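(* Let $\beta>0$, $z>0$, let $u$ be a superstable pair potential on $\mathbb{R}^d$ (as defined in the context) and let $\mathsf{G}$ be a $(\beta,z,u)$-Gibbs point process, with $\rho_2(x)=\rho^{(2)}(x,0)$ its pair correlation function. For $\ell>0$ let $\Lambda=B_\ell(0)$, and for a function $v:\mathbb{R}^d\to\mathbb{R}$ let $V_\Lambda(\gamma)=\sum_{x_1\neq x_2\in\gamma}1_\Lambda(x_1)1_\Lambda(x_2)\,v(x_1-x_2)$. Then there exists a constant $c>0$ such that $$\liminf_{\ell\to\infty}\frac{\mathbb{V}\mathrm{ar}\bigl[V_\Lambda\bigr]}{|\Lambda|}\;\ge\;\frac{c}{\|v\|_{L^2}^2}\Bigl(\int_{\mathbb{R}^d}v(x)^2\rho_2(x)\,\mathrm{d}x\Bigr)^2$$ for every even function $v\in L^1(\mathbb{R}^d)\cap L^2(\mathbb{R}^d)\setminus\{0\}$.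
   Context: $|\cdot|$ denotes Lebesgue measure, $B_\ell(0)$ the ball of radius $\ell$ around the origin. $\Gamma$ is the set of locally finite subsets $\gamma\subset\mathbb{R}^d$ with the $\sigma$-algebra generated by the counting maps $\gamma\mapsto\#(\gamma\cap\triangle)$, $\triangle$ bounded (Borel); a point process is a probability measure on $\Gamma$, stationary if invariant under all translations. Correlation functions $\rho^{(n)}\ge0$ are defined by $\mathbb{E}\bigl[\sum_{x_1\neq\dots\neq x_n\in\gamma}G(x_1,\dots,x_n)\bigr]=\int_{(\mathbb{R}^d)^n}G\,\rho^{(n)}\,\mathrm{d}x_1\cdots\mathrm{d}x_n$ for all measurable $G\ge0$ (sum over $n$-tuples of pairwise distinct points). Superstable pair potential: an even function $u:\mathbb{R}^d\to\mathbb{R}\cup\{+\infty\}$ with $u(0)=+\infty$ for which there are $r_0>0$ and decreasing positive functions $\varphi:(0,r_0)\to(0,\infty)$, $\psi:[0,\infty)\to(0,\infty)$ with $\int_0^{r_0}r^{d-1}\varphi(r)\,\mathrm{d}r=+\infty$, $\int_{r_0}^\infty r^{d-1}\psi(r)\,\mathrm{d}r<\infty$, $u(x)\ge\varphi(|x|)$ for $0<|x|<r_0$, and $|u(x)|\le\psi(|x|)$ for $|x|\ge r_0$. For $x\in\mathbb{R}^d$, $\eta\in\Gamma$ let $W(x\mid\eta)=\sum_{y\in\eta}u(x-y)$ if $\sum_{y\in\eta}|u(x-y)|<\infty$ and $W(x\mid\eta)=+\infty$ otherwise (with $e^{-\infty}=0$). A $(\beta,z,u)$-Gibbs point process is a stationary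 point process with $$\mathbb{E}\Bigl[\sum_{x\in\gamma}G(x,\gamma)\Bigr]=\mathbb{E}\Bigl[z\int_{\mathbb{R}^d}G(x,\gamma\cup\{x\})\,e^{-\beta W(x\mid\gamma)}\,\mathrm{d}x\Bigr]$$ for every measurable $G:\mathbb{R}^d\times\Gamma\to[0,\infty]$. Its correlation functions exist and it is known (Ruelle) that they satisfy $\rho^{(n)}\le q^n$ for all $n$ and some $q=q(\beta,z,u)>0$. *)

theory Defs
  imports "HOL-Probability.Probability"
begin

section \<open>Point processes\<close>

definition locally_finite_sets :: "'a::euclidean_space set set" where
  "locally_finite_sets = {\<gamma>. \<forall>\<Delta>. bounded \<Delta> \<longrightarrow> finite (\<gamma> \<inter> \<Delta>)}"

text \<open>The counting maps take values in a countable discrete space, so the \<sigma>-algebra they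
  generate is the one generated by their fibres.\<close>

definition config_space :: "'a::euclidean_space set measure" where
  "config_space = sigma locally_finite_sets
     {{\<gamma> \<in> locally_finite_sets. card (\<gamma> \<inter> \<Delta>) = k} | \<Delta> k. \<Delta> \<in> sets borel \<and> bounded \<Delta>}"

definition point_process :: "'a::euclidean_space set measure \<Rightarrow> bool" where
  "point_process G \<longleftrightarrow> prob_space G \<and> sets G = sets config_space"

definition stationary :: "'a::euclidean_space set measure \<Rightarrow> bool" where
  "stationary G \<longleftrightarrow> (\<forall>a. distr G config_space (\<lambda>\<gamma>. (\<lambda>x. x + a) ` \<gamma>) = G)"


section \<open>Correlation functions\<close>

text \<open>Points of the \<open>n\<close>-fold product of \<open>'a\<close> are extensional functions on \<open>{..<n}\<close>.
  Sums of nonnegative extended reals are integrals with respect to counting measure.\<close>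

definition distinct_tuples :: "nat \<Rightarrow> 'a set \<Rightarrow> (nat \<Rightarrow> 'a) set" where
  "distinct_tuples n \<gamma> = {x \<in> {..<n} \<rightarrow>\<^sub>E \<gamma>. inj_on x {..<n}}"

definition is_correlation_function ::
    "'a::euclidean_space set measure \<Rightarrow> nat \<Rightarrow> ((nat \<Rightarrow> 'a) \<Rightarrow> real) \<Rightarrow> bool" where
  "is_correlation_function G n r \<longleftrightarrow>
     r \<in> borel_measurable (PiM {..<n} (\<lambda>_. lborel)) \<and>
     (\<forall>x. 0 \<le> r x) \<and>
     (\<forall>F :: (nat \<Rightarrow> 'a) \<Rightarrow> ennreal. F \<in> borel_measurable (PiM {..<n} (\<lambda>_. lborel)) \<longrightarrow>
        (\<integral>\<^sup>+\<gamma>. (\<integral>\<^sup>+x. F x \<partial>count_space (distinct_tuples n \<gamma>)) \<partial>G)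
      = (\<integral>\<^sup>+x. F x * ennreal (r x) \<partial>PiM {..<n} (\<lambda>_. lborel)))"

text \<open>A correlation function is determined only up to null sets, hence the bound is required
  almost everywhere.\<close>

definition ruelle_bound :: "(nat \<Rightarrow> (nat \<Rightarrow> 'a::euclidean_space) \<Rightarrow> real) \<Rightarrow> bool" where
  "ruelle_bound \<rho> \<longleftrightarrow>
     (\<exists>q>0. \<forall>n\<ge>1. AE x in PiM {..<n} (\<lambda>_. lborel). \<rho> n x \<le> q ^ n)"

definition pair_point :: "'a \<Rightarrow> 'a \<Rightarrow> nat \<Rightarrow> 'a" where
  "pair_point x y = (\<lambda>i\<in>{..<2}. if i = 0 then x else y)"

text \<open>The points \<open>(x, 0)\<close> form a null set of the product space, so \<open>pair_correlation\<close> is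
  meaningful only for a version of the second correlation function that is invariant under
  translations everywhere (which exists for stationary processes and is unique up to a null set
  of differences).\<close>

definition translation_invariant2 :: "((nat \<Rightarrow> 'a::euclidean_space) \<Rightarrow> real) \<Rightarrow> bool" where
  "translation_invariant2 r \<longleftrightarrow>
     (\<forall>x y a. r (pair_point (x + a) (y + a)) = r (pair_point x y))"

definition pair_correlation ::
    "(nat \<Rightarrow> (nat \<Rightarrow> 'a::euclidean_space) \<Rightarrow> real) \<Rightarrow> 'a \<Rightarrow> real" where
  "pair_correlation \<rho> x = \<rho> 2 (pair_point x 0)"


section \<open>Superstable potentials and Gibbs point processes\<close>

definition superstable :: "('a::euclidean_space \<Rightarrow> ereal) \<Rightarrow> bool" where
  "superstable u \<longleftrightarrow>
     u \<in> borel_measurable borel \<and>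
     (\<forall>x. u x \<noteq> -\<infinity>) \<and> (\<forall>x. u (- x) = u x) \<and> u 0 = \<infinity> \<and>
     (\<exists>r0 (\<phi> :: real \<Rightarrow> real) (\<psi> :: real \<Rightarrow> real). 0 < r0 \<and>
        antimono_on {0<..<r0} \<phi> \<and> (\<forall>r\<in>{0<..<r0}. 0 < \<phi> r) \<and>
        antimono_on {0..} \<psi> \<and> (\<forall>r\<in>{0..}. 0 < \<psi> r) \<and>
        (\<integral>\<^sup>+r\<in>{0<..<r0}. ennreal (r ^ (DIM('a) - 1) * \<phi> r) \<partial>lborel) = \<infinity> \<and>
        (\<integral>\<^sup>+r\<in>{r0..}. ennreal (r ^ (DIM('a) - 1) * \<psi> r) \<partial>lborel) < \<infinity> \<and>
        (\<forall>x. 0 < norm x \<and> norm x < r0 \<longrightarrow> ereal (\<phi> (norm x)) \<le> u x) \<and>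
        (\<forall>x. r0 \<le> norm x \<longrightarrow> \<bar>u x\<bar> \<le> ereal (\<psi> (norm x))))"

text \<open>In the first case all terms of the sum are finite and the sum converges absolutely.\<close>

definition interaction :: "('a::euclidean_space \<Rightarrow> ereal) \<Rightarrow> 'a \<Rightarrow> 'a set \<Rightarrow> ereal" where
  "interaction u x \<eta> =
     (if (\<integral>\<^sup>+y. e2ennreal \<bar>u (x - y)\<bar> \<partial>count_space \<eta>) < \<infinity>
      then ereal (\<Sum>\<^sub>\<infinity>y\<in>\<eta>. real_of_ereal (u (x - y))) else \<infinity>)"

definition boltzmann :: "real \<Rightarrow> ereal \<Rightarrow> ennreal" where
  "boltzmann \<beta> w = (if w = \<infinity> then 0 else ennreal (exp (- \<beta> * real_of_ereal w)))"

definition gibbs_process ::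
    "real \<Rightarrow> real \<Rightarrow> ('a::euclidean_space \<Rightarrow> ereal) \<Rightarrow> 'a set measure \<Rightarrow> bool" where
  "gibbs_process \<beta> z u G \<longleftrightarrow>
     point_process G \<and> stationary G \<and>
     (\<forall>F :: 'a \<times> 'a set \<Rightarrow> ennreal. F \<in> borel_measurable (borel \<Otimes>\<^sub>M config_space) \<longrightarrow>
        (\<integral>\<^sup>+\<gamma>. (\<integral>\<^sup>+x. F (x, \<gamma>) \<partial>count_space \<gamma>) \<partial>G)
      = (\<integral>\<^sup>+\<gamma>. ennreal z * (\<integral>\<^sup>+x. F (x, insert x \<gamma>) * boltzmann \<beta> (interaction u x \<gamma>) \<partial>lborel) \<partial>G))"


section \<open>Pair energy\<close>

text \<open>The sum runs over ordered pairs; it is finite for locally finite \<open>\<gamma>\<close> and bounded \<open>\<Lambda>\<close>.\<close>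

definition pair_energy ::
    "('a::euclidean_space \<Rightarrow> real) \<Rightarrow> 'a set \<Rightarrow> 'a set \<Rightarrow> real" where
  "pair_energy v \<Lambda> \<gamma> =
     (\<Sum>(x, y)\<in>{(x, y). x \<in> \<gamma> \<inter> \<Lambda> \<and> y \<in> \<gamma> \<inter> \<Lambda> \<and> x \<noteq> y}. v (x - y))"

end

(*
  The variance of the pair energy V is bounded from below by the Cauchy-Schwarz inequality
  Var[V] >= Cov[V, F]^2 / E[F^2] with a test functional F that is a second order innovation: with the
  Papangelou intensity p(x | gamma) = z exp(-beta W(x | gamma)) and g(x, y) a truncation of v(x - y),

    F = sum_x h(x, gamma - x) - int h(x, gamma) p(x | gamma) dx,
    h(x, gamma) = sum_y g(x, y) - int g(x, y) p(y | gamma + x) dy,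

  all sums and integrals being restricted to the ball.  The Georgii-Nguyen-Zessin equation, read as
  integration by parts, gives E[V F] = 2 E[sum g(x, y) v(x - y)], because the second difference of V
  is the deterministic function 2 v(x - y).  It also gives a Skorohod type isometry for E[F^2].  Since
  p(y | gamma + x) = p(y | gamma) e(x - y) with e = exp(-beta u) and e - 1 integrable, every
  correction term in this isometry is a quadratic form in g linked through integrable kernels, and
  E[F^2] <= const |Lambda| ||v||_2^2 with a constant that does not see v.  The moments of p that enter
  here are finite because Ruelle's bound controls the exponential moments of sums
  sum_y psi(|x - y|) over the points of the process.
*)
theory Submission
  imports Defs
begin

section \<open>Measurability on the configuration space\<close>

text \<open>A first order innovation would not do: its covariance with V is linear in v, and v has
  no sign, so the terms could cancel. The second difference turns the covariance into a sum of
  products g * v, and since g equals v wherever it is nonzero, this is a sum of squares. The price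
  is that the isometry is needed for F under P and again for h(x, .) under P weighted by p(x | .) or
  by p(x | .) p(y | .). The function h(x, .) is centred for the first of these weights but not for
  the second; the defect is the \<open>remainder\<close>. As e - 1 has no sign either, all
  corrections are estimated in absolute value. Two kinds of bounds are kept apart. \<open>Z\<close>
  dominates everything in one fixed window and only guarantees integrability; \<open>K\<close>,
  \<open>C\<close> and \<open>\<Phi>\<close> are the same for all windows and alone enter the final
  constant. V itself is never truncated, only g is: g must be bounded so that F has moments, and of
  bounded support so that the boundary layer of the ball is negligible in the limit.\<close>

lemma space_config [simp]: "space config_space = locally_finite_sets"
  unfolding config_space_def by (auto intro!: space_measure_of simp: locally_finite_sets_def)

lemma finite_Int_bounded: "\<gamma> \<in> locally_finite_sets \<Longrightarrow> bounded B \<Longrightarrow> finite (\<gamma> \<inter> B)"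
  by (auto simp: locally_finite_sets_def)

lemma locally_finite_insert [simp]:
  "\<gamma> \<in> locally_finite_sets \<Longrightarrow> insert x \<gamma> \<in> locally_finite_sets"
  by (auto simp: locally_finite_sets_def Int_insert_left)

lemma locally_finite_Diff [simp]:
  "\<gamma> \<in> locally_finite_sets \<Longrightarrow> \<gamma> - A \<in> locally_finite_sets"
  unfolding locally_finite_sets_def by (auto intro: finite_subset[rotated])

lemma countable_locally_finite:
  assumes "\<gamma> \<in> locally_finite_sets" shows "countable \<gamma>"
proof -
  have "\<gamma> = (\<Union>n::nat. \<gamma> \<inter> cball 0 (real n))"
    using real_arch_simple by fastforce
  moreover have "countable (\<gamma> \<inter> cball 0 (real n))" for n :: nat
    using assms by (intro countable_finite finite_Int_bounded) auto
  ultimately show ?thesis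
    by (metis countable_UN uncountable_def countableI_type)
qed

lemma measurable_card_config:
  assumes "\<Gamma> \<in> M \<rightarrow>\<^sub>M config_space" "B \<in> sets borel" "bounded B"
  shows "(\<lambda>m. card (\<Gamma> m \<inter> B)) \<in> M \<rightarrow>\<^sub>M count_space UNIV"
proof -
  have "{\<gamma> \<in> locally_finite_sets. card (\<gamma> \<inter> B) = k} \<in> sets (config_space :: 'b set measure)" for k
    unfolding config_space_def using assms(2,3)
    by (subst sets_measure_of) (auto simp: locally_finite_sets_def)
  then have "(\<lambda>\<gamma>. card (\<gamma> \<inter> B)) \<in> (config_space :: 'b set measure) \<rightarrow>\<^sub>M count_space UNIV"
    by (subst measurable_count_space_eq2_countable)
      (auto simp: vimage_def Int_def conj_commute)
  from measurable_compose[OF assms(1) this] show ?thesis .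
qed

lemma measurable_configI:
  assumes "\<And>m. m \<in> space M \<Longrightarrow> \<Gamma> m \<in> locally_finite_sets"
    and "\<And>B. B \<in> sets borel \<Longrightarrow> bounded B \<Longrightarrow>
      (\<lambda>m. card (\<Gamma> m \<inter> B)) \<in> M \<rightarrow>\<^sub>M count_space UNIV"
  shows "\<Gamma> \<in> M \<rightarrow>\<^sub>M config_space"
  unfolding config_space_def
proof (rule measurable_measure_of)
  fix X assume "X \<in> {{\<gamma> \<in> locally_finite_sets. card (\<gamma> \<inter> B) = k} | B k.
    B \<in> sets borel \<and> bounded (B :: 'b set)}"
  then obtain B k where X: "X = {\<gamma> \<in> locally_finite_sets. card (\<gamma> \<inter> B) = k}"
    "B \<in> sets borel" "bounded B" by auto
  have "\<Gamma> -` X \<inter> space M = (\<lambda>m. card (\<Gamma> m \<inter> B)) -` {k} \<inter> space M"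
    using assms(1) by (auto simp: X)
  also have "\<dots> \<in> sets M"
    by (rule measurable_sets[OF assms(2)[OF X(2,3)]]) auto
  finally show "\<Gamma> -` X \<inter> space M \<in> sets M" .
qed (use assms(1) in \<open>auto simp: locally_finite_sets_def\<close>)

text \<open>The counting measures on \<open>\<Gamma> m \<inter> B\<close> have finite but unbounded
  mass. Division by \<open>1 + card\<close> turns them into a subprobability kernel
  \<open>\<kappa>\<close>, to which the measurability theorem for \<open>subprob_algebra\<close>
  applies; the factor is measurable itself and is multiplied back at the end.\<close>

lemma nn_integral_count_bounded_measurable:
  fixes H :: "'m \<Rightarrow> 'a::euclidean_space \<Rightarrow> ennreal"
  assumes H: "case_prod H \<in> borel_measurable (M \<Otimes>\<^sub>M borel)"
    and \<Gamma>: "\<Gamma> \<in> M \<rightarrow>\<^sub>M config_space" and B: "B \<in> sets borel" "bounded B"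
  shows "(\<lambda>m. \<integral>\<^sup>+x. H m x \<partial>count_space (\<Gamma> m \<inter> B)) \<in> borel_measurable M"
proof -
  define \<kappa> where "\<kappa> m = scale_measure (1 / ennreal (1 + real (card (\<Gamma> m \<inter> B))))
    (distr (count_space (\<Gamma> m \<inter> B)) borel (\<lambda>x. x))" for m
  have fin: "finite (\<Gamma> m \<inter> B)" if "m \<in> space M" for m
    using measurable_space[OF \<Gamma> that] B by (auto intro: finite_Int_bounded)
  have em: "emeasure (\<kappa> m) A = 1 / ennreal (1 + real (card (\<Gamma> m \<inter> B))) * real (card (\<Gamma> m \<inter> (B \<inter> A)))"
    if "m \<in> space M" "A \<in> sets borel" for m A
  proof -
    have "finite (\<Gamma> m \<inter> B \<inter> A)" using fin[OF that(1)] by simp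
    then have "emeasure (count_space (\<Gamma> m \<inter> B)) (\<Gamma> m \<inter> B \<inter> A) = real (card (\<Gamma> m \<inter> (B \<inter> A)))"
      by (subst emeasure_count_space_finite) (auto simp: Int_assoc ennreal_of_nat_eq_real_of_nat)
    moreover have "emeasure (distr (count_space (\<Gamma> m \<inter> B)) borel (\<lambda>x. x)) A
        = emeasure (count_space (\<Gamma> m \<inter> B)) (\<Gamma> m \<inter> B \<inter> A)"
      using that by (subst emeasure_distr) (auto simp: Int_commute)
    ultimately have "emeasure (distr (count_space (\<Gamma> m \<inter> B)) borel (\<lambda>x. x)) A = real (card (\<Gamma> m \<inter> (B \<inter> A)))"
      by simp
    then show ?thesis by (simp add: \<kappa>_def)
  qed
  have \<kappa>: "\<kappa> \<in> M \<rightarrow>\<^sub>M subprob_algebra borel"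
  proof (rule measurable_subprob_algebra)
    fix m assume m: "m \<in> space M"
    show "subprob_space (\<kappa> m)"
    proof
      have "emeasure (\<kappa> m) UNIV = 1 / ennreal (1 + real (card (\<Gamma> m \<inter> B))) * real (card (\<Gamma> m \<inter> B))"
        using em[OF m, of UNIV] by simp
      also have "\<dots> = ennreal (real (card (\<Gamma> m \<inter> B)) / (1 + real (card (\<Gamma> m \<inter> B))))"
        by (subst ennreal_1[symmetric], subst divide_ennreal)
          (auto simp: ennreal_mult'[symmetric] simp del: ennreal_1)
      also have "\<dots> \<le> 1" by (subst ennreal_1[symmetric]) (intro ennreal_leI, simp add: field_simps)
      also have "UNIV = space (\<kappa> m)" by (simp add: \<kappa>_def space_scale_measure)
      finally show "emeasure (\<kappa> m) (space (\<kappa> m)) \<le> 1" .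
      show "space (\<kappa> m) \<noteq> {}" by (simp add: \<kappa>_def space_scale_measure)
    qed
    show "sets (\<kappa> m) = sets borel" by (simp add: \<kappa>_def)
  next
    fix A :: "'a set" assume A: "A \<in> sets borel"
    note [measurable] = measurable_card_config[OF \<Gamma> B]
      measurable_card_config[OF \<Gamma> sets.Int[OF B(1) A] bounded_Int[OF disjI1[OF B(2)]]]
    have "(\<lambda>m. 1 / ennreal (1 + real (card (\<Gamma> m \<inter> B))) * real (card (\<Gamma> m \<inter> (B \<inter> A)))) \<in> borel_measurable M"
      by measurable
    then show "(\<lambda>m. emeasure (\<kappa> m) A) \<in> borel_measurable M"
      by (subst measurable_cong[OF em[OF _ A]])
  qed
  note [measurable] = measurable_card_config[OF \<Gamma> B]
  have int[measurable]: "(\<lambda>m. \<integral>\<^sup>+x. H m x \<partial>\<kappa> m) \<in> borel_measurable M"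
    by (rule nn_integral_measurable_subprob_algebra2[OF H \<kappa>])
  have "(\<integral>\<^sup>+x. H m x \<partial>count_space (\<Gamma> m \<inter> B)) =
     ennreal (1 + real (card (\<Gamma> m \<inter> B))) * (\<integral>\<^sup>+x. H m x \<partial>\<kappa> m)" if m: "m \<in> space M" for m
  proof -
    have [measurable]: "H m \<in> borel_measurable borel" using measurable_Pair2[OF H m] by simp
    have inv: "ennreal (1 + r) * (1 / ennreal (1 + r)) = 1" if "0 \<le> r" for r
    proof -
      have "1 / ennreal (1 + r) = ennreal (1 / (1 + r))"
        using divide_ennreal[of 1 "1 + r"] that by (simp del: ennreal_plus)
      then show ?thesis using that by (simp add: ennreal_mult'[symmetric] del: ennreal_plus)
    qed
    have "ennreal (1 + real (card (\<Gamma> m \<inter> B))) * (1 / ennreal (1 + real (card (\<Gamma> m \<inter> B)))) = 1"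
      by (rule inv) simp
    then show ?thesis
      by (simp add: \<kappa>_def nn_integral_scale_measure nn_integral_distr mult.assoc[symmetric])
  qed
  then show ?thesis by (subst measurable_cong) auto
qed

lemma nn_integral_count_space_exhaust:
  fixes f :: "'a::euclidean_space \<Rightarrow> ennreal"
  shows "(\<integral>\<^sup>+x. f x \<partial>count_space \<gamma>) = (SUP n::nat. \<integral>\<^sup>+x. f x \<partial>count_space (\<gamma> \<inter> cball 0 (real n)))"
proof -
  have "(SUP n::nat. \<integral>\<^sup>+x. f x \<partial>count_space (\<gamma> \<inter> cball 0 (real n)))
     = (SUP n::nat. \<integral>\<^sup>+x. f x * indicator (cball 0 (real n)) x \<partial>count_space \<gamma>)"
    by (intro SUP_cong refl) (auto simp: nn_integral_count_space_indicator indicator_inter_arith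
       nn_integral_restrict_space[symmetric] restrict_count_space Int_ac)
  also have "\<dots> = (\<integral>\<^sup>+x. (SUP n::nat. f x * indicator (cball 0 (real n)) x) \<partial>count_space \<gamma>)"
    by (rule nn_integral_monotone_convergence_SUP[symmetric])
      (auto simp: incseq_def le_fun_def indicator_def)
  also have "(\<lambda>x. SUP n::nat. f x * indicator (cball 0 (real n)) x) = f"
  proof (intro ext antisym)
    fix x
    show "(SUP n::nat. f x * indicator (cball 0 (real n)) x) \<le> f x"
      by (rule SUP_least) (auto simp: indicator_def)
    obtain n where "norm x \<le> real n" using real_arch_simple by blast
    then show "f x \<le> (SUP n::nat. f x * indicator (cball 0 (real n)) x)"
      by (intro SUP_upper2[of n]) auto
  qed
  finally show ?thesis by simp
qed

lemma nn_integral_count_measurable [measurable (raw)]: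
  fixes H :: "'m \<Rightarrow> 'a::euclidean_space \<Rightarrow> ennreal"
  assumes H: "case_prod H \<in> borel_measurable (M \<Otimes>\<^sub>M borel)"
    and \<Gamma>: "\<Gamma> \<in> M \<rightarrow>\<^sub>M config_space"
  shows "(\<lambda>m. \<integral>\<^sup>+x. H m x \<partial>count_space (\<Gamma> m)) \<in> borel_measurable M"
  by (subst nn_integral_count_space_exhaust)
    (intro borel_measurable_SUP countableI_type nn_integral_count_bounded_measurable[OF H \<Gamma>], auto)

text \<open>Membership is detected by counting: the integral over \<open>\<Gamma> m\<close> of the
  indicator of the singleton \<open>{f m}\<close> is 1 or 0.\<close>

lemma measurable_mem_config:
  fixes f :: "'m \<Rightarrow> 'a::euclidean_space"
  assumes f[measurable]: "f \<in> M \<rightarrow>\<^sub>M borel" and \<Gamma>: "\<Gamma> \<in> M \<rightarrow>\<^sub>M config_space"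
  shows "Measurable.pred M (\<lambda>m. f m \<in> \<Gamma> m)"
proof -
  have 1: "(\<lambda>m. \<integral>\<^sup>+x. indicator {x. x = f m} x \<partial>count_space (\<Gamma> m)) \<in> borel_measurable M"
    by (rule nn_integral_count_measurable[OF _ \<Gamma>]) (simp add: indicator_def, measurable)
  have "(\<integral>\<^sup>+x. indicator {x. x = f m} x \<partial>count_space (\<Gamma> m)) = (if f m \<in> \<Gamma> m then 1 else 0)" for m
  proof -
    have "{x. x = f m} \<inter> \<Gamma> m = (if f m \<in> \<Gamma> m then {f m} else {})" by auto
    then show ?thesis by (subst nn_integral_indicator') (auto simp: emeasure_count_space)
  qed
  then have [measurable]: "(\<lambda>m. if f m \<in> \<Gamma> m then 1 else 0 :: ennreal) \<in> borel_measurable M"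
    using 1 by simp
  have "Measurable.pred M (\<lambda>m. (if f m \<in> \<Gamma> m then 1 else 0 :: ennreal) = 1)" by measurable
  also have "(\<lambda>m. (if f m \<in> \<Gamma> m then 1 else 0 :: ennreal) = 1) = (\<lambda>m. f m \<in> \<Gamma> m)"
    by auto
  finally show ?thesis .
qed

lemma measurable_Int_config:
  fixes B :: "'a::euclidean_space set"
  assumes \<Gamma>: "\<Gamma> \<in> M \<rightarrow>\<^sub>M config_space" and B: "B \<in> sets borel"
  shows "(\<lambda>m. \<Gamma> m \<inter> B) \<in> M \<rightarrow>\<^sub>M config_space"
proof (rule measurable_configI)
  fix m assume "m \<in> space M"
  then have "\<Gamma> m \<in> locally_finite_sets" using measurable_space[OF \<Gamma>] by simp
  then show "\<Gamma> m \<inter> B \<in> locally_finite_sets"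
    unfolding locally_finite_sets_def by (auto simp: Int_assoc intro: finite_subset[rotated])
next
  fix C :: "'a set" assume "C \<in> sets borel" "bounded C"
  then show "(\<lambda>m. card (\<Gamma> m \<inter> B \<inter> C)) \<in> M \<rightarrow>\<^sub>M count_space UNIV"
    using measurable_card_config[OF \<Gamma>, of "B \<inter> C"] B by (auto simp: Int_assoc)
qed

lemma measurable_insert_config [measurable (raw)]:
  fixes f :: "'m \<Rightarrow> 'a::euclidean_space"
  assumes f[measurable]: "f \<in> M \<rightarrow>\<^sub>M borel" and \<Gamma>[measurable]: "\<Gamma> \<in> M \<rightarrow>\<^sub>M config_space"
  shows "(\<lambda>m. insert (f m) (\<Gamma> m)) \<in> M \<rightarrow>\<^sub>M config_space"
proof (rule measurable_configI)
  show lf: "insert (f m) (\<Gamma> m) \<in> locally_finite_sets" if "m \<in> space M" for m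
    using measurable_space[OF \<Gamma> that] by simp
  fix B :: "'a set" assume [measurable]: "B \<in> sets borel" and B: "bounded B"
  note [measurable (raw)] = measurable_mem_config
  note [measurable] = measurable_card_config[OF \<Gamma> \<open>B \<in> sets borel\<close> B]
  have eq: "card (insert (f m) (\<Gamma> m) \<inter> B) =
      (if f m \<in> B \<and> f m \<notin> \<Gamma> m then Suc (card (\<Gamma> m \<inter> B)) else card (\<Gamma> m \<inter> B))"
    if "m \<in> space M" for m
    using measurable_space[OF \<Gamma> that] B
        by (auto simp: finite_Int_bounded card_insert_if Int_insert_left insert_absorb)
  have "(\<lambda>m. if f m \<in> B \<and> f m \<notin> \<Gamma> m then Suc (card (\<Gamma> m \<inter> B)) else card (\<Gamma> m \<inter> B)) \<in> M \<rightarrow>\<^sub>M count_space UNIV"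
    by measurable
  then show "(\<lambda>m. card (insert (f m) (\<Gamma> m) \<inter> B)) \<in> M \<rightarrow>\<^sub>M count_space UNIV"
    by (subst measurable_cong[OF eq])
qed

lemma measurable_delete_config [measurable (raw)]:
  fixes f :: "'m \<Rightarrow> 'a::euclidean_space"
  assumes f[measurable]: "f \<in> M \<rightarrow>\<^sub>M borel" and \<Gamma>[measurable]: "\<Gamma> \<in> M \<rightarrow>\<^sub>M config_space"
  shows "(\<lambda>m. \<Gamma> m - {f m}) \<in> M \<rightarrow>\<^sub>M config_space"
proof (rule measurable_configI)
  show lf: "\<Gamma> m - {f m} \<in> locally_finite_sets" if "m \<in> space M" for m
    using measurable_space[OF \<Gamma> that] by simp
  fix B :: "'a set" assume [measurable]: "B \<in> sets borel" and B: "bounded B"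
  note [measurable (raw)] = measurable_mem_config
  note [measurable] = measurable_card_config[OF \<Gamma> \<open>B \<in> sets borel\<close> B]
  have eq: "card ((\<Gamma> m - {f m}) \<inter> B) =
      (if f m \<in> B \<and> f m \<in> \<Gamma> m then card (\<Gamma> m \<inter> B) - 1 else card (\<Gamma> m \<inter> B))"
    if "m \<in> space M" for m
  proof -
    have "(\<Gamma> m - {f m}) \<inter> B = \<Gamma> m \<inter> B - {f m}" by auto
    then show ?thesis by (simp add: card_Diff_singleton_if)
  qed
  have "(\<lambda>m. if f m \<in> B \<and> f m \<in> \<Gamma> m then card (\<Gamma> m \<inter> B) - 1 else card (\<Gamma> m \<inter> B)) \<in> M \<rightarrow>\<^sub>M count_space UNIV"
    by measurable
  then show "(\<lambda>m. card ((\<Gamma> m - {f m}) \<inter> B)) \<in> M \<rightarrow>\<^sub>M count_space UNIV"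
    by (subst measurable_cong[OF eq])
qed

text \<open>Positive and negative parts reduce the claim to the nonnegative case. Both have finite
  sums because \<open>\<Gamma> m \<inter> B\<close> is finite, so the \<open>enn2real\<close> values
  may be subtracted.\<close>

lemma sum_config_measurable:
  fixes H :: "'m \<Rightarrow> 'a::euclidean_space \<Rightarrow> real"
  assumes H[measurable]: "case_prod H \<in> borel_measurable (M \<Otimes>\<^sub>M borel)"
    and \<Gamma>[measurable]: "\<Gamma> \<in> M \<rightarrow>\<^sub>M config_space" and B: "B \<in> sets borel" "bounded B"
  shows "(\<lambda>m. \<Sum>x\<in>\<Gamma> m \<inter> B. H m x) \<in> borel_measurable M"
proof -
  note [measurable] = measurable_Int_config[OF \<Gamma> B(1)]
  have [measurable]: "(\<lambda>m. \<integral>\<^sup>+x. ennreal (H m x) \<partial>count_space (\<Gamma> m \<inter> B)) \<in> borel_measurable M"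
    "(\<lambda>m. \<integral>\<^sup>+x. ennreal (- H m x) \<partial>count_space (\<Gamma> m \<inter> B)) \<in> borel_measurable M"
    by (rule nn_integral_count_bounded_measurable[OF _ \<Gamma> B], measurable)+
  have "(\<Sum>x\<in>\<Gamma> m \<inter> B. H m x) = enn2real (\<integral>\<^sup>+x. ennreal (H m x) \<partial>count_space (\<Gamma> m \<inter> B))
      - enn2real (\<integral>\<^sup>+x. ennreal (- H m x) \<partial>count_space (\<Gamma> m \<inter> B))" if m: "m \<in> space M" for m
  proof -
    have fin: "finite (\<Gamma> m \<inter> B)"
      using measurable_space[OF \<Gamma> m] B by (auto intro: finite_Int_bounded)
    have pos: "(\<integral>\<^sup>+x. ennreal (F x) \<partial>count_space (\<Gamma> m \<inter> B)) = ennreal (\<Sum>x\<in>\<Gamma> m \<inter> B. max 0 (F x))" for F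
    proof -
      have "(\<integral>\<^sup>+x. ennreal (F x) \<partial>count_space (\<Gamma> m \<inter> B)) = (\<Sum>x\<in>\<Gamma> m \<inter> B. ennreal (F x))"
        by (rule nn_integral_count_space_finite[OF fin])
      also have "\<dots> = (\<Sum>x\<in>\<Gamma> m \<inter> B. ennreal (max 0 (F x)))"
        by (intro sum.cong) (auto simp: max_def ennreal_neg)
      also have "\<dots> = ennreal (\<Sum>x\<in>\<Gamma> m \<inter> B. max 0 (F x))"
        by (rule sum_ennreal) simp
      finally show ?thesis .
    qed
    have "(\<Sum>x\<in>\<Gamma> m \<inter> B. H m x) = (\<Sum>x\<in>\<Gamma> m \<inter> B. max 0 (H m x)) - (\<Sum>x\<in>\<Gamma> m \<inter> B. max 0 (- H m x))"
      by (subst sum_subtractf[symmetric]) (auto intro!: sum.cong simp: max_def)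
    then show ?thesis by (simp only: pos enn2real_ennreal[OF sum_nonneg] max.cobounded1)
  qed
  then show ?thesis by (subst measurable_cong) auto
qed

section \<open>Innovations of a process with Papangelou intensity\<close>

text \<open>For a nonintegrable \<open>f\<close> the Bochner integral is 0 by convention, which the
  bound covers as well.\<close>

lemma ennreal_integral_le: "ennreal (integral\<^sup>L M f) \<le> (\<integral>\<^sup>+x. ennreal \<bar>f x\<bar> \<partial>M)"
proof (cases "integrable M f")
  case True
  then have "norm (integral\<^sup>L M f) \<le> (\<integral>\<^sup>+x. norm (f x) \<partial>M)" 
    by (rule integral_norm_bound_ennreal)
  moreover have "ennreal (integral\<^sup>L M f) \<le> ennreal (norm (integral\<^sup>L M f))" by (intro ennreal_leI) auto
  ultimately have "ennreal (integral\<^sup>L M f) \<le> (\<integral>\<^sup>+x. norm (f x) \<partial>M)" by (rule order_trans[rotated])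
  then show ?thesis by simp
qed (simp add: not_integrable_integral_eq)

text \<open>The dominating function \<open>Z\<close> may depend on \<open>\<Lambda>\<close>; the constants \<open>K\<close>, \<open>C\<close> and \<open>\<Phi>\<close>, which
  enter the final bound, must not.\<close>

locale papangelou = prob_space P for P :: "'a::euclidean_space set measure" +
  fixes \<Lambda> :: "'a set" and p :: "'a \<Rightarrow> 'a set \<Rightarrow> real" and e :: "'a \<Rightarrow> real"
    and Z :: "'a set \<Rightarrow> real" and K C \<Phi> :: real
  assumes sets_P [measurable_cong]: "sets P = sets config_space"
    and \<Lambda>_borel [measurable]: "\<Lambda> \<in> sets borel" and bounded_\<Lambda>: "bounded \<Lambda>"
    and p_pair_measurable: "case_prod p \<in> borel_measurable (borel \<Otimes>\<^sub>M config_space)"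
    and p_nonneg [simp]: "\<And>x \<gamma>. 0 \<le> p x \<gamma>"
    and p_insert: "\<And>x y \<gamma>. \<gamma> \<in> locally_finite_sets \<Longrightarrow> x \<notin> \<gamma> \<Longrightarrow> p y (insert x \<gamma>) = p y \<gamma> * e (y - x)"
    and e_measurable [measurable]: "e \<in> borel_measurable borel"
    and e_nonneg [simp]: "\<And>x. 0 \<le> e x" and e_le: "\<And>x. e x \<le> K" and e_even: "\<And>x. e (- x) = e x"
    and K_ge_1: "1 \<le> K"
    and GNZ: "\<And>H :: 'a \<times> 'a set \<Rightarrow> ennreal. H \<in> borel_measurable (borel \<Otimes>\<^sub>M config_space) \<Longrightarrow>
      (\<integral>\<^sup>+\<gamma>. (\<integral>\<^sup>+x. H (x, \<gamma> - {x}) \<partial>count_space \<gamma>) \<partial>P)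
      = (\<integral>\<^sup>+\<gamma>. (\<integral>\<^sup>+x. H (x, \<gamma>) * ennreal (p x \<gamma>) \<partial>lborel) \<partial>P)"
    and Z_measurable [measurable]: "Z \<in> borel_measurable config_space"
    and Z_ge_1: "\<And>\<gamma>. 1 \<le> Z \<gamma>"
    and p_le_Z: "\<And>x \<gamma>. x \<in> \<Lambda> \<Longrightarrow> \<gamma> \<in> locally_finite_sets \<Longrightarrow> p x \<gamma> \<le> Z \<gamma>"
    and card_le_Z: "\<And>\<gamma>. \<gamma> \<in> locally_finite_sets \<Longrightarrow> real (card (\<gamma> \<inter> \<Lambda>)) \<le> Z \<gamma>"
    and Z_insert: "\<And>x \<gamma>. \<gamma> \<in> locally_finite_sets \<Longrightarrow> Z (insert x \<gamma>) \<le> K * Z \<gamma>"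
    and Z_mono_insert: "\<And>x \<gamma>. \<gamma> \<in> locally_finite_sets \<Longrightarrow> Z \<gamma> \<le> Z (insert x \<gamma>)"
    and Z_moments: "\<And>k. integrable P (\<lambda>\<gamma>. Z \<gamma> ^ k)"
    and p_moments: "\<And>x. (\<integral>\<^sup>+\<gamma>. ennreal ((1 + p x \<gamma>) ^ 4) \<partial>P) \<le> ennreal C"
    and C_nonneg: "0 \<le> C" and \<Phi>_nonneg: "0 \<le> \<Phi>"
    and e_integral: "(\<integral>\<^sup>+x. ennreal \<bar>e x - 1\<bar> \<partial>lborel) \<le> ennreal \<Phi>"
begin

section \<open>Lebesgue measure on the window\<close>

text \<open>Written as a density, so that its space stays \<open>UNIV\<close> and its sets stay the
  Borel sets; measurability proofs then need no mention of the window.\<close>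

definition L :: "'a measure" where "L = density lborel (indicator \<Lambda>)"

lemma sets_L [simp, measurable_cong]: "sets L = sets borel" by (simp add: L_def)
lemma space_L [simp]: "space L = UNIV" by (simp add: L_def)
lemma space_P [simp]: "space P = locally_finite_sets" using sets_eq_imp_space_eq[OF sets_P] by simp

lemma AE_L: "(\<And>x. x \<in> \<Lambda> \<Longrightarrow> Q x) \<Longrightarrow> AE x in L. Q x"
  unfolding L_def by (subst AE_density) (auto simp: indicator_def)

text \<open>A locally finite configuration is countable, hence a Lebesgue null set. This allows
  identities such as \<open>p_insert\<close>, which hold only for
  \<open>x \<notin> \<gamma>\<close>, to be used under the integral over x.\<close>

lemma AE_L_notin:
  assumes "\<gamma> \<in> locally_finite_sets" "\<And>x. x \<in> \<Lambda> \<Longrightarrow> x \<notin> \<gamma> \<Longrightarrow> Q x"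
  shows "AE x in L. Q x"
proof -
  have "AE x in lborel. x \<notin> \<gamma>"
    using countable_imp_null_set_lborel[OF countable_locally_finite[OF assms(1)]] AE_not_in by blast
  then have "AE x in lborel. 0 < (indicator \<Lambda> x :: ennreal) \<longrightarrow> Q x"
    by eventually_elim (auto simp: indicator_def intro: assms(2))
  then show ?thesis unfolding L_def by (subst AE_density) auto
qed

lemma emeasure_L_finite: "emeasure L UNIV < \<infinity>"
  using emeasure_bounded_finite[OF bounded_\<Lambda>] by (simp add: L_def emeasure_density)

sublocale L: finite_measure L
  by standard (use emeasure_L_finite in auto)

sublocale LP: pair_sigma_finite L P ..
sublocale LL: pair_sigma_finite L L ..

lemma nn_integral_L: "F \<in> borel_measurable borel \<Longrightarrow>
    (\<integral>\<^sup>+x. F x \<partial>L) = (\<integral>\<^sup>+x. F x * indicator \<Lambda> x \<partial>lborel)"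
  unfolding L_def by (subst nn_integral_density) (auto simp: mult.commute)

lemma p_measurable [measurable (raw)]:
  "f \<in> M \<rightarrow>\<^sub>M borel \<Longrightarrow> \<Gamma> \<in> M \<rightarrow>\<^sub>M config_space \<Longrightarrow> (\<lambda>m. p (f m) (\<Gamma> m)) \<in> borel_measurable M"
  using measurable_compose[OF measurable_Pair p_pair_measurable, of f M \<Gamma>] by simp

lemma borel_measurable_pair:
  "case_prod h \<in> borel_measurable (borel \<Otimes>\<^sub>M config_space) \<Longrightarrow>
  f \<in> M \<rightarrow>\<^sub>M borel \<Longrightarrow> \<Gamma> \<in> M \<rightarrow>\<^sub>M config_space \<Longrightarrow> (\<lambda>m. h (f m) (\<Gamma> m)) \<in> borel_measurable M"
  using measurable_compose[OF measurable_Pair, of f M borel \<Gamma> config_space "case_prod h" borel] by simp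

lemma sum_measurable [measurable (raw)]:
  "case_prod H \<in> borel_measurable (M \<Otimes>\<^sub>M borel) \<Longrightarrow> \<Gamma> \<in> M \<rightarrow>\<^sub>M config_space \<Longrightarrow>
    (\<lambda>m. \<Sum>x\<in>\<Gamma> m \<inter> \<Lambda>. H m x :: real) \<in> borel_measurable M"
  using sum_config_measurable \<Lambda>_borel bounded_\<Lambda> by blast

lemma finite_Int_\<Lambda> [simp]: "\<gamma> \<in> locally_finite_sets \<Longrightarrow> finite (\<gamma> \<inter> \<Lambda>)"
  using bounded_\<Lambda> by (rule finite_Int_bounded[rotated])

lemma e_minus: "e (x - y) = e (y - x)" using e_even[of "x - y"] by simp

section \<open>Polynomial growth in Z and integrability\<close>

text \<open>The bound is uniform over an index set of parameters, usually points of the window. The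
  class is closed under the operations below, and \<open>Z_moments\<close> makes its measurable
  members integrable, so that integrability questions for bounded kernels reduce to a
  \<open>polybd\<close> check.\<close>

definition polybd :: "'i set \<Rightarrow> ('i \<Rightarrow> 'a set \<Rightarrow> real) \<Rightarrow> bool" where
  "polybd A f \<longleftrightarrow> (\<exists>B m. \<forall>i\<in>A. \<forall>\<gamma>\<in>locally_finite_sets. \<bar>f i \<gamma>\<bar> \<le> B * Z \<gamma> ^ m)"

abbreviation pb :: "('a set \<Rightarrow> real) \<Rightarrow> bool" where "pb T \<equiv> polybd (UNIV :: unit set) (\<lambda>_. T)"

lemma polybdE:
  assumes "polybd A f"
  obtains B m where "0 \<le> B" "\<And>i \<gamma>. i \<in> A \<Longrightarrow> \<gamma> \<in> locally_finite_sets \<Longrightarrow> \<bar>f i \<gamma>\<bar> \<le> B * Z \<gamma> ^ m"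
proof -
  obtain B :: real and m :: nat where *: "\<And>i \<gamma>. i \<in> A \<Longrightarrow> \<gamma> \<in> locally_finite_sets \<Longrightarrow> \<bar>f i \<gamma>\<bar> \<le> B * Z \<gamma> ^ m"
    using assms unfolding polybd_def by blast
  have "\<bar>f i \<gamma>\<bar> \<le> \<bar>B\<bar> * Z \<gamma> ^ m" if "i \<in> A" "\<gamma> \<in> locally_finite_sets" for i \<gamma>
    using *[OF that] Z_ge_1[of \<gamma>] by (smt (verit) mult_right_mono zero_le_power)
  then show thesis using that[of "\<bar>B\<bar>" m] by auto
qed

lemma polybd_ex:
  "polybd A f \<Longrightarrow> \<exists>B\<ge>0. \<exists>m. \<forall>i\<in>A. \<forall>\<gamma>\<in>locally_finite_sets. \<bar>f i \<gamma>\<bar> \<le> B * Z \<gamma> ^ m"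
  by (elim polybdE) blast

lemma polybdI:
  "(\<And>i \<gamma>. i \<in> A \<Longrightarrow> \<gamma> \<in> locally_finite_sets \<Longrightarrow> \<bar>f i \<gamma>\<bar> \<le> B * Z \<gamma> ^ m) \<Longrightarrow> polybd A f"
  unfolding polybd_def by blast

lemma Z_power_mono: "m \<le> n \<Longrightarrow> Z \<gamma> ^ m \<le> Z \<gamma> ^ n" by (intro power_increasing Z_ge_1)
lemma Z_pos: "0 < Z \<gamma>" using Z_ge_1[of \<gamma>] by simp

lemma polybd_mult: "polybd A f \<Longrightarrow> polybd A g \<Longrightarrow> polybd A (\<lambda>i \<gamma>. f i \<gamma> * g i \<gamma>)"
proof (elim polybdE)
  fix B m B' m' assume *: "0 \<le> B" "\<And>i \<gamma>. i \<in> A \<Longrightarrow> \<gamma> \<in> locally_finite_sets \<Longrightarrow> \<bar>f i \<gamma>\<bar> \<le> B * Z \<gamma> ^ m"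
    "0 \<le> B'" "\<And>i \<gamma>. i \<in> A \<Longrightarrow> \<gamma> \<in> locally_finite_sets \<Longrightarrow> \<bar>g i \<gamma>\<bar> \<le> B' * Z \<gamma> ^ m'"
  show ?thesis
  proof (rule polybdI)
    fix i and \<gamma> :: "'a set" assume "i \<in> A" "\<gamma> \<in> locally_finite_sets"
    then have "\<bar>f i \<gamma>\<bar> * \<bar>g i \<gamma>\<bar> \<le> (B * Z \<gamma> ^ m) * (B' * Z \<gamma> ^ m')"
      using * Z_pos[of \<gamma>] by (intro mult_mono) auto
    then show "\<bar>f i \<gamma> * g i \<gamma>\<bar> \<le> (B * B') * Z \<gamma> ^ (m + m')" by (simp add: abs_mult power_add mult_ac)
  qed
qed

lemma polybd_add: "polybd A f \<Longrightarrow> polybd A g \<Longrightarrow> polybd A (\<lambda>i \<gamma>. f i \<gamma> + g i \<gamma>)"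
proof (elim polybdE)
  fix B m B' m' assume *: "0 \<le> B" "\<And>i \<gamma>. i \<in> A \<Longrightarrow> \<gamma> \<in> locally_finite_sets \<Longrightarrow> \<bar>f i \<gamma>\<bar> \<le> B * Z \<gamma> ^ m"
    "0 \<le> B'" "\<And>i \<gamma>. i \<in> A \<Longrightarrow> \<gamma> \<in> locally_finite_sets \<Longrightarrow> \<bar>g i \<gamma>\<bar> \<le> B' * Z \<gamma> ^ m'"
  show ?thesis
  proof (rule polybdI)
    fix i and \<gamma> :: "'a set" assume i: "i \<in> A" "\<gamma> \<in> locally_finite_sets"
    have "B * Z \<gamma> ^ m \<le> B * Z \<gamma> ^ (m + m')" "B' * Z \<gamma> ^ m' \<le> B' * Z \<gamma> ^ (m + m')"
      using * by (auto intro!: mult_left_mono Z_power_mono)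
    then show "\<bar>f i \<gamma> + g i \<gamma>\<bar> \<le> (B + B') * Z \<gamma> ^ (m + m')"
      using *(2,4)[OF i] by (simp add: ring_distribs)
  qed
qed

lemma polybd_bounded: "(\<And>i. i \<in> A \<Longrightarrow> \<bar>c i\<bar> \<le> B) \<Longrightarrow> polybd A (\<lambda>i \<gamma>. c i)"
  by (rule polybdI[of _ _ B 0]) auto

lemma polybd_const: "polybd A (\<lambda>i \<gamma>. c)" by (rule polybd_bounded) auto

lemma polybd_minus: "polybd A f \<Longrightarrow> polybd A (\<lambda>i \<gamma>. - f i \<gamma>)" by (simp add: polybd_def)

lemma polybd_diff: "polybd A f \<Longrightarrow> polybd A g \<Longrightarrow> polybd A (\<lambda>i \<gamma>. f i \<gamma> - g i \<gamma>)"
  using polybd_add[OF _ polybd_minus] by simp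

lemma polybd_power2: "polybd A f \<Longrightarrow> polybd A (\<lambda>i \<gamma>. (f i \<gamma>)\<^sup>2)"
  unfolding power2_eq_square by (rule polybd_mult)

lemma polybd_mono:
  "polybd A g \<Longrightarrow> (\<And>i \<gamma>. i \<in> A \<Longrightarrow> \<gamma> \<in> locally_finite_sets \<Longrightarrow> \<bar>f i \<gamma>\<bar> \<le> \<bar>g i \<gamma>\<bar>) \<Longrightarrow> polybd A f"
  unfolding polybd_def by (meson order_trans)

lemma polybd_max: "polybd A f \<Longrightarrow> polybd A (\<lambda>i \<gamma>. max 0 (f i \<gamma>))"
  by (erule polybd_mono) auto

lemma polybd_reindex: "polybd A f \<Longrightarrow> (\<And>j. j \<in> B \<Longrightarrow> \<phi> j \<in> A) \<Longrightarrow> polybd B (\<lambda>j. f (\<phi> j))"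
  unfolding polybd_def by blast

lemma polybd_pb: "pb T \<Longrightarrow> polybd A (\<lambda>i. T)" unfolding polybd_def by auto
lemma pb_polybd: "polybd A f \<Longrightarrow> i \<in> A \<Longrightarrow> pb (f i)" unfolding polybd_def by auto

text \<open>A new point multiplies \<open>Z\<close> by at most \<open>K\<close>: the degree is kept
  and the coefficient grows by \<open>K ^ m\<close>.\<close>

lemma polybd_insert: "polybd A f \<Longrightarrow> polybd A (\<lambda>i \<gamma>. f i (insert (x i) \<gamma>))"
proof (elim polybdE)
  fix B m assume *: "0 \<le> B" "\<And>i \<gamma>. i \<in> A \<Longrightarrow> \<gamma> \<in> locally_finite_sets \<Longrightarrow> \<bar>f i \<gamma>\<bar> \<le> B * Z \<gamma> ^ m"
  show ?thesis
  proof (rule polybdI)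
    fix i and \<gamma> :: "'a set" assume i: "i \<in> A" "\<gamma> \<in> locally_finite_sets"
    have "Z (insert (x i) \<gamma>) ^ m \<le> (K * Z \<gamma>) ^ m"
      using Z_insert[OF i(2)] Z_pos by (intro power_mono) (auto simp: less_imp_le)
    then have "B * Z (insert (x i) \<gamma>) ^ m \<le> B * (K * Z \<gamma>) ^ m" by (rule mult_left_mono) (rule *)
    then show "\<bar>f i (insert (x i) \<gamma>)\<bar> \<le> (B * K ^ m) * Z \<gamma> ^ m"
      using *(2)[of i "insert (x i) \<gamma>"] i by (simp add: power_mult_distrib)
  qed
qed

lemma Z_delete: "\<gamma> \<in> locally_finite_sets \<Longrightarrow> Z (\<gamma> - {x}) \<le> Z \<gamma>"
  using Z_mono_insert[of "\<gamma> - {x}" x] by (cases "x \<in> \<gamma>") (auto simp: insert_absorb)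

text \<open>By \<open>card_le_Z\<close> there are at most \<open>Z \<gamma>\<close> summands, each
  evaluated at a smaller configuration, where \<open>Z\<close> is not larger. The degree rises by
  one.\<close>

lemma polybd_sum_delete: "polybd (A \<times> \<Lambda>) (\<lambda>(i, y). f i y) \<Longrightarrow> polybd A (\<lambda>i \<gamma>. \<Sum>y\<in>\<gamma> \<inter> \<Lambda>. f i y (\<gamma> - {y}))"
proof (elim polybdE)
  fix B m assume B: "0 \<le> B" and *: "\<And>i \<gamma>. i \<in> A \<times> \<Lambda> \<Longrightarrow> \<gamma> \<in> locally_finite_sets
      \<Longrightarrow> \<bar>(case i of (i, y) \<Rightarrow> f i y) \<gamma>\<bar> \<le> B * Z \<gamma> ^ m"
  show ?thesis
  proof (rule polybdI)
    fix i and \<gamma> :: "'a set" assume i: "i \<in> A" "\<gamma> \<in> locally_finite_sets"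
    have "\<bar>f i y (\<gamma> - {y})\<bar> \<le> B * Z \<gamma> ^ m" if "y \<in> \<gamma> \<inter> \<Lambda>" for y
    proof -
      have "\<bar>f i y (\<gamma> - {y})\<bar> \<le> B * Z (\<gamma> - {y}) ^ m" using *[of "(i, y)" "\<gamma> - {y}"] i that by auto
      also have "\<dots> \<le> B * Z \<gamma> ^ m"
        by (intro mult_left_mono B power_mono Z_delete i) (simp add: Z_pos less_imp_le)
      finally show ?thesis .
    qed
    then have "\<bar>\<Sum>y\<in>\<gamma> \<inter> \<Lambda>. f i y (\<gamma> - {y})\<bar> \<le> real (card (\<gamma> \<inter> \<Lambda>)) * (B * Z \<gamma> ^ m)"
      by (intro order_trans[OF sum_abs] sum_bounded_above)
    also have "\<dots> \<le> Z \<gamma> * (B * Z \<gamma> ^ m)"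
      by (intro mult_right_mono card_le_Z i mult_nonneg_nonneg B) (simp add: Z_pos less_imp_le)
    finally show "\<bar>\<Sum>y\<in>\<gamma> \<inter> \<Lambda>. f i y (\<gamma> - {y})\<bar> \<le> B * Z \<gamma> ^ Suc m" by (simp add: mult_ac)
  qed
qed

lemma polybd_sum: "polybd (A \<times> \<Lambda>) (\<lambda>(i, y). f i y) \<Longrightarrow> polybd A (\<lambda>i \<gamma>. \<Sum>y\<in>\<gamma> \<inter> \<Lambda>. f i y \<gamma>)"
proof (elim polybdE)
  fix B m assume B: "0 \<le> B" and *: "\<And>i \<gamma>. i \<in> A \<times> \<Lambda> \<Longrightarrow> \<gamma> \<in> locally_finite_sets
      \<Longrightarrow> \<bar>(case i of (i, y) \<Rightarrow> f i y) \<gamma>\<bar> \<le> B * Z \<gamma> ^ m"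
  show ?thesis
  proof (rule polybdI)
    fix i and \<gamma> :: "'a set" assume i: "i \<in> A" "\<gamma> \<in> locally_finite_sets"
    have "\<bar>\<Sum>y\<in>\<gamma> \<inter> \<Lambda>. f i y \<gamma>\<bar> \<le> real (card (\<gamma> \<inter> \<Lambda>)) * (B * Z \<gamma> ^ m)"
      using *[of "(i, _)" \<gamma>] i by (intro order_trans[OF sum_abs] sum_bounded_above) auto
    also have "\<dots> \<le> Z \<gamma> * (B * Z \<gamma> ^ m)"
      by (intro mult_right_mono card_le_Z i mult_nonneg_nonneg B) (simp add: Z_pos less_imp_le)
    finally show "\<bar>\<Sum>y\<in>\<gamma> \<inter> \<Lambda>. f i y \<gamma>\<bar> \<le> B * Z \<gamma> ^ Suc m" by (simp add: mult_ac)
  qed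
qed

lemma integral_L_bound:
  assumes "\<And>x. x \<in> \<Lambda> \<Longrightarrow> \<bar>F x\<bar> \<le> B" "0 \<le> B"
  shows "\<bar>\<integral>x. F x \<partial>L\<bar> \<le> B * measure L UNIV"
proof -
  have "\<bar>\<integral>x. F x \<partial>L\<bar> \<le> (\<integral>x. \<bar>F x\<bar> \<partial>L)" using integral_norm_bound[of L F] by simp
  also have "\<dots> \<le> (\<integral>x. B \<partial>L)"
    by (rule integral_mono_AE') (auto intro!: AE_L assms)
  finally show ?thesis by (simp add: mult.commute)
qed

lemma polybd_integral: "polybd (A \<times> \<Lambda>) (\<lambda>(i, y). f i y) \<Longrightarrow> polybd A (\<lambda>i \<gamma>. \<integral>y. f i y \<gamma> \<partial>L)"
proof (elim polybdE)
  fix B m assume B: "0 \<le> B" and *: "\<And>i \<gamma>. i \<in> A \<times> \<Lambda> \<Longrightarrow> \<gamma> \<in> locally_finite_sets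
      \<Longrightarrow> \<bar>(case i of (i, y) \<Rightarrow> f i y) \<gamma>\<bar> \<le> B * Z \<gamma> ^ m"
  show ?thesis
  proof (rule polybdI)
    fix i and \<gamma> :: "'a set" assume i: "i \<in> A" "\<gamma> \<in> locally_finite_sets"
    have "\<bar>\<integral>y. f i y \<gamma> \<partial>L\<bar> \<le> B * Z \<gamma> ^ m * measure L UNIV"
      using *[of "(i, _)" \<gamma>] i B Z_pos[of \<gamma>] by (intro integral_L_bound) auto
    then show "\<bar>\<integral>y. f i y \<gamma> \<partial>L\<bar> \<le> (B * measure L UNIV) * Z \<gamma> ^ m" by (simp add: mult_ac)
  qed
qed

lemma polybd_p: "polybd \<Lambda> p"
  by (rule polybdI[of _ _ 1 1]) (auto intro: p_le_Z)

lemma polybd_e: "polybd A (\<lambda>i \<gamma>. e (c i))"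
  by (rule polybd_bounded[of _ _ K]) (auto intro: e_le)

lemma pb_integrable:
  assumes "pb T" and [measurable]: "T \<in> borel_measurable config_space"
  shows "integrable P T"
proof -
  obtain B :: real and m :: nat where "0 \<le> B"
    and *: "\<And>i \<gamma>. i \<in> (UNIV :: unit set) \<Longrightarrow> \<gamma> \<in> locally_finite_sets \<Longrightarrow> \<bar>T \<gamma>\<bar> \<le> B * Z \<gamma> ^ m"
        using polybd_ex[OF assms(1)] by blast
  have "integrable P (\<lambda>\<gamma>. B * Z \<gamma> ^ m)" by (intro integrable_mult_right Z_moments)
  then show ?thesis
  proof (rule Bochner_Integration.integrable_bound)
    show "AE \<gamma> in P. norm (T \<gamma>) \<le> norm (B * Z \<gamma> ^ m)"
    proof (rule AE_I2)
      fix \<gamma> assume "\<gamma> \<in> space P"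
      then have "\<bar>T \<gamma>\<bar> \<le> B * Z \<gamma> ^ m" using *[of "()" \<gamma>] by simp
      then show "norm (T \<gamma>) \<le> norm (B * Z \<gamma> ^ m)" unfolding real_norm_def by linarith
    qed
  qed measurable
qed

lemma L_integrable:
  fixes F :: "'a \<Rightarrow> real"
  assumes [measurable]: "F \<in> borel_measurable borel" and "\<And>x. x \<in> \<Lambda> \<Longrightarrow> \<bar>F x\<bar> \<le> B"
  shows "integrable L F"
proof (rule L.integrable_const_bound[where B=B])
  show "AE x in L. norm (F x) \<le> B" by (rule AE_L) (simp add: assms(2))
qed measurable

lemma polybd_L_integrable:
  assumes "polybd \<Lambda> F" "(\<lambda>x. F x \<gamma>) \<in> borel_measurable borel" "\<gamma> \<in> locally_finite_sets"
  shows "integrable L (\<lambda>x. F x \<gamma>)"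
proof -
  obtain B :: real and m :: nat
    where "\<And>i \<gamma>. i \<in> \<Lambda> \<Longrightarrow> \<gamma> \<in> locally_finite_sets \<Longrightarrow> \<bar>F i \<gamma>\<bar> \<le> B * Z \<gamma> ^ m"
        using polybd_ex[OF assms(1)] by blast
  then show ?thesis using assms(3) by (intro L_integrable[OF assms(2), where B="B * Z \<gamma> ^ m"]) blast
qed

lemma polybd_LP_integrable:
  assumes F: "polybd \<Lambda> F" and m[measurable]: "case_prod F \<in> borel_measurable (borel \<Otimes>\<^sub>M config_space)"
  shows "integrable (L \<Otimes>\<^sub>M P) (case_prod F)"
proof -
  have sets [measurable_cong]: "sets (L \<Otimes>\<^sub>M P) = sets (borel \<Otimes>\<^sub>M config_space)"
    by (intro sets_pair_measure_cong sets_P sets_L)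
  obtain B :: real and m :: nat where "0 \<le> B"
    and *: "\<And>i \<gamma>. i \<in> \<Lambda> \<Longrightarrow> \<gamma> \<in> locally_finite_sets \<Longrightarrow> \<bar>F i \<gamma>\<bar> \<le> B * Z \<gamma> ^ m" using polybd_ex[OF F] by blast
  show ?thesis
  proof (rule integrableI_bounded)
    show m': "case_prod F \<in> borel_measurable (L \<Otimes>\<^sub>M P)" by measurable
    have "(\<integral>\<^sup>+z. norm (case_prod F z) \<partial>(L \<Otimes>\<^sub>M P)) = (\<integral>\<^sup>+x. \<integral>\<^sup>+\<gamma>. ennreal \<bar>F x \<gamma>\<bar> \<partial>P \<partial>L)"
      by (subst nn_integral_fst[symmetric]) (auto)
    also have "\<dots> \<le> (\<integral>\<^sup>+x. \<integral>\<^sup>+\<gamma>. ennreal (B * Z \<gamma> ^ m) \<partial>P \<partial>L)"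
      by (intro nn_integral_mono_AE AE_L AE_I2 ennreal_leI *) auto
    also have "\<dots> = (\<integral>\<^sup>+\<gamma>. ennreal (B * Z \<gamma> ^ m) \<partial>P) * emeasure L UNIV" by simp
    also have "\<dots> < \<infinity>"
    proof -
      have "integrable P (\<lambda>\<gamma>. B * Z \<gamma> ^ m)" by (intro integrable_mult_right Z_moments)
      then have "(\<integral>\<^sup>+\<gamma>. ennreal (B * Z \<gamma> ^ m) \<partial>P) < \<infinity>"
        using \<open>0 \<le> B\<close> Z_pos by (subst nn_integral_eq_integral) (auto simp: less_imp_le)
      then show ?thesis using emeasure_L_finite by (simp add: ennreal_mult_less_top)
    qed
    finally show "(\<integral>\<^sup>+z. norm (case_prod F z) \<partial>(L \<Otimes>\<^sub>M P)) < \<infinity>" .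
  qed
qed

lemma expectation_integral_swap:
  assumes "polybd \<Lambda> F" "case_prod F \<in> borel_measurable (borel \<Otimes>\<^sub>M config_space)"
  shows "(\<integral>\<gamma>. (\<integral>x. F x \<gamma> \<partial>L) \<partial>P) = (\<integral>x. (\<integral>\<gamma>. F x \<gamma> \<partial>P) \<partial>L)"
  by (rule LP.Fubini_integral[OF polybd_LP_integrable[OF assms]])

text \<open>With respect to the unnormalised density \<open>w\<close> the Papangelou intensity is \<open>p x \<gamma> * a x\<close>. Weights
  replace Palm measures: \<open>weight_p\<close> adds a fixed point \<open>x\<close> to the configuration.\<close>

definition weight :: "('a set \<Rightarrow> real) \<Rightarrow> ('a \<Rightarrow> real) \<Rightarrow> bool" where
  "weight w a \<longleftrightarrow> w \<in> borel_measurable config_space \<and> a \<in> borel_measurable borel \<and>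
     (\<forall>\<gamma>. 0 \<le> w \<gamma>) \<and> (\<forall>x. 0 \<le> a x) \<and> (\<exists>A. \<forall>x. a x \<le> A) \<and> pb w \<and>
     (\<forall>\<gamma>\<in>locally_finite_sets. \<forall>x. x \<notin> \<gamma> \<longrightarrow> w (insert x \<gamma>) = w \<gamma> * a x)"

lemma weightD:
  assumes "weight w a"
  shows "w \<in> borel_measurable config_space" "a \<in> borel_measurable borel"
    "0 \<le> w \<gamma>" "0 \<le> a x" "pb w" "polybd A (\<lambda>i \<gamma>. a (c i))"
    "\<gamma> \<in> locally_finite_sets \<Longrightarrow> x \<notin> \<gamma> \<Longrightarrow> w (insert x \<gamma>) = w \<gamma> * a x"
proof -
  obtain B where "\<And>x. a x \<le> B" "\<And>x. 0 \<le> a x" using assms unfolding weight_def by auto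
  then show "polybd A (\<lambda>i \<gamma>. a (c i))" by (intro polybd_bounded[of _ _ B]) auto
qed (use assms in \<open>auto simp: weight_def\<close>)

lemma weight_one: "weight (\<lambda>_. 1) (\<lambda>_. 1)"
  by (auto simp: weight_def intro!: polybd_const)

text \<open>By \<open>p_insert\<close>, inserting y multiplies \<open>p x\<close> by
  \<open>e (x - y)\<close>. Starting from \<open>weight_one\<close>, iteration gives the weights for
  one and two fixed points.\<close>

lemma weight_p:
  assumes "weight w a" "x \<in> \<Lambda>" shows "weight (\<lambda>\<gamma>. w \<gamma> * p x \<gamma>) (\<lambda>y. a y * e (x - y))"
proof -
  note [measurable] = weightD(1,2)[OF assms(1)]
  obtain A where A: "\<And>x. a x \<le> A" "\<And>x. 0 \<le> a x" using assms unfolding weight_def by auto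
  then have "a y * e (x - y) \<le> A * K" for y by (intro mult_mono e_le) (auto intro: order_trans)
  then show ?thesis unfolding weight_def
    using weightD[OF assms(1)] p_insert polybd_mult[OF _ pb_polybd[OF polybd_p assms(2)]]
    by auto
qed

lemma GNZ_weight_nn:
  assumes w: "weight w a" and H[measurable]: "case_prod H \<in> borel_measurable (borel \<Otimes>\<^sub>M config_space)"
    and H0: "\<And>x \<gamma>. 0 \<le> H x \<gamma>"
  shows "(\<integral>\<^sup>+\<gamma>. ennreal (w \<gamma> * (\<Sum>x\<in>\<gamma> \<inter> \<Lambda>. H x (\<gamma> - {x}))) \<partial>P)
    = (\<integral>\<^sup>+\<gamma>. \<integral>\<^sup>+x. ennreal (w \<gamma> * (H x \<gamma> * (p x \<gamma> * a x))) \<partial>L \<partial>P)"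
proof -
  note [measurable] = weightD(1,2)[OF w]
  note [measurable (raw)] = borel_measurable_pair[OF H]
  \<comment> \<open>The factor \<open>a x\<close> restores the weight of the full configuration:
    \<open>w (\<gamma> - {x}) * a x = w \<gamma>\<close> for x in \<gamma>. On the left
    \<open>w \<gamma>\<close> thus leaves the sum over points, on the right \<open>a x\<close> stays
    as part of the intensity.\<close>
  define F where "F = (\<lambda>(x, \<gamma>). ennreal (indicator \<Lambda> x * (w \<gamma> * (H x \<gamma> * a x))))"
  have F[measurable]: "F \<in> borel_measurable (borel \<Otimes>\<^sub>M config_space)" unfolding F_def by measurable
  have "(\<integral>\<^sup>+x. F (x, \<gamma> - {x}) \<partial>count_space \<gamma>) = ennreal (w \<gamma> * (\<Sum>x\<in>\<gamma> \<inter> \<Lambda>. H x (\<gamma> - {x})))"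
    if \<gamma>: "\<gamma> \<in> locally_finite_sets" for \<gamma>
  proof -
    have "w (\<gamma> - {x}) * a x = w \<gamma>" if "x \<in> \<gamma>" for x
      using weightD(7)[OF w, of "\<gamma> - {x}" x] \<gamma> that by (auto simp: insert_absorb)
    then have eq: "w (\<gamma> - {x}) * (H x (\<gamma> - {x}) * a x) = w \<gamma> * H x (\<gamma> - {x})" if "x \<in> \<gamma>" for x
      using that by (metis mult.assoc mult.commute)
    have *: "F (x, \<gamma> - {x}) = ennreal (w \<gamma> * H x (\<gamma> - {x})) * indicator \<Lambda> x" if "x \<in> \<gamma>" for x
      unfolding F_def prod.case eq[OF that] by (simp add: indicator_def)
    then have "(\<integral>\<^sup>+x. F (x, \<gamma> - {x}) \<partial>count_space \<gamma>) =
       (\<integral>\<^sup>+x. ennreal (w \<gamma> * H x (\<gamma> - {x})) * indicator \<Lambda> x \<partial>count_space \<gamma>)"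
      by (intro nn_integral_cong) auto
    also have "\<dots> = (\<integral>\<^sup>+x. ennreal (w \<gamma> * H x (\<gamma> - {x})) \<partial>count_space (\<gamma> \<inter> \<Lambda>))"
      by (subst nn_integral_restrict_space[symmetric]) (auto simp: restrict_count_space Int_commute)
    also have "\<dots> = (\<Sum>x\<in>\<gamma> \<inter> \<Lambda>. ennreal (w \<gamma> * H x (\<gamma> - {x})))"
      using \<gamma> by (simp add: nn_integral_count_space_finite)
    also have "\<dots> = ennreal (\<Sum>x\<in>\<gamma> \<inter> \<Lambda>. w \<gamma> * H x (\<gamma> - {x}))"
      by (rule sum_ennreal) (simp add: H0 weightD[OF w])
    finally show ?thesis by (simp add: sum_distrib_left)
  qed
  then have "(\<integral>\<^sup>+\<gamma>. ennreal (w \<gamma> * (\<Sum>x\<in>\<gamma> \<inter> \<Lambda>. H x (\<gamma> - {x}))) \<partial>P) =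
     (\<integral>\<^sup>+\<gamma>. (\<integral>\<^sup>+x. F (x, \<gamma> - {x}) \<partial>count_space \<gamma>) \<partial>P)"
    by (intro nn_integral_cong) simp
  also have "\<dots> = (\<integral>\<^sup>+\<gamma>. (\<integral>\<^sup>+x. F (x, \<gamma>) * ennreal (p x \<gamma>) \<partial>lborel) \<partial>P)" by (rule GNZ[OF F])
  also have "\<dots> = (\<integral>\<^sup>+\<gamma>. \<integral>\<^sup>+x. ennreal (w \<gamma> * (H x \<gamma> * (p x \<gamma> * a x))) \<partial>L \<partial>P)"
  proof (intro nn_integral_cong)
    fix \<gamma> assume "\<gamma> \<in> space P"
    then have [measurable]: "(\<lambda>x. H x \<gamma>) \<in> borel_measurable borel" "(\<lambda>x. p x \<gamma>) \<in> borel_measurable borel"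
      by (auto intro!: borel_measurable_pair[OF H] p_measurable)
    show "(\<integral>\<^sup>+x. F (x, \<gamma>) * ennreal (p x \<gamma>) \<partial>lborel) = (\<integral>\<^sup>+x. ennreal (w \<gamma> * (H x \<gamma> * (p x \<gamma> * a x))) \<partial>L)"
      by (subst nn_integral_L)
       (auto intro!: nn_integral_cong simp: F_def indicator_def ennreal_mult'[symmetric]
           ennreal_mult''[symmetric] mult_ac)
  qed
  finally show ?thesis .
qed

lemma measurable_section [measurable]:
  "\<gamma> \<in> locally_finite_sets \<Longrightarrow> (\<lambda>x. p x \<gamma>) \<in> borel_measurable borel"
  by (auto intro!: p_measurable)

text \<open>The signed integrand is split into positive and negative part; the polynomial bound
  makes all integrals finite, so the two nonnegative identities may be subtracted.\<close>

lemma GNZ_weight: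
  assumes w: "weight w a" and H[measurable]: "case_prod H \<in> borel_measurable (borel \<Otimes>\<^sub>M config_space)"
    and pH: "polybd \<Lambda> H"
  shows "(\<integral>\<gamma>. w \<gamma> * (\<Sum>x\<in>\<gamma> \<inter> \<Lambda>. H x (\<gamma> - {x})) \<partial>P)
    = (\<integral>\<gamma>. w \<gamma> * (\<integral>x. H x \<gamma> * (p x \<gamma> * a x) \<partial>L) \<partial>P)"
proof -
  note [measurable] = weightD(1,2)[OF w]
  have S: "integrable P (\<lambda>\<gamma>. w \<gamma> * (\<Sum>x\<in>\<gamma> \<inter> \<Lambda>. H x (\<gamma> - {x})))"
    and I: "integrable P (\<lambda>\<gamma>. w \<gamma> * (\<integral>x. H x \<gamma> * (p x \<gamma> * a x) \<partial>L))"
    and Ix: "\<And>\<gamma>. \<gamma> \<in> locally_finite_sets \<Longrightarrow> integrable L (\<lambda>x. H x \<gamma> * (p x \<gamma> * a x))"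
    if H[measurable]: "case_prod H \<in> borel_measurable (borel \<Otimes>\<^sub>M config_space)" and pH: "polybd \<Lambda> H"
    for H
  proof -
    note [measurable (raw)] = borel_measurable_pair[OF H]
    have 1: "polybd \<Lambda> (\<lambda>x \<gamma>. H x \<gamma> * (p x \<gamma> * a x))"
      by (intro polybd_mult pH polybd_p weightD(6)[OF w])
    have "pb (\<lambda>\<gamma>. \<Sum>x\<in>\<gamma> \<inter> \<Lambda>. H x (\<gamma> - {x}))"
      by (rule polybd_sum_delete) (use polybd_reindex[OF pH, of "UNIV \<times> \<Lambda>" snd] in \<open>auto simp:
          case_prod_beta'\<close>)
    then show "integrable P (\<lambda>\<gamma>. w \<gamma> * (\<Sum>x\<in>\<gamma> \<inter> \<Lambda>. H x (\<gamma> - {x})))"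
      by (intro pb_integrable polybd_mult weightD(5)[OF w]) measurable
    have "pb (\<lambda>\<gamma>. \<integral>x. H x \<gamma> * (p x \<gamma> * a x) \<partial>L)"
      by (rule polybd_integral) (use polybd_reindex[OF 1, of "UNIV \<times> \<Lambda>" snd] in \<open>auto simp: case_prod_beta'\<close>)
    then show "integrable P (\<lambda>\<gamma>. w \<gamma> * (\<integral>x. H x \<gamma> * (p x \<gamma> * a x) \<partial>L))"
      by (intro pb_integrable polybd_mult weightD(5)[OF w]) measurable
    show "integrable L (\<lambda>x. H x \<gamma> * (p x \<gamma> * a x))" if "\<gamma> \<in> locally_finite_sets" for \<gamma>
      using 1 by (rule polybd_L_integrable) (use that in \<open>auto intro!: borel_measurable_pair[OF H]\<close>)
  qed
  have nonneg: "(\<integral>\<gamma>. w \<gamma> * (\<Sum>x\<in>\<gamma> \<inter> \<Lambda>. H x (\<gamma> - {x})) \<partial>P)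
    = (\<integral>\<gamma>. w \<gamma> * (\<integral>x. H x \<gamma> * (p x \<gamma> * a x) \<partial>L) \<partial>P)"
    if H[measurable]: "case_prod H \<in> borel_measurable (borel \<Otimes>\<^sub>M config_space)" and pH: "polybd \<Lambda> H"
      and H0: "\<And>x \<gamma>. 0 \<le> H x \<gamma>" for H
  proof -
    note [measurable (raw)] = borel_measurable_pair[OF H]
    have "(\<integral>\<^sup>+\<gamma>. \<integral>\<^sup>+x. ennreal (w \<gamma> * (H x \<gamma> * (p x \<gamma> * a x))) \<partial>L \<partial>P)
      = (\<integral>\<^sup>+\<gamma>. ennreal (w \<gamma> * (\<integral>x. H x \<gamma> * (p x \<gamma> * a x) \<partial>L)) \<partial>P)"
      by (intro nn_integral_cong) (subst nn_integral_eq_integral,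
        auto intro!: integrable_mult_right Ix H pH mult_nonneg_nonneg H0 weightD[OF w])
    then show ?thesis
      using GNZ_weight_nn[OF w H H0] by (subst (1 2) integral_eq_nn_integral)
       (auto intro!: mult_nonneg_nonneg sum_nonneg Bochner_Integration.integral_nonneg AE_I2 H0
           weightD[OF w] S I pH)
  qed
  define H1 where "H1 = (\<lambda>x \<gamma>. max 0 (H x \<gamma>))"
  define H2 where "H2 = (\<lambda>x \<gamma>. max 0 (- H x \<gamma>))"
  note [measurable (raw)] = borel_measurable_pair[OF H]
  have m: "case_prod H1 \<in> borel_measurable (borel \<Otimes>\<^sub>M config_space)"
       "case_prod H2 \<in> borel_measurable (borel \<Otimes>\<^sub>M config_space)"
    unfolding H1_def H2_def by measurable
  have b: "polybd \<Lambda> H1" "polybd \<Lambda> H2" unfolding H1_def H2_def by (intro polybd_max polybd_minus pH)+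
  have n: "\<And>x \<gamma>. 0 \<le> H1 x \<gamma>" "\<And>x \<gamma>. 0 \<le> H2 x \<gamma>" by (auto simp: H1_def H2_def)
  have d: "H x \<gamma> = H1 x \<gamma> - H2 x \<gamma>" for x \<gamma> by (auto simp: H1_def H2_def)
  have "(\<integral>\<gamma>. w \<gamma> * (\<Sum>x\<in>\<gamma> \<inter> \<Lambda>. H x (\<gamma> - {x})) \<partial>P) =
     (\<integral>\<gamma>. w \<gamma> * (\<Sum>x\<in>\<gamma> \<inter> \<Lambda>. H1 x (\<gamma> - {x})) - w \<gamma> * (\<Sum>x\<in>\<gamma> \<inter> \<Lambda>. H2 x (\<gamma> - {x})) \<partial>P)"
    by (simp add: d sum_subtractf right_diff_distrib)
  also have "\<dots> = (\<integral>\<gamma>. w \<gamma> * (\<Sum>x\<in>\<gamma> \<inter> \<Lambda>. H1 x (\<gamma> - {x})) \<partial>P) - (\<integral>\<gamma>. w \<gamma> * (\<Sum>x\<in>\<gamma> \<inter> \<Lambda>. H2 x (\<gamma> - {x})) \<partial>P)"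
    by (intro Bochner_Integration.integral_diff S m b)
  also have "\<dots> = (\<integral>\<gamma>. w \<gamma> * (\<integral>x. H1 x \<gamma> * (p x \<gamma> * a x) \<partial>L) \<partial>P)
      - (\<integral>\<gamma>. w \<gamma> * (\<integral>x. H2 x \<gamma> * (p x \<gamma> * a x) \<partial>L) \<partial>P)"
    by (simp only: nonneg[OF m(1) b(1) n(1)] nonneg[OF m(2) b(2) n(2)])
  also have "\<dots> = (\<integral>\<gamma>. w \<gamma> * (\<integral>x. H1 x \<gamma> * (p x \<gamma> * a x) \<partial>L) - w \<gamma> * (\<integral>x. H2 x \<gamma> * (p x \<gamma> * a x) \<partial>L) \<partial>P)"
    by (intro Bochner_Integration.integral_diff[symmetric] I m b)
  also have "\<dots> = (\<integral>\<gamma>. w \<gamma> * (\<integral>x. H x \<gamma> * (p x \<gamma> * a x) \<partial>L) \<partial>P)"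
    by (intro Bochner_Integration.integral_cong refl)
      (simp add: d left_diff_distrib right_diff_distrib Ix[OF m(1) b(1)] Ix[OF m(2) b(2)])
  finally show ?thesis .
qed

end

lemma ennreal_abs_integral_le: "ennreal \<bar>integral\<^sup>L M f\<bar> \<le> (\<integral>\<^sup>+x. ennreal \<bar>f x\<bar> \<partial>M)"
proof (cases "0 \<le> integral\<^sup>L M f")
  case True
  then show ?thesis using ennreal_integral_le[of M f] by simp
next
  case False
  then show ?thesis using ennreal_integral_le[of M "\<lambda>x. - f x"] by simp
qed

section \<open>Innovations and integration by parts\<close>

context papangelou begin

definition tame :: "('a \<Rightarrow> 'a set \<Rightarrow> real) \<Rightarrow> bool" where
  "tame h \<longleftrightarrow> case_prod h \<in> borel_measurable (borel \<Otimes>\<^sub>M config_space) \<and> polybd \<Lambda> h"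

definition tame1 :: "('a set \<Rightarrow> real) \<Rightarrow> bool" where
  "tame1 T \<longleftrightarrow> T \<in> borel_measurable config_space \<and> pb T"

text \<open>Sum minus compensator. Under a density \<open>w\<close> with \<open>weight w a\<close>
  the intensity is \<open>p x \<gamma> * a x\<close>, so \<open>w\<close> times the innovation has
  mean zero (\<open>ibp\<close> with T = 1).\<close>

definition innovation :: "('a \<Rightarrow> real) \<Rightarrow> ('a \<Rightarrow> 'a set \<Rightarrow> real) \<Rightarrow> 'a set \<Rightarrow> real" where
  "innovation a h \<gamma> = (\<Sum>x\<in>\<gamma> \<inter> \<Lambda>. h x (\<gamma> - {x})) - (\<integral>x. h x \<gamma> * (p x \<gamma> * a x) \<partial>L)"

lemma polybd_snd: "polybd \<Lambda> f \<Longrightarrow> polybd (A \<times> \<Lambda>) (\<lambda>(i, y). f y)"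
  using polybd_reindex[of \<Lambda> f "A \<times> \<Lambda>" snd] by (auto simp: case_prod_beta')

lemma innovation_tame1:
  assumes w: "weight w a" and h: "tame h"
  shows "tame1 (innovation a h)"
proof -
  have H: "case_prod h \<in> borel_measurable (borel \<Otimes>\<^sub>M config_space)" and ph: "polybd \<Lambda> h"
    using h by (auto simp: tame_def)
  note [measurable] = weightD(1,2)[OF w]
  note [measurable (raw)] = borel_measurable_pair[OF H]
  have 1: "innovation a h \<in> borel_measurable config_space" unfolding innovation_def by measurable
  have "polybd \<Lambda> (\<lambda>x \<gamma>. h x \<gamma> * (p x \<gamma> * a x))"
    by (intro polybd_mult ph polybd_p weightD(6)[OF w])
  then have "pb (innovation a h)" unfolding innovation_def
    by (intro polybd_diff polybd_sum_delete polybd_integral polybd_snd ph)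
  with 1 show ?thesis by (simp add: tame1_def)
qed

text \<open>The innovation is adjoint to the difference operator that adds a point. For x in
  \<gamma> one has \<open>T \<gamma> = T (insert x (\<gamma> - {x}))\<close>, which puts the product
  of T with the sum into the form required by \<open>GNZ_weight\<close>; the compensator supplies
  the subtracted term.\<close>

lemma ibp:
  assumes w: "weight w a" and h: "tame h" and T: "tame1 T"
  shows "(\<integral>\<gamma>. w \<gamma> * (T \<gamma> * innovation a h \<gamma>) \<partial>P) =
    (\<integral>\<gamma>. w \<gamma> * (\<integral>x. h x \<gamma> * (T (insert x \<gamma>) - T \<gamma>) * (p x \<gamma> * a x) \<partial>L) \<partial>P)"
proof -
  have H: "case_prod h \<in> borel_measurable (borel \<Otimes>\<^sub>M config_space)" and ph: "polybd \<Lambda> h"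
    using h by (auto simp: tame_def)
  have Tm[measurable]: "T \<in> borel_measurable config_space" and pT: "pb T" using T by (auto simp: tame1_def)
  note [measurable] = weightD(1,2)[OF w]
  note [measurable (raw)] = borel_measurable_pair[OF H]
  have b1: "polybd \<Lambda> (\<lambda>x \<gamma>. h x \<gamma> * (p x \<gamma> * a x))"
    by (intro polybd_mult ph polybd_p weightD(6)[OF w])
  have bH: "polybd \<Lambda> (\<lambda>x \<gamma>. h x \<gamma> * T (insert x \<gamma>))"
    by (intro polybd_mult ph polybd_insert[OF polybd_pb[OF pT]])
  have b2: "polybd \<Lambda> (\<lambda>x \<gamma>. (h x \<gamma> * T (insert x \<gamma>)) * (p x \<gamma> * a x))"
    by (intro polybd_mult bH polybd_p weightD(6)[OF w])
  have mH: "(\<lambda>(x, \<gamma>). h x \<gamma> * T (insert x \<gamma>)) \<in> borel_measurable (borel \<Otimes>\<^sub>M config_space)" by measurable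
  have i1: "integrable P (\<lambda>\<gamma>. w \<gamma> * (\<Sum>x\<in>\<gamma> \<inter> \<Lambda>. h x (\<gamma> - {x}) * T (insert x (\<gamma> - {x}))))"
    by (rule pb_integrable[OF polybd_mult[OF weightD(5)[OF w] polybd_sum_delete[OF polybd_snd[OF bH]]]])
        measurable
  have i2: "integrable P (\<lambda>\<gamma>. w \<gamma> * (T \<gamma> * (\<integral>x. h x \<gamma> * (p x \<gamma> * a x) \<partial>L)))"
    by (rule pb_integrable[OF polybd_mult[OF weightD(5)[OF w] polybd_mult[OF pT polybd_integral[OF
        polybd_snd[OF b1]]]]]) measurable
  have i3: "integrable P (\<lambda>\<gamma>. w \<gamma> * (\<integral>x. (h x \<gamma> * T (insert x \<gamma>)) * (p x \<gamma> * a x) \<partial>L))"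
    by (rule pb_integrable[OF polybd_mult[OF weightD(5)[OF w] polybd_integral[OF polybd_snd[OF b2]]]])
        measurable
  have "(\<integral>\<gamma>. w \<gamma> * (T \<gamma> * innovation a h \<gamma>) \<partial>P)
      = (\<integral>\<gamma>. w \<gamma> * (\<Sum>x\<in>\<gamma> \<inter> \<Lambda>. h x (\<gamma> - {x}) * T (insert x (\<gamma> - {x})))
     - w \<gamma> * (T \<gamma> * (\<integral>x. h x \<gamma> * (p x \<gamma> * a x) \<partial>L)) \<partial>P)"
  proof (intro Bochner_Integration.integral_cong refl)
    fix \<gamma>
    have "(\<Sum>x\<in>\<gamma> \<inter> \<Lambda>. h x (\<gamma> - {x}) * T (insert x (\<gamma> - {x}))) = T \<gamma> * (\<Sum>x\<in>\<gamma> \<inter> \<Lambda>. h x (\<gamma> - {x}))"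
      by (subst sum_distrib_left) (auto intro!: sum.cong simp: insert_absorb)
    then show "w \<gamma> * (T \<gamma> * innovation a h \<gamma>) = w \<gamma> * (\<Sum>x\<in>\<gamma> \<inter> \<Lambda>. h x (\<gamma> - {x}) * T (insert x (\<gamma> - {x})))
     - w \<gamma> * (T \<gamma> * (\<integral>x. h x \<gamma> * (p x \<gamma> * a x) \<partial>L))"
      by (simp add: innovation_def algebra_simps)
  qed
  also have "\<dots> = (\<integral>\<gamma>. w \<gamma> * (\<integral>x. (h x \<gamma> * T (insert x \<gamma>)) * (p x \<gamma> * a x) \<partial>L) \<partial>P)
      - (\<integral>\<gamma>. w \<gamma> * (T \<gamma> * (\<integral>x. h x \<gamma> * (p x \<gamma> * a x) \<partial>L)) \<partial>P)"
    by (subst Bochner_Integration.integral_diff[OF i1 i2]) (simp only: GNZ_weight[OF w mH bH])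
  also have "\<dots> = (\<integral>\<gamma>. w \<gamma> * (\<integral>x. (h x \<gamma> * T (insert x \<gamma>)) * (p x \<gamma> * a x) \<partial>L)
      - w \<gamma> * (T \<gamma> * (\<integral>x. h x \<gamma> * (p x \<gamma> * a x) \<partial>L)) \<partial>P)"
    by (rule Bochner_Integration.integral_diff[OF i3 i2, symmetric])
  also have "\<dots> = (\<integral>\<gamma>. w \<gamma> * (\<integral>x. h x \<gamma> * (T (insert x \<gamma>) - T \<gamma>) * (p x \<gamma> * a x) \<partial>L) \<partial>P)"
  proof (intro Bochner_Integration.integral_cong refl)
    fix \<gamma> assume "\<gamma> \<in> space P"
    then have \<gamma>: "\<gamma> \<in> locally_finite_sets" and [measurable]: "\<gamma> \<in> space config_space"
      "(\<lambda>x. h x \<gamma>) \<in> borel_measurable borel" "(\<lambda>x. p x \<gamma>) \<in> borel_measurable borel"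
      by (auto intro!: borel_measurable_pair[OF H] measurable_section)
    have j: "integrable L (\<lambda>x. (h x \<gamma> * T (insert x \<gamma>)) * (p x \<gamma> * a x))"
      by (rule polybd_L_integrable[OF b2 _ \<gamma>]) measurable
    have j': "integrable L (\<lambda>x. h x \<gamma> * (p x \<gamma> * a x))"
      by (rule polybd_L_integrable[OF b1 _ \<gamma>]) measurable
    have "(\<integral>x. h x \<gamma> * (T (insert x \<gamma>) - T \<gamma>) * (p x \<gamma> * a x) \<partial>L) =
      (\<integral>x. (h x \<gamma> * T (insert x \<gamma>)) * (p x \<gamma> * a x) - T \<gamma> * (h x \<gamma> * (p x \<gamma> * a x)) \<partial>L)"
      by (intro Bochner_Integration.integral_cong refl) (simp add: algebra_simps)
    also have "\<dots> = (\<integral>x. (h x \<gamma> * T (insert x \<gamma>)) * (p x \<gamma> * a x) \<partial>L) - T \<gamma> * (\<integral>x. h x \<gamma> * (p x \<gamma> * a x) \<partial>L)"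
      by (subst Bochner_Integration.integral_diff[OF j integrable_mult_right[OF j']]) simp
    finally have *: "(\<integral>x. h x \<gamma> * (T (insert x \<gamma>) - T \<gamma>) * (p x \<gamma> * a x) \<partial>L) =
      (\<integral>x. (h x \<gamma> * T (insert x \<gamma>)) * (p x \<gamma> * a x) \<partial>L) - T \<gamma> * (\<integral>x. h x \<gamma> * (p x \<gamma> * a x) \<partial>L)" .
    show "w \<gamma> * (\<integral>x. (h x \<gamma> * T (insert x \<gamma>)) * (p x \<gamma> * a x) \<partial>L)
      - w \<gamma> * (T \<gamma> * (\<integral>x. h x \<gamma> * (p x \<gamma> * a x) \<partial>L))
          = w \<gamma> * (\<integral>x. h x \<gamma> * (T (insert x \<gamma>) - T \<gamma>) * (p x \<gamma> * a x) \<partial>L)"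
      unfolding * by (rule right_diff_distrib[symmetric])
  qed
  finally show ?thesis .
qed

text \<open>Commutation of the difference operator with the innovation. The sum contributes the new
  term \<open>h x \<gamma>\<close>; in the compensator \<open>p y\<close> gains the factor
  \<open>e (x - y)\<close>. The result is arranged around the innovation that belongs to the weight
  \<open>w * p x\<close>, so that \<open>ibp\<close> can be applied to it once more. The last
  integral is the change of compensator.\<close>

lemma innovation_insert:
  assumes w: "weight w a" and h: "tame h" and \<gamma>[measurable]: "\<gamma> \<in> locally_finite_sets" and x: "x \<in> \<Lambda>" "x \<notin> \<gamma>"
  shows "innovation a h (insert x \<gamma>) - innovation a h \<gamma> = h x \<gamma>
     + innovation (\<lambda>y. a y * e (x - y)) (\<lambda>y \<gamma>. h y (insert x \<gamma>) - h y \<gamma>) \<gamma>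
     - (\<integral>y. h y \<gamma> * (e (x - y) - 1) * (p y \<gamma> * a y) \<partial>L)"
proof -
  have H: "case_prod h \<in> borel_measurable (borel \<Otimes>\<^sub>M config_space)" and ph: "polybd \<Lambda> h"
    using h by (auto simp: tame_def)
  note [measurable] = weightD(1,2)[OF w]
  have [measurable]: "(\<lambda>y. h y \<gamma>) \<in> borel_measurable borel" "(\<lambda>y. h y (insert x \<gamma>)) \<in> borel_measurable borel"
    "(\<lambda>y. p y \<gamma>) \<in> borel_measurable borel"
    using \<gamma> by (auto intro!: borel_measurable_pair[OF H] measurable_section)
  have S: "(\<Sum>y\<in>insert x \<gamma> \<inter> \<Lambda>. h y (insert x \<gamma> - {y})) = h x \<gamma> + (\<Sum>y\<in>\<gamma> \<inter> \<Lambda>. h y (insert x (\<gamma> - {y})))"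
  proof -
    have "insert x \<gamma> \<inter> \<Lambda> = insert x (\<gamma> \<inter> \<Lambda>)" using x by auto
    moreover have "insert x \<gamma> - {x} = \<gamma>" using x by auto
    moreover have "insert x \<gamma> - {y} = insert x (\<gamma> - {y})" if "y \<in> \<gamma>" for y using x that by auto
    ultimately show ?thesis using x \<gamma> by (auto simp add: sum.insert intro!: sum.cong)
  qed
  have b1: "polybd \<Lambda> (\<lambda>y \<gamma>. h y \<gamma> * (p y \<gamma> * a y))"
    by (intro polybd_mult ph polybd_p weightD(6)[OF w])
  have b2: "polybd \<Lambda> (\<lambda>y \<gamma>. h y (insert x \<gamma>) * (p y \<gamma> * (a y * e (x - y))))"
    by (intro polybd_mult polybd_insert[OF ph] polybd_p weightD(6)[OF w] polybd_e)
  have b3: "polybd \<Lambda> (\<lambda>y \<gamma>. h y \<gamma> * (p y \<gamma> * (a y * e (x - y))))"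
    by (intro polybd_mult ph polybd_p weightD(6)[OF w] polybd_e)
  have i: "integrable L (\<lambda>y. h y \<gamma> * (p y \<gamma> * a y))"
     "integrable L (\<lambda>y. h y (insert x \<gamma>) * (p y \<gamma> * (a y * e (x - y))))"
     "integrable L (\<lambda>y. h y \<gamma> * (p y \<gamma> * (a y * e (x - y))))"
    by (rule polybd_L_integrable[OF b1 _ \<gamma>] polybd_L_integrable[OF b2 _ \<gamma>] polybd_L_integrable[OF b3 _
        \<gamma>], measurable)+
  have "(\<integral>y. h y (insert x \<gamma>) * (p y (insert x \<gamma>) * a y) \<partial>L)
      = (\<integral>y. h y (insert x \<gamma>) * (p y \<gamma> * (a y * e (x - y))) \<partial>L)"
    using x \<gamma> by (intro Bochner_Integration.integral_cong refl) (simp add: p_insert e_minus[of x] mult_ac)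
  moreover have "(\<integral>y. (h y (insert x \<gamma>) - h y \<gamma>) * (p y \<gamma> * (a y * e (x - y))) \<partial>L) =
     (\<integral>y. h y (insert x \<gamma>) * (p y \<gamma> * (a y * e (x - y))) \<partial>L) - (\<integral>y. h y \<gamma> * (p y \<gamma> * (a y * e (x - y))) \<partial>L)"
    by (subst Bochner_Integration.integral_diff[symmetric, OF i(2,3)]) (simp add: left_diff_distrib)
  moreover have "(\<integral>y. h y \<gamma> * (e (x - y) - 1) * (p y \<gamma> * a y) \<partial>L) =
     (\<integral>y. h y \<gamma> * (p y \<gamma> * (a y * e (x - y))) \<partial>L) - (\<integral>y. h y \<gamma> * (p y \<gamma> * a y) \<partial>L)"
    by (subst Bochner_Integration.integral_diff[symmetric, OF i(3,1)])
      (intro Bochner_Integration.integral_cong refl, simp add: algebra_simps)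
  ultimately show ?thesis unfolding innovation_def S by (simp add: sum_subtractf)
qed

section \<open>The isometry inequality\<close>

lemma nn_integral_swap:
  assumes [measurable]: "case_prod F \<in> borel_measurable (borel \<Otimes>\<^sub>M config_space)"
  shows "(\<integral>\<^sup>+\<gamma>. \<integral>\<^sup>+x. F x \<gamma> \<partial>L \<partial>P) = (\<integral>\<^sup>+x. \<integral>\<^sup>+\<gamma>. F x \<gamma> \<partial>P \<partial>L)"
proof -
  have [measurable_cong]: "sets (L \<Otimes>\<^sub>M P) = sets (borel \<Otimes>\<^sub>M config_space)"
    by (intro sets_pair_measure_cong sets_P sets_L)
  have "case_prod F \<in> borel_measurable (L \<Otimes>\<^sub>M P)" by measurable
  from LP.Fubini'[OF this] show ?thesis .
qed

lemma nn_integral_swap_LL: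
  assumes [measurable]: "case_prod F \<in> borel_measurable (borel \<Otimes>\<^sub>M borel)"
  shows "(\<integral>\<^sup>+x. \<integral>\<^sup>+y. F x y \<partial>L \<partial>L) = (\<integral>\<^sup>+x. \<integral>\<^sup>+y. F y x \<partial>L \<partial>L)"
proof -
  have [measurable_cong]: "sets (L \<Otimes>\<^sub>M L) = sets (borel \<Otimes>\<^sub>M borel)"
    by (intro sets_pair_measure_cong sets_L)
  have "case_prod F \<in> borel_measurable (L \<Otimes>\<^sub>M L)" by measurable
  from LL.Fubini'[OF this] show ?thesis by simp
qed

text \<open>Schur's test: the arithmetic-geometric mean inequality and the symmetry of the kernel.\<close>

lemma symmetric_kernel_bound:
  fixes U A :: "'a \<Rightarrow> 'a \<Rightarrow> 'a set \<Rightarrow> real"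
  assumes [measurable]: "(\<lambda>(x, y, \<gamma>). U x y \<gamma>) \<in> borel_measurable (borel \<Otimes>\<^sub>M borel \<Otimes>\<^sub>M config_space)"
    "(\<lambda>(x, y, \<gamma>). A x y \<gamma>) \<in> borel_measurable (borel \<Otimes>\<^sub>M borel \<Otimes>\<^sub>M config_space)"
    and U: "\<And>x y \<gamma>. U x y \<gamma> = U y x \<gamma>" "\<And>x y \<gamma>. 0 \<le> U x y \<gamma>"
  shows "(\<integral>\<^sup>+x. \<integral>\<^sup>+y. \<integral>\<^sup>+\<gamma>. ennreal (U x y \<gamma> * \<bar>A x y \<gamma> * A y x \<gamma>\<bar>) \<partial>P \<partial>L \<partial>L)
     \<le> (\<integral>\<^sup>+x. \<integral>\<^sup>+y. \<integral>\<^sup>+\<gamma>. ennreal (U x y \<gamma> * (A x y \<gamma>)\<^sup>2) \<partial>P \<partial>L \<partial>L)"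
proof -
  have mU: "f \<in> M \<rightarrow>\<^sub>M borel \<Longrightarrow> g \<in> M \<rightarrow>\<^sub>M borel \<Longrightarrow> h \<in> M \<rightarrow>\<^sub>M config_space \<Longrightarrow>
     (\<lambda>m. U (f m) (g m) (h m)) \<in> borel_measurable M" for f g h M
    using measurable_compose[OF measurable_Pair[OF _ measurable_Pair] assms(1)] by simp
  have mA: "f \<in> M \<rightarrow>\<^sub>M borel \<Longrightarrow> g \<in> M \<rightarrow>\<^sub>M borel \<Longrightarrow> h \<in> M \<rightarrow>\<^sub>M config_space \<Longrightarrow>
     (\<lambda>m. A (f m) (g m) (h m)) \<in> borel_measurable M" for f g h M
    using measurable_compose[OF measurable_Pair[OF _ measurable_Pair] assms(2)] by simp
  note [measurable (raw)] = mU mA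
  define Q where "Q x y = (\<integral>\<^sup>+\<gamma>. ennreal (U x y \<gamma> * (A x y \<gamma>)\<^sup>2) \<partial>P)" for x y
  have Q[measurable]: "case_prod Q \<in> borel_measurable (borel \<Otimes>\<^sub>M borel)" unfolding Q_def by measurable
  have [measurable (raw)]: "f \<in> M \<rightarrow>\<^sub>M borel \<Longrightarrow> g \<in> M \<rightarrow>\<^sub>M borel
      \<Longrightarrow> (\<lambda>m. Q (f m) (g m)) \<in> borel_measurable M" for f g M
    using measurable_compose[OF measurable_Pair Q] by simp
  have "(\<integral>\<^sup>+x. \<integral>\<^sup>+y. \<integral>\<^sup>+\<gamma>. ennreal (U x y \<gamma> * \<bar>A x y \<gamma> * A y x \<gamma>\<bar>) \<partial>P \<partial>L \<partial>L)
     \<le> (\<integral>\<^sup>+x. \<integral>\<^sup>+y. ennreal (1/2) * Q x y + ennreal (1/2) * Q y x \<partial>L \<partial>L)"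
  proof (intro nn_integral_mono)
    fix x y
    have "ennreal (U x y \<gamma> * \<bar>A x y \<gamma> * A y x \<gamma>\<bar>) \<le>
      ennreal (1/2) * ennreal (U x y \<gamma> * (A x y \<gamma>)\<^sup>2) + ennreal (1/2) * ennreal (U y x \<gamma> * (A y x \<gamma>)\<^sup>2)" for \<gamma>
    proof -
      have "0 \<le> (\<bar>A x y \<gamma>\<bar> - \<bar>A y x \<gamma>\<bar>)\<^sup>2" by simp
      then have "\<bar>A x y \<gamma> * A y x \<gamma>\<bar> \<le> 1/2 * (A x y \<gamma>)\<^sup>2 + 1/2 * (A y x \<gamma>)\<^sup>2"
        by (simp add: power2_diff abs_mult)
      then have "U x y \<gamma> * \<bar>A x y \<gamma> * A y x \<gamma>\<bar> \<le> U x y \<gamma> * (1/2 * (A x y \<gamma>)\<^sup>2 + 1/2 * (A y x \<gamma>)\<^sup>2)"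
        by (rule mult_left_mono) (rule U)
      then have "U x y \<gamma> * \<bar>A x y \<gamma> * A y x \<gamma>\<bar>
          \<le> 1/2 * (U x y \<gamma> * (A x y \<gamma>)\<^sup>2) + 1/2 * (U y x \<gamma> * (A y x \<gamma>)\<^sup>2)"
        using U(1)[of x y \<gamma>] by (simp add: algebra_simps)
      then have "ennreal (U x y \<gamma> * \<bar>A x y \<gamma> * A y x \<gamma>\<bar>) \<le>
         ennreal (1/2 * (U x y \<gamma> * (A x y \<gamma>)\<^sup>2) + 1/2 * (U y x \<gamma> * (A y x \<gamma>)\<^sup>2))" by (rule ennreal_leI)
      also have "\<dots> = ennreal (1/2 * (U x y \<gamma> * (A x y \<gamma>)\<^sup>2)) + ennreal (1/2 * (U y x \<gamma> * (A y x \<gamma>)\<^sup>2))"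
        using U(2) by (intro ennreal_plus) auto
      also have "\<dots> = ennreal (1/2) * ennreal (U x y \<gamma> * (A x y \<gamma>)\<^sup>2)
          + ennreal (1/2) * ennreal (U y x \<gamma> * (A y x \<gamma>)\<^sup>2)"
        by (subst (1 2) ennreal_mult'[symmetric]) auto
      finally show ?thesis .
    qed
    then have "(\<integral>\<^sup>+\<gamma>. ennreal (U x y \<gamma> * \<bar>A x y \<gamma> * A y x \<gamma>\<bar>) \<partial>P) \<le> (\<integral>\<^sup>+\<gamma>.
      ennreal (1/2) * ennreal (U x y \<gamma> * (A x y \<gamma>)\<^sup>2) + ennreal (1/2) * ennreal (U y x \<gamma> * (A y x \<gamma>)\<^sup>2) \<partial>P)"
      by (intro nn_integral_mono)
    also have "\<dots> = ennreal (1/2) * Q x y + ennreal (1/2) * Q y x"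
      unfolding Q_def by (subst nn_integral_add) (auto simp: nn_integral_cmult)
    finally show "(\<integral>\<^sup>+\<gamma>. ennreal (U x y \<gamma> * \<bar>A x y \<gamma> * A y x \<gamma>\<bar>) \<partial>P)
        \<le> ennreal (1/2) * Q x y + ennreal (1/2) * Q y x" .
  qed
  also have "\<dots> = ennreal (1/2) * (\<integral>\<^sup>+x. \<integral>\<^sup>+y. Q x y \<partial>L \<partial>L) + ennreal (1/2) * (\<integral>\<^sup>+x. \<integral>\<^sup>+y. Q y x \<partial>L \<partial>L)"
    by (subst nn_integral_add, measurable)+ (simp add: nn_integral_cmult nn_integral_add)
  also have "(\<integral>\<^sup>+x. \<integral>\<^sup>+y. Q y x \<partial>L \<partial>L) = (\<integral>\<^sup>+x. \<integral>\<^sup>+y. Q x y \<partial>L \<partial>L)"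
    by (rule nn_integral_swap_LL[OF Q, symmetric])
  also have "ennreal (1/2) * (\<integral>\<^sup>+x. \<integral>\<^sup>+y. Q x y \<partial>L \<partial>L) + ennreal (1/2) * (\<integral>\<^sup>+x. \<integral>\<^sup>+y. Q x y \<partial>L \<partial>L)
     = (\<integral>\<^sup>+x. \<integral>\<^sup>+y. Q x y \<partial>L \<partial>L)"
  proof -
    have "ennreal (1/2) + ennreal (1/2) = 1" by (subst ennreal_plus[symmetric]) auto
    then show ?thesis by (metis distrib_right mult_1)
  qed
  finally show ?thesis unfolding Q_def .
qed

end

lemma abs_double_integral_le:
  "ennreal \<bar>\<integral>x. (\<integral>y. F x y \<partial>N) \<partial>M\<bar> \<le> (\<integral>\<^sup>+x. \<integral>\<^sup>+y. ennreal \<bar>F x y\<bar> \<partial>N \<partial>M)"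
proof -
  have "ennreal \<bar>\<integral>x. (\<integral>y. F x y \<partial>N) \<partial>M\<bar> \<le> (\<integral>\<^sup>+x. ennreal \<bar>\<integral>y. F x y \<partial>N\<bar> \<partial>M)"
    by (rule ennreal_abs_integral_le)
  also have "\<dots> \<le> (\<integral>\<^sup>+x. \<integral>\<^sup>+y. ennreal \<bar>F x y\<bar> \<partial>N \<partial>M)"
    by (rule nn_integral_mono) (rule ennreal_abs_integral_le)
  finally show ?thesis .
qed

context papangelou begin

lemma expectation_integral_LP:
  assumes "polybd \<Lambda> F" "case_prod F \<in> borel_measurable (borel \<Otimes>\<^sub>M config_space)"
  shows "(\<integral>\<gamma>. (\<integral>x. F x \<gamma> \<partial>L) \<partial>P) = integral\<^sup>L (L \<Otimes>\<^sub>M P) (case_prod F)"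
    "(\<integral>x. (\<integral>\<gamma>. F x \<gamma> \<partial>P) \<partial>L) = integral\<^sup>L (L \<Otimes>\<^sub>M P) (case_prod F)"
proof -
  show 1: "(\<integral>\<gamma>. (\<integral>x. F x \<gamma> \<partial>L) \<partial>P) = integral\<^sup>L (L \<Otimes>\<^sub>M P) (case_prod F)"
    by (rule LP.integral_snd[OF polybd_LP_integrable[OF assms]])
  then show "(\<integral>x. (\<integral>\<gamma>. F x \<gamma> \<partial>P) \<partial>L) = integral\<^sup>L (L \<Otimes>\<^sub>M P) (case_prod F)"
    using expectation_integral_swap[OF assms] by simp
qed

lemma tame1_section: "tame h \<Longrightarrow> x \<in> \<Lambda> \<Longrightarrow> tame1 (h x)"
  unfolding tame_def tame1_def by (auto intro: pb_polybd borel_measurable_pair)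

lemma tame_increment:
  assumes "tame h" shows "tame (\<lambda>y \<gamma>. h y (insert x \<gamma>) - h y \<gamma>)"
proof -
  have H: "case_prod h \<in> borel_measurable (borel \<Otimes>\<^sub>M config_space)" and ph: "polybd \<Lambda> h"
    using assms by (auto simp: tame_def)
  note [measurable (raw)] = borel_measurable_pair[OF H]
  show ?thesis unfolding tame_def
    by (auto intro!: polybd_diff polybd_insert ph)
qed

text \<open>\<open>ibp\<close> with the innovation itself as T, followed by
  \<open>innovation_insert\<close>, gives three contributions. \<open>F1\<close> is the diagonal
  term. \<open>F3\<close>, from the change of compensator, is a quadratic form with kernel e - 1.
  \<open>F2\<close> still contains an innovation; a second \<open>ibp\<close>, now under the weight
  \<open>w * p x\<close>, turns it into a form in mixed increments of h.
  \<open>symmetric_kernel_bound\<close> replaces the mixed products by squares, whence an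
  inequality.\<close>

lemma isometry:
  assumes w: "weight w a" and h: "tame h"
  shows "(\<integral>\<^sup>+\<gamma>. ennreal (w \<gamma> * (innovation a h \<gamma>)\<^sup>2) \<partial>P) \<le>
      (\<integral>\<^sup>+x. \<integral>\<^sup>+\<gamma>. ennreal (w \<gamma> * (p x \<gamma> * a x) * (h x \<gamma>)\<^sup>2) \<partial>P \<partial>L)
    + (\<integral>\<^sup>+x. \<integral>\<^sup>+y. \<integral>\<^sup>+\<gamma>. ennreal (w \<gamma> * (p x \<gamma> * a x) * (p y \<gamma> * a y) * \<bar>e (x - y) - 1\<bar> * (h x \<gamma>)\<^sup>2) \<partial>P \<partial>L \<partial>L)
    + (\<integral>\<^sup>+x. \<integral>\<^sup>+y. \<integral>\<^sup>+\<gamma>. ennreal (w \<gamma> * (p x \<gamma> * a x) * (p y \<gamma> * a y) * e (x - y) *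
         (h x (insert y \<gamma>) - h x \<gamma>)\<^sup>2) \<partial>P \<partial>L \<partial>L)" (is "_ \<le> ?R1 + ?R2 + ?R3")
proof -
  have H: "case_prod h \<in> borel_measurable (borel \<Otimes>\<^sub>M config_space)" and ph: "polybd \<Lambda> h"
    using h by (auto simp: tame_def)
  note [measurable] = weightD(1,2)[OF w]
  note [measurable (raw)] = borel_measurable_pair[OF H]
  define B where "B = (\<lambda>x \<gamma>. innovation (\<lambda>y. a y * e (x - y)) (\<lambda>y \<gamma>. h y (insert x \<gamma>) - h y \<gamma>) \<gamma>)"
  define D where "D = (\<lambda>x \<gamma>. \<integral>y. h y \<gamma> * (e (x - y) - 1) * (p y \<gamma> * a y) \<partial>L)"
  define F1 where "F1 = (\<lambda>x \<gamma>. w \<gamma> * (p x \<gamma> * a x) * (h x \<gamma>)\<^sup>2)"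
  define F2 where "F2 = (\<lambda>x \<gamma>. w \<gamma> * (p x \<gamma> * a x) * (h x \<gamma> * B x \<gamma>))"
  define F3 where "F3 = (\<lambda>x \<gamma>. w \<gamma> * (p x \<gamma> * a x) * (h x \<gamma> * D x \<gamma>))"
  have mB: "case_prod B \<in> borel_measurable (borel \<Otimes>\<^sub>M config_space)" unfolding B_def innovation_def
      by measurable
  have mD: "case_prod D \<in> borel_measurable (borel \<Otimes>\<^sub>M config_space)" unfolding D_def by measurable
  note [measurable (raw)] = borel_measurable_pair[OF mB] borel_measurable_pair[OF mD]
  have m: "case_prod F1 \<in> borel_measurable (borel \<Otimes>\<^sub>M config_space)"
    "case_prod F2 \<in> borel_measurable (borel \<Otimes>\<^sub>M config_space)"
    "case_prod F3 \<in> borel_measurable (borel \<Otimes>\<^sub>M config_space)"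
    unfolding F1_def F2_def F3_def by measurable
  have pw: "polybd A (\<lambda>i \<gamma>. w \<gamma>)" for A :: "'i set" by (rule polybd_pb[OF weightD(5)[OF w]])
  have pfst: "polybd (\<Lambda> \<times> \<Lambda>) (\<lambda>(x, y). f x)" if "polybd \<Lambda> f" for f
    using polybd_reindex[OF that, of "\<Lambda> \<times> \<Lambda>" fst] by (auto simp: case_prod_beta')
  have bd: "polybd (\<Lambda> \<times> \<Lambda>) (\<lambda>(x, y) \<gamma>. h y (insert x \<gamma>) - h y \<gamma>)"
    using polybd_diff[OF polybd_insert[OF polybd_snd[OF ph], where x=fst] polybd_snd[OF ph]]
    by (simp add: case_prod_beta')
  have bB: "polybd \<Lambda> B"
  proof -
    have "polybd (\<Lambda> \<times> \<Lambda>) (\<lambda>(x, y) \<gamma>. (h y (insert x \<gamma>) - h y \<gamma>) * (p y \<gamma> * (a y * e (x - y))))"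
      using polybd_mult[OF bd polybd_mult[OF polybd_snd[OF polybd_p] polybd_mult[OF weightD(6)[OF w,
          where c=snd] polybd_e[where c="\<lambda>i. fst i - snd i"]]]]
      by (simp add: case_prod_beta')
    then show ?thesis unfolding B_def innovation_def
      using bd by (intro polybd_diff[OF polybd_sum_delete polybd_integral]) (simp_all add: case_prod_beta')
  qed
  have bD: "polybd \<Lambda> D"
  proof -
    have "polybd (\<Lambda> \<times> \<Lambda>) (\<lambda>(x, y) \<gamma>. h y \<gamma> * (e (x - y) - 1) * (p y \<gamma> * a y))"
      using polybd_mult[OF polybd_mult[OF polybd_snd[OF ph] polybd_diff[OF polybd_e[where c="\<lambda>i. fst i
          - snd i"] polybd_const[where c=1]]]
         polybd_mult[OF polybd_snd[OF polybd_p] weightD(6)[OF w, where c=snd]]]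
      by (simp add: case_prod_beta')
    then show ?thesis unfolding D_def by (intro polybd_integral) (simp add: case_prod_beta')
  qed
  have b: "polybd \<Lambda> F1" "polybd \<Lambda> F2" "polybd \<Lambda> F3"
    unfolding F1_def F2_def F3_def
    by (intro polybd_mult polybd_power2 pw polybd_p weightD(6)[OF w] ph bB bD)+
  have T: "tame1 (innovation a h)" by (rule innovation_tame1[OF w h])
  then have [measurable]: "innovation a h \<in> borel_measurable config_space" and pT: "pb (innovation a h)"
      by (auto simp: tame1_def)
  have "(\<integral>\<^sup>+\<gamma>. ennreal (w \<gamma> * (innovation a h \<gamma>)\<^sup>2) \<partial>P) = ennreal (\<integral>\<gamma>. w \<gamma> * (innovation a h \<gamma>)\<^sup>2 \<partial>P)"
    by (intro nn_integral_eq_integral pb_integrable polybd_mult polybd_power2 pT weightD(5)[OF w])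
      (auto simp: weightD[OF w])
  also have "(\<integral>\<gamma>. w \<gamma> * (innovation a h \<gamma>)\<^sup>2 \<partial>P) =
     (\<integral>\<gamma>. w \<gamma> * (\<integral>x. h x \<gamma> * (innovation a h (insert x \<gamma>) - innovation a h \<gamma>) * (p x \<gamma> * a x) \<partial>L) \<partial>P)"
    unfolding power2_eq_square by (rule ibp[OF w h T])
  also have "\<dots> = (\<integral>\<gamma>. (\<integral>x. F1 x \<gamma> + F2 x \<gamma> - F3 x \<gamma> \<partial>L) \<partial>P)"
  proof (intro Bochner_Integration.integral_cong refl)
    fix \<gamma> assume "\<gamma> \<in> space P"
    then have \<gamma>: "\<gamma> \<in> locally_finite_sets" and [measurable]: "\<gamma> \<in> space config_space" by auto
    have "w \<gamma> * (\<integral>x. h x \<gamma> * (innovation a h (insert x \<gamma>) - innovation a h \<gamma>) * (p x \<gamma> * a x) \<partial>L) =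
      (\<integral>x. w \<gamma> * (h x \<gamma> * (innovation a h (insert x \<gamma>) - innovation a h \<gamma>) * (p x \<gamma> * a x)) \<partial>L)" by simp
    also have "\<dots> = (\<integral>x. F1 x \<gamma> + F2 x \<gamma> - F3 x \<gamma> \<partial>L)"
    \<comment> \<open>\<open>innovation_insert\<close> is available only for x outside \<gamma>; the
      remaining x form a null set.\<close>
    proof (intro integral_cong_AE AE_L_notin[OF \<gamma>])
      fix x assume x: "x \<in> \<Lambda>" "x \<notin> \<gamma>"
      show "w \<gamma> * (h x \<gamma> * (innovation a h (insert x \<gamma>) - innovation a h \<gamma>) * (p x \<gamma> * a x))
          = F1 x \<gamma> + F2 x \<gamma> - F3 x \<gamma>"
        unfolding innovation_insert[OF w h \<gamma> x] F1_def F2_def F3_def B_def D_def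
        by (simp add: algebra_simps power2_eq_square)
    qed (use m in measurable)
    finally show "w \<gamma> * (\<integral>x. h x \<gamma> * (innovation a h (insert x \<gamma>) - innovation a h \<gamma>) * (p x \<gamma> * a x) \<partial>L) = 
       (\<integral>x. F1 x \<gamma> + F2 x \<gamma> - F3 x \<gamma> \<partial>L)" .
  qed
  also have "\<dots> = integral\<^sup>L (L \<Otimes>\<^sub>M P) (\<lambda>(x, \<gamma>). F1 x \<gamma> + F2 x \<gamma> - F3 x \<gamma>)"
    by (rule expectation_integral_LP) (use m in \<open>auto intro!: polybd_add polybd_diff b simp: case_prod_beta'\<close>)
  also have "\<dots> = (\<integral>x. (\<integral>\<gamma>. F1 x \<gamma> \<partial>P) \<partial>L) + (\<integral>x. (\<integral>\<gamma>. F2 x \<gamma> \<partial>P) \<partial>L) - (\<integral>x. (\<integral>\<gamma>. F3 x \<gamma> \<partial>P) \<partial>L)"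
    unfolding expectation_integral_LP(2)[OF b(1) m(1)] expectation_integral_LP(2)[OF b(2) m(2)]
      expectation_integral_LP(2)[OF b(3) m(3)] case_prod_beta'
    using polybd_LP_integrable[OF b(1) m(1)] polybd_LP_integrable[OF b(2) m(2)] polybd_LP_integrable[OF
        b(3) m(3)]
    by (simp add: case_prod_beta')
  also have "ennreal \<dots> \<le> ennreal (\<bar>\<integral>x. (\<integral>\<gamma>. F1 x \<gamma> \<partial>P) \<partial>L\<bar> + \<bar>\<integral>x. (\<integral>\<gamma>. F3 x \<gamma> \<partial>P) \<partial>L\<bar>
      + \<bar>\<integral>x. (\<integral>\<gamma>. F2 x \<gamma> \<partial>P) \<partial>L\<bar>)"
    by (intro ennreal_leI) linarith
  also have "\<dots> = ennreal \<bar>\<integral>x. (\<integral>\<gamma>. F1 x \<gamma> \<partial>P) \<partial>L\<bar> + ennreal \<bar>\<integral>x. (\<integral>\<gamma>. F3 x \<gamma> \<partial>P) \<partial>L\<bar>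
      + ennreal \<bar>\<integral>x. (\<integral>\<gamma>. F2 x \<gamma> \<partial>P) \<partial>L\<bar>"
    by simp
  also have "\<dots> \<le> ?R1 + ?R2 + ?R3"
  proof (intro add_mono)
    have int: "ennreal \<bar>\<integral>x. (\<integral>\<gamma>. F x \<gamma> \<partial>P) \<partial>L\<bar> \<le> (\<integral>\<^sup>+x. \<integral>\<^sup>+\<gamma>. ennreal \<bar>F x \<gamma>\<bar> \<partial>P \<partial>L)"
        for F :: "'a \<Rightarrow> 'a set \<Rightarrow> real"
      by (rule abs_double_integral_le)
    show "ennreal \<bar>\<integral>x. (\<integral>\<gamma>. F1 x \<gamma> \<partial>P) \<partial>L\<bar> \<le> ?R1"
      using int[of F1] by (simp add: F1_def abs_mult weightD[OF w])
    let ?U = "\<lambda>x y \<gamma>. w \<gamma> * (p x \<gamma> * a x) * (p y \<gamma> * a y) * \<bar>e (x - y) - 1\<bar>"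
    have "ennreal \<bar>\<integral>x. (\<integral>\<gamma>. F3 x \<gamma> \<partial>P) \<partial>L\<bar> \<le> (\<integral>\<^sup>+x. \<integral>\<^sup>+\<gamma>. ennreal \<bar>F3 x \<gamma>\<bar> \<partial>P \<partial>L)" by (rule int)
    also have "\<dots> \<le> (\<integral>\<^sup>+x. \<integral>\<^sup>+\<gamma>. \<integral>\<^sup>+y. ennreal (?U x y \<gamma> * \<bar>h x \<gamma> * h y \<gamma>\<bar>) \<partial>L \<partial>P \<partial>L)"
    proof (intro nn_integral_mono)
      fix x \<gamma>
      have F3: "F3 x \<gamma> = (\<integral>y. w \<gamma> * (p x \<gamma> * a x) * h x \<gamma> * (h y \<gamma> * (e (x - y) - 1) * (p y \<gamma> * a y)) \<partial>L)"
        unfolding F3_def D_def integral_mult_right_zero by (rule mult.assoc[symmetric])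
      have "ennreal \<bar>F3 x \<gamma>\<bar>
          \<le> (\<integral>\<^sup>+y. ennreal \<bar>w \<gamma> * (p x \<gamma> * a x) * h x \<gamma> * (h y \<gamma> * (e (x - y) - 1) * (p y \<gamma> * a y))\<bar> \<partial>L)"
        unfolding F3 by (rule ennreal_abs_integral_le)
      also have "\<dots> = (\<integral>\<^sup>+y. ennreal (?U x y \<gamma> * \<bar>h x \<gamma> * h y \<gamma>\<bar>) \<partial>L)"
        by (intro nn_integral_cong) (simp add: abs_mult weightD[OF w] mult_ac)
      finally show "ennreal \<bar>F3 x \<gamma>\<bar> \<le> (\<integral>\<^sup>+y. ennreal (?U x y \<gamma> * \<bar>h x \<gamma> * h y \<gamma>\<bar>) \<partial>L)" .
    qed
    also have "\<dots> = (\<integral>\<^sup>+x. \<integral>\<^sup>+y. \<integral>\<^sup>+\<gamma>. ennreal (?U x y \<gamma> * \<bar>h x \<gamma> * h y \<gamma>\<bar>) \<partial>P \<partial>L \<partial>L)"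
      by (intro nn_integral_cong nn_integral_swap) measurable
    also have "\<dots> \<le> ?R2"
      by (rule symmetric_kernel_bound[where A="\<lambda>x y. h x"])
        (measurable, auto simp: weightD[OF w] mult_ac e_minus abs_minus_commute intro!: mult_nonneg_nonneg)
    finally show "ennreal \<bar>\<integral>x. (\<integral>\<gamma>. F3 x \<gamma> \<partial>P) \<partial>L\<bar> \<le> ?R2" .
    let ?V = "\<lambda>x y \<gamma>. w \<gamma> * (p x \<gamma> * a x) * (p y \<gamma> * a y) * e (x - y)"
    let ?A = "\<lambda>x y \<gamma>. h x (insert y \<gamma>) - h x \<gamma>"
    have "ennreal \<bar>\<integral>x. (\<integral>\<gamma>. F2 x \<gamma> \<partial>P) \<partial>L\<bar> \<le> (\<integral>\<^sup>+x. ennreal \<bar>\<integral>\<gamma>. F2 x \<gamma> \<partial>P\<bar> \<partial>L)"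
      by (rule ennreal_abs_integral_le)
    also have "\<dots> \<le> (\<integral>\<^sup>+x. \<integral>\<^sup>+\<gamma>. \<integral>\<^sup>+y. ennreal (?V x y \<gamma> * \<bar>?A x y \<gamma> * ?A y x \<gamma>\<bar>) \<partial>L \<partial>P \<partial>L)"
    proof (intro nn_integral_mono_AE AE_L)
      fix x assume x: "x \<in> \<Lambda>"
      \<comment> \<open>For fixed x, \<open>w \<gamma> * p x \<gamma>\<close> is again a weight and
        \<open>h x\<close> a tame variable. Integration by parts replaces the innovation by the
        increment of \<open>h x\<close> at y, next to the increment of \<open>h y\<close> at x: a
        product symmetric in x and y.\<close>
      have "(\<integral>\<gamma>. F2 x \<gamma> \<partial>P)
          = (\<integral>\<gamma>. a x * ((w \<gamma> * p x \<gamma>) * (h x \<gamma> * innovation (\<lambda>y. a y * e (x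
          - y)) (\<lambda>y \<gamma>. h y (insert x \<gamma>) - h y \<gamma>) \<gamma>)) \<partial>P)"
        unfolding F2_def B_def by (simp add: mult_ac)
      also have "\<dots> = a x * (\<integral>\<gamma>. (w \<gamma> * p x \<gamma>) * (\<integral>y. (h y (insert x \<gamma>) - h y \<gamma>) * (h x (insert y \<gamma>) - h x \<gamma>) *
           (p y \<gamma> * (a y * e (x - y))) \<partial>L) \<partial>P)"
        by (simp only: integral_mult_right_zero ibp[OF weight_p[OF w x] tame_increment[OF h]
            tame1_section[OF h x]])
      also have "\<dots> = (\<integral>\<gamma>. (\<integral>y. a x * (w \<gamma> * p x \<gamma>) * ((h y (insert x \<gamma>) - h y \<gamma>) * (h x (insert y \<gamma>)
          - h x \<gamma>) *
           (p y \<gamma> * (a y * e (x - y)))) \<partial>L) \<partial>P)"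
        by (simp only: integral_mult_right_zero mult.assoc)
      finally have F2: "(\<integral>\<gamma>. F2 x \<gamma> \<partial>P)
          = (\<integral>\<gamma>. (\<integral>y. a x * (w \<gamma> * p x \<gamma>) * ((h y (insert x \<gamma>) - h y \<gamma>) * (h x (insert y \<gamma>) - h x \<gamma>) *
           (p y \<gamma> * (a y * e (x - y)))) \<partial>L) \<partial>P)" .
      have "ennreal \<bar>\<integral>\<gamma>. F2 x \<gamma> \<partial>P\<bar>
          \<le> (\<integral>\<^sup>+\<gamma>. \<integral>\<^sup>+y. ennreal \<bar>a x * (w \<gamma> * p x \<gamma>) * ((h y (insert x \<gamma>)
          - h y \<gamma>) * (h x (insert y \<gamma>) - h x \<gamma>) *
           (p y \<gamma> * (a y * e (x - y))))\<bar> \<partial>L \<partial>P)"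
        unfolding F2 by (rule abs_double_integral_le)
      also have "\<dots> = (\<integral>\<^sup>+\<gamma>. \<integral>\<^sup>+y. ennreal (?V x y \<gamma> * \<bar>?A x y \<gamma> * ?A y x \<gamma>\<bar>) \<partial>L \<partial>P)"
        by (intro nn_integral_cong) (simp add: abs_mult weightD[OF w] mult_ac)
      finally show "ennreal \<bar>\<integral>\<gamma>. F2 x \<gamma> \<partial>P\<bar>
          \<le> (\<integral>\<^sup>+\<gamma>. \<integral>\<^sup>+y. ennreal (?V x y \<gamma> * \<bar>?A x y \<gamma> * ?A y x \<gamma>\<bar>) \<partial>L \<partial>P)" .
    qed
    also have "\<dots> = (\<integral>\<^sup>+x. \<integral>\<^sup>+y. \<integral>\<^sup>+\<gamma>. ennreal (?V x y \<gamma> * \<bar>?A x y \<gamma> * ?A y x \<gamma>\<bar>) \<partial>P \<partial>L \<partial>L)"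
      by (intro nn_integral_cong nn_integral_swap) measurable
    also have "\<dots> \<le> ?R3"
      by (rule symmetric_kernel_bound[where A="?A"])
        (measurable, auto simp: weightD[OF w] mult_ac e_minus intro!: mult_nonneg_nonneg)
    finally show "ennreal \<bar>\<integral>x. (\<integral>\<gamma>. F2 x \<gamma> \<partial>P) \<partial>L\<bar> \<le> ?R3" .
  qed
  finally show ?thesis .
qed

end

section \<open>Moments of the intensity and deterministic integrands\<close>

lemma nn_integral_scale_le:
  assumes "0 \<le> c" and [measurable]: "Q \<in> borel_measurable M"
    and "\<And>\<gamma>. \<gamma> \<in> space M \<Longrightarrow> F \<gamma> \<le> c * Q \<gamma>" and "(\<integral>\<^sup>+\<gamma>. ennreal (Q \<gamma>) \<partial>M) \<le> ennreal C"
  shows "(\<integral>\<^sup>+\<gamma>. ennreal (F \<gamma>) \<partial>M) \<le> ennreal (c * C)"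
proof -
  have "(\<integral>\<^sup>+\<gamma>. ennreal (F \<gamma>) \<partial>M) \<le> (\<integral>\<^sup>+\<gamma>. ennreal c * ennreal (Q \<gamma>) \<partial>M)"
    using assms by (intro nn_integral_mono) (auto simp: ennreal_mult'[symmetric] intro!: ennreal_leI)
  also have "\<dots> = ennreal c * (\<integral>\<^sup>+\<gamma>. ennreal (Q \<gamma>) \<partial>M)" by (rule nn_integral_cmult) measurable
  also have "\<dots> \<le> ennreal c * ennreal C" by (intro mult_left_mono assms) simp
  finally show ?thesis using assms(1) by (simp add: ennreal_mult')
qed

text \<open>Cauchy-Schwarz for the measure with density u, obtained by writing u as a product of two
  square roots.\<close>

lemma square_integral_product_le:
  assumes [measurable]: "f \<in> borel_measurable M" "g \<in> borel_measurable M" "u \<in> borel_measurable M"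
    and u: "\<And>s. 0 \<le> u s"
  shows "ennreal ((\<integral>s. f s * u s \<partial>M)\<^sup>2) \<le> (\<integral>\<^sup>+s. ennreal ((f s)\<^sup>2 * u s) \<partial>M) * (\<integral>\<^sup>+s. ennreal (u s) \<partial>M)"
proof -
  have "ennreal ((\<integral>s. f s * u s \<partial>M)\<^sup>2) = (ennreal \<bar>\<integral>s. f s * u s \<partial>M\<bar>)\<^sup>2"
    by (simp add: ennreal_power)
  also have "\<dots> \<le> (\<integral>\<^sup>+s. ennreal \<bar>f s * u s\<bar> \<partial>M)\<^sup>2"
    by (intro power_mono ennreal_abs_integral_le) simp
  also have "(\<integral>\<^sup>+s. ennreal \<bar>f s * u s\<bar> \<partial>M) = (\<integral>\<^sup>+s. ennreal (\<bar>f s\<bar> * sqrt (u s)) * ennreal (sqrt (u s)) \<partial>M)"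
    using u by (intro nn_integral_cong) (simp add: ennreal_mult'[symmetric] abs_mult)
  also have "\<dots>\<^sup>2 \<le> (\<integral>\<^sup>+s. (ennreal (\<bar>f s\<bar> * sqrt (u s)))\<^sup>2 \<partial>M) * (\<integral>\<^sup>+s. (ennreal (sqrt (u s)))\<^sup>2 \<partial>M)"
    by (rule Cauchy_Schwarz_nn_integral) measurable
  also have "\<dots> = (\<integral>\<^sup>+s. ennreal ((f s)\<^sup>2 * u s) \<partial>M) * (\<integral>\<^sup>+s. ennreal (u s) \<partial>M)"
    using u by (simp add: ennreal_power power_mult_distrib)
  finally show ?thesis .
qed

context papangelou begin

text \<open>\<open>p_moments\<close> controls one point at a time; the arithmetic-geometric mean
  inequality spreads a product over four points into fourth powers. With \<open>1 + p\<close> in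
  place of \<open>p\<close>, products of two or three intensities can be padded to four
  factors.\<close>

lemma moment_le:
  assumes le: "\<And>\<gamma>. F \<gamma> \<le> (1 + p a \<gamma>) * (1 + p b \<gamma>) * (1 + p c \<gamma>) * (1 + p d \<gamma>)"
  shows "(\<integral>\<^sup>+\<gamma>. ennreal (F \<gamma>) \<partial>P) \<le> ennreal C"
proof -
  have amgm: "r * s * t * q \<le> 1/4 * (r^4 + s^4 + t^4 + q^4)" for r s t q :: real
  proof -
    have "(r * s) * (t * q) \<le> ((r * s)\<^sup>2 + (t * q)\<^sup>2) / 2"
      using sum_squares_bound[of "r * s" "t * q"] by simp
    moreover have "(r * s)\<^sup>2 \<le> (r^4 + s^4) / 2"
      using sum_squares_bound[of "r\<^sup>2" "s\<^sup>2"] by (simp add: power_mult_distrib)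
    moreover have "(t * q)\<^sup>2 \<le> (t^4 + q^4) / 2"
      using sum_squares_bound[of "t\<^sup>2" "q\<^sup>2"] by (simp add: power_mult_distrib)
    ultimately show ?thesis by (simp add: mult.assoc)
  qed
  have s: "(\<integral>\<^sup>+\<gamma>. ennreal ((1 + p a \<gamma>)^4 + (1 + p b \<gamma>)^4 + (1 + p c \<gamma>)^4 + (1 + p d \<gamma>)^4) \<partial>P)
      \<le> ennreal (4 * C)"
  proof -
    have "(\<integral>\<^sup>+\<gamma>. ennreal ((1 + p a \<gamma>)^4 + (1 + p b \<gamma>)^4 + (1 + p c \<gamma>)^4 + (1 + p d \<gamma>)^4) \<partial>P)
      = (\<integral>\<^sup>+\<gamma>. ennreal ((1 + p a \<gamma>)^4) + ennreal ((1 + p b \<gamma>)^4) + ennreal ((1 + p c \<gamma>)^4)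
          + ennreal ((1 + p d \<gamma>)^4) \<partial>P)"
      by (intro nn_integral_cong) (simp del: ennreal_plus add: ennreal_plus[symmetric])
    also have "\<dots> = (\<integral>\<^sup>+\<gamma>. ennreal ((1 + p a \<gamma>)^4) \<partial>P) + (\<integral>\<^sup>+\<gamma>. ennreal ((1 + p b \<gamma>)^4) \<partial>P)
       + (\<integral>\<^sup>+\<gamma>. ennreal ((1 + p c \<gamma>)^4) \<partial>P) + (\<integral>\<^sup>+\<gamma>. ennreal ((1 + p d \<gamma>)^4) \<partial>P)"
      by (simp add: nn_integral_add)
    also have "\<dots> \<le> ennreal C + ennreal C + ennreal C + ennreal C"
      by (intro add_mono p_moments)
    also have "\<dots> = ennreal (4 * C)" using C_nonneg by (simp del: ennreal_plus add: ennreal_plus[symmetric])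
    finally show ?thesis .
  qed
  have "(\<integral>\<^sup>+\<gamma>. ennreal (F \<gamma>) \<partial>P) \<le> ennreal (1/4 * (4 * C))"
    by (rule nn_integral_scale_le[OF _ _ order_trans[OF le amgm] s]) auto
  then show ?thesis by simp
qed

lemma moment2: "(\<integral>\<^sup>+\<gamma>. ennreal (p a \<gamma> * p b \<gamma>) \<partial>P) \<le> ennreal C"
  by (rule moment_le[of _ a b a a]) (use mult_mono in \<open>auto simp: algebra_simps intro!: add_increasing
      mult_nonneg_nonneg\<close>)

lemma moment4: "(\<integral>\<^sup>+\<gamma>. ennreal (p a \<gamma> * p b \<gamma> * p c \<gamma> * p d \<gamma>) \<partial>P) \<le> ennreal C"
  by (rule moment_le[of _ a b c d]) (intro mult_mono, auto intro!: mult_nonneg_nonneg)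

lemma moment3: "(\<integral>\<^sup>+\<gamma>. ennreal (p a \<gamma> * p b \<gamma> * p c \<gamma>) \<partial>P) \<le> ennreal C"
proof (rule moment_le[of _ a b c a])
  fix \<gamma>
  have "p a \<gamma> * p b \<gamma> * p c \<gamma> * 1 \<le> (1 + p a \<gamma>) * (1 + p b \<gamma>) * (1 + p c \<gamma>) * (1 + p a \<gamma>)"
    by (intro mult_mono) (auto intro!: mult_nonneg_nonneg)
  then show "p a \<gamma> * p b \<gamma> * p c \<gamma> \<le> (1 + p a \<gamma>) * (1 + p b \<gamma>) * (1 + p c \<gamma>) * (1 + p a \<gamma>)" by simp
qed

lemma e_integral_L: "(\<integral>\<^sup>+y. ennreal \<bar>e (x - y) - 1\<bar> \<partial>L) \<le> ennreal \<Phi>"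
proof -
  have "(\<integral>\<^sup>+y. ennreal \<bar>e (x - y) - 1\<bar> \<partial>L) = (\<integral>\<^sup>+y. ennreal \<bar>e (- x + y) - 1\<bar> * indicator \<Lambda> y \<partial>lborel)"
    by (subst nn_integral_L) (auto simp: e_minus[of x])
  also have "\<dots> \<le> (\<integral>\<^sup>+y. ennreal \<bar>e (- x + y) - 1\<bar> \<partial>lborel)"
    by (intro nn_integral_mono) (auto simp: indicator_def)
  also have "\<dots> = (\<integral>\<^sup>+y. ennreal \<bar>e y - 1\<bar> \<partial>distr lborel borel ((+) (- x)))"
    by (subst nn_integral_distr) auto
  also have "\<dots> \<le> ennreal \<Phi>" unfolding lborel_distr_plus by (rule e_integral)
  finally show ?thesis .
qed

lemma e_integral_L': "(\<integral>\<^sup>+y. ennreal \<bar>e (y - x) - 1\<bar> \<partial>L) \<le> ennreal \<Phi>"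
  using e_integral_L[of x] by (simp add: e_minus)

lemma abs_e_diff_le: "\<bar>e x - 1\<bar> \<le> K"
  using e_nonneg[of x] e_le[of x] K_ge_1 by linarith

lemma weight_p1: "x \<in> \<Lambda> \<Longrightarrow> weight (p x) (\<lambda>s. e (x - s))"
  using weight_p[OF weight_one] by simp

lemma weight_p2: "x \<in> \<Lambda> \<Longrightarrow> y \<in> \<Lambda> \<Longrightarrow> weight (\<lambda>\<gamma>. p x \<gamma> * p y \<gamma>) (\<lambda>s. e (x - s) * e (y - s))"
  using weight_p[OF weight_p1] by simp

text \<open>Sum of the constants from the first two terms of \<open>isometry\<close> for a
  deterministic integrand. For one or two fixed points the factor of the weight is at most
  \<open>K\<^sup>2\<close>; it enters the first term once and the second term twice.\<close>

definition isometry_const :: real where "isometry_const = K\<^sup>2 * C + (K\<^sup>2)\<^sup>2 * C * \<Phi>"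

lemma isometry_const_nonneg: "0 \<le> isometry_const" using C_nonneg \<Phi>_nonneg by (simp add: isometry_const_def)

text \<open>A deterministic integrand has no increments, so the third term of
  \<open>isometry\<close> vanishes. In the second term the kernel e - 1 is integrated out over the
  variable that does not occur in \<phi>.\<close>

lemma deterministic_isometry:
  assumes w: "weight w a" and a: "\<And>x. a x \<le> K\<^sup>2"
    and \<phi>[measurable]: "\<phi> \<in> borel_measurable borel" and M: "\<And>y. \<bar>\<phi> y\<bar> \<le> M"
    and m1: "\<And>x. (\<integral>\<^sup>+\<gamma>. ennreal (w \<gamma> * p x \<gamma>) \<partial>P) \<le> ennreal C"
    and m2: "\<And>x y. (\<integral>\<^sup>+\<gamma>. ennreal (w \<gamma> * p x \<gamma> * p y \<gamma>) \<partial>P) \<le> ennreal C"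
  shows "(\<integral>\<^sup>+\<gamma>. ennreal (w \<gamma> * (innovation a (\<lambda>y _. \<phi> y) \<gamma>)\<^sup>2) \<partial>P)
      \<le> ennreal isometry_const * (\<integral>\<^sup>+y. ennreal ((\<phi> y)\<^sup>2) \<partial>L)"
proof -
  note [measurable] = weightD(1,2)[OF w]
  have h: "tame (\<lambda>y _. \<phi> y)"
    unfolding tame_def by (auto intro!: polybd_bounded M)
  let ?J = "\<integral>\<^sup>+y. ennreal ((\<phi> y)\<^sup>2) \<partial>L"
  have t1: "(\<integral>\<^sup>+x. \<integral>\<^sup>+\<gamma>. ennreal (w \<gamma> * (p x \<gamma> * a x) * (\<phi> x)\<^sup>2) \<partial>P \<partial>L) \<le> ennreal (K\<^sup>2 * C) * ?J"
  proof -
    have "(\<integral>\<^sup>+\<gamma>. ennreal (w \<gamma> * (p x \<gamma> * a x) * (\<phi> x)\<^sup>2) \<partial>P) \<le> ennreal ((K\<^sup>2 * (\<phi> x)\<^sup>2) * C)" for x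
    proof (rule nn_integral_scale_le[OF _ _ _ m1[of x]])
      fix \<gamma>
      have "a x * (w \<gamma> * p x \<gamma> * (\<phi> x)\<^sup>2) \<le> K\<^sup>2 * (w \<gamma> * p x \<gamma> * (\<phi> x)\<^sup>2)"
        by (intro mult_right_mono a) (simp add: weightD[OF w])
      then show "w \<gamma> * (p x \<gamma> * a x) * (\<phi> x)\<^sup>2 \<le> K\<^sup>2 * (\<phi> x)\<^sup>2 * (w \<gamma> * p x \<gamma>)" by (simp add: mult_ac)
    qed auto
    then have "(\<integral>\<^sup>+x. \<integral>\<^sup>+\<gamma>. ennreal (w \<gamma> * (p x \<gamma> * a x) * (\<phi> x)\<^sup>2) \<partial>P \<partial>L)
        \<le> (\<integral>\<^sup>+x. ennreal (K\<^sup>2 * C) * ennreal ((\<phi> x)\<^sup>2) \<partial>L)"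
      using C_nonneg by (intro nn_integral_mono) (simp add: ennreal_mult'[symmetric] mult_ac)
    also have "\<dots> = ennreal (K\<^sup>2 * C) * ?J" by (rule nn_integral_cmult) measurable
    finally show ?thesis .
  qed
  have t2: "(\<integral>\<^sup>+x. \<integral>\<^sup>+y. \<integral>\<^sup>+\<gamma>. ennreal (w \<gamma> * (p x \<gamma> * a x) * (p y \<gamma> * a y) * \<bar>e (x - y)
      - 1\<bar> * (\<phi> x)\<^sup>2) \<partial>P \<partial>L \<partial>L)
     \<le> ennreal ((K\<^sup>2)\<^sup>2 * C * \<Phi>) * ?J"
  proof -
    have "(\<integral>\<^sup>+\<gamma>. ennreal (w \<gamma> * (p x \<gamma> * a x) * (p y \<gamma> * a y) * \<bar>e (x - y) - 1\<bar> * (\<phi> x)\<^sup>2) \<partial>P)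
       \<le> ennreal (((K\<^sup>2)\<^sup>2 * \<bar>e (x - y) - 1\<bar> * (\<phi> x)\<^sup>2) * C)" for x y
    proof (rule nn_integral_scale_le[OF _ _ _ m2[of x y]])
      fix \<gamma>
      have "a x * a y \<le> K\<^sup>2 * K\<^sup>2" by (intro mult_mono a) (simp_all add: weightD[OF w])
      then have "(a x * a y) * (w \<gamma> * p x \<gamma> * p y \<gamma> * \<bar>e (x - y) - 1\<bar> * (\<phi> x)\<^sup>2)
          \<le> (K\<^sup>2 * K\<^sup>2) * (w \<gamma> * p x \<gamma> * p y \<gamma> * \<bar>e (x - y) - 1\<bar> * (\<phi> x)\<^sup>2)"
        by (intro mult_right_mono) (simp_all add: weightD[OF w])
      then show "w \<gamma> * (p x \<gamma> * a x) * (p y \<gamma> * a y) * \<bar>e (x - y) - 1\<bar> * (\<phi> x)\<^sup>2 \<le>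
         (K\<^sup>2)\<^sup>2 * \<bar>e (x - y) - 1\<bar> * (\<phi> x)\<^sup>2 * (w \<gamma> * p x \<gamma> * p y \<gamma>)" by (simp add: mult_ac power2_eq_square)
    qed auto
    then have "(\<integral>\<^sup>+x. \<integral>\<^sup>+y. \<integral>\<^sup>+\<gamma>. ennreal (w \<gamma> * (p x \<gamma> * a x) * (p y \<gamma> * a y) * \<bar>e (x - y)
        - 1\<bar> * (\<phi> x)\<^sup>2) \<partial>P \<partial>L \<partial>L)
       \<le> (\<integral>\<^sup>+x. \<integral>\<^sup>+y. ennreal ((K\<^sup>2)\<^sup>2 * (\<phi> x)\<^sup>2 * C) * ennreal \<bar>e (x - y) - 1\<bar> \<partial>L \<partial>L)"
      using C_nonneg by (intro nn_integral_mono) (simp add: ennreal_mult'[symmetric] mult_ac)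
    also have "\<dots> = (\<integral>\<^sup>+x. ennreal ((K\<^sup>2)\<^sup>2 * (\<phi> x)\<^sup>2 * C) * (\<integral>\<^sup>+y. ennreal \<bar>e (x - y) - 1\<bar> \<partial>L) \<partial>L)"
      by (intro nn_integral_cong nn_integral_cmult) measurable
    also have "\<dots> \<le> (\<integral>\<^sup>+x. ennreal ((K\<^sup>2)\<^sup>2 * (\<phi> x)\<^sup>2 * C) * ennreal \<Phi> \<partial>L)"
      by (intro nn_integral_mono mult_left_mono e_integral_L) simp
    also have "\<dots> = (\<integral>\<^sup>+x. ennreal ((K\<^sup>2)\<^sup>2 * C * \<Phi>) * ennreal ((\<phi> x)\<^sup>2) \<partial>L)"
      using C_nonneg \<Phi>_nonneg by (intro nn_integral_cong) (simp add: ennreal_mult'[symmetric] mult_ac)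
    also have "\<dots> = ennreal ((K\<^sup>2)\<^sup>2 * C * \<Phi>) * ?J" by (rule nn_integral_cmult) measurable
    finally show ?thesis .
  qed
  have "(\<integral>\<^sup>+\<gamma>. ennreal (w \<gamma> * (innovation a (\<lambda>y _. \<phi> y) \<gamma>)\<^sup>2) \<partial>P)
      \<le> ennreal (K\<^sup>2 * C) * ?J + ennreal ((K\<^sup>2)\<^sup>2 * C * \<Phi>) * ?J + 0"
    by (rule order_trans[OF isometry[OF w h] add_mono[OF add_mono[OF t1 t2]]]) simp
  also have "\<dots> = ennreal isometry_const * ?J"
    using C_nonneg \<Phi>_nonneg by (simp add: isometry_const_def distrib_right)
  finally show ?thesis .
qed

section \<open>The second order test functional\<close>

text \<open>The factor \<open>e (x - s)\<close> is the one of the weight \<open>p x\<close>, see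
  \<open>weight_p1\<close>. So this is the innovation of \<open>g x\<close> for the process that has
  a point at x, and it is centred under that weight.\<close>

definition test_h :: "('a \<Rightarrow> 'a \<Rightarrow> real) \<Rightarrow> 'a \<Rightarrow> 'a set \<Rightarrow> real" where
  "test_h g x \<gamma> = innovation (\<lambda>s. e (x - s)) (\<lambda>s _. g x s) \<gamma>"

text \<open>Change of the compensator of \<open>g x\<close> caused by a further point y. It plays
  two roles: it is the defect of \<open>test_h g x\<close> from being an innovation for the weight
  \<open>p x * p y\<close> (\<open>test_h_split\<close>), and it corrects the increment of
  \<open>test_h g x\<close> at y (\<open>test_h_insert\<close>).\<close>

definition remainder :: "('a \<Rightarrow> 'a \<Rightarrow> real) \<Rightarrow> 'a \<Rightarrow> 'a \<Rightarrow> 'a set \<Rightarrow> real" where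
  "remainder g x y \<gamma> = (\<integral>s. g x s * (e (y - s) - 1) * (p s \<gamma> * e (x - s)) \<partial>L)"

text \<open>The three summands are the constants for the three terms of \<open>isometry\<close>
  applied to \<open>test_h g\<close>.\<close>

definition variance_const :: real where
  "variance_const = isometry_const + (2 * \<Phi> * isometry_const + 2 * K * (K\<^sup>2 * C * \<Phi>\<^sup>2)) + (2 * K * C
      + 2 * K * (K\<^sup>2 * C * \<Phi>\<^sup>2))"

context
  fixes g :: "'a \<Rightarrow> 'a \<Rightarrow> real" and M :: real
  assumes g_pair: "case_prod g \<in> borel_measurable (borel \<Otimes>\<^sub>M borel)" and g_le: "\<And>x y. \<bar>g x y\<bar> \<le> M"
begin

lemma g_measurable:
  "f1 \<in> N \<rightarrow>\<^sub>M borel \<Longrightarrow> f2 \<in> N \<rightarrow>\<^sub>M borel \<Longrightarrow> (\<lambda>m. g (f1 m) (f2 m)) \<in> borel_measurable N"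
  using measurable_compose[OF measurable_Pair g_pair] by simp

lemma tame_g: "tame (\<lambda>s _. g x s)"
  supply [measurable (raw)] = g_measurable
  unfolding tame_def by (auto intro!: polybd_bounded g_le)

lemma test_h_pair: "case_prod (test_h g) \<in> borel_measurable (borel \<Otimes>\<^sub>M config_space)"
  supply [measurable (raw)] = g_measurable
  unfolding test_h_def innovation_def by measurable

lemma remainder_measurable:
  assumes [measurable]: "f1 \<in> N \<rightarrow>\<^sub>M borel" "f2 \<in> N \<rightarrow>\<^sub>M borel" "\<Gamma> \<in> N \<rightarrow>\<^sub>M config_space"
  shows "(\<lambda>m. remainder g (f1 m) (f2 m) (\<Gamma> m)) \<in> borel_measurable N"
  supply [measurable (raw)] = g_measurable
  unfolding remainder_def by measurable

lemma tame_test_h: "tame (test_h g)"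
proof -
  note [measurable (raw)] = g_measurable remainder_measurable
  have b: "polybd (\<Lambda> \<times> \<Lambda>) (\<lambda>(x, s) \<gamma>. g x s)"
    unfolding case_prod_beta' by (rule polybd_bounded[where B=M]) (rule g_le)
  have "polybd (\<Lambda> \<times> \<Lambda>) (\<lambda>(x, s) \<gamma>. g x s * (p s \<gamma> * e (x - s)))"
    using polybd_mult[OF b polybd_mult[OF polybd_snd[OF polybd_p] polybd_e[where c="\<lambda>i. fst i - snd i"]]]
    by (simp add: case_prod_beta')
  then have "polybd \<Lambda> (test_h g)" unfolding test_h_def innovation_def
    using b by (intro polybd_diff[OF polybd_sum_delete polybd_integral]) (simp_all add: case_prod_beta')
  with test_h_pair show ?thesis by (simp add: tame_def)
qed

lemma test_h_split:
  assumes \<gamma>: "\<gamma> \<in> locally_finite_sets"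
  shows "test_h g x \<gamma> = innovation (\<lambda>s. e (x - s) * e (y - s)) (\<lambda>s _. g x s) \<gamma> + remainder g x y \<gamma>"
proof -
  note [measurable (raw)] = g_measurable remainder_measurable
  have [measurable]: "\<gamma> \<in> space config_space" using \<gamma> by simp
  have b: "polybd \<Lambda> (\<lambda>s \<gamma>. g x s * (p s \<gamma> * e (x - s)))"
    by (intro polybd_mult polybd_p polybd_e polybd_bounded[where B=M] g_le)
  have b': "polybd \<Lambda> (\<lambda>s \<gamma>. g x s * (p s \<gamma> * (e (x - s) * e (y - s))))"
    by (intro polybd_mult polybd_p polybd_e polybd_bounded[where B=M] g_le)
  have i: "integrable L (\<lambda>s. g x s * (p s \<gamma> * e (x - s)))"
    by (rule polybd_L_integrable[OF b _ \<gamma>]) measurable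
  have i': "integrable L (\<lambda>s. g x s * (p s \<gamma> * (e (x - s) * e (y - s))))"
    by (rule polybd_L_integrable[OF b' _ \<gamma>]) measurable
  have "remainder g x y \<gamma> = (\<integral>s. g x s * (p s \<gamma> * (e (x - s) * e (y - s))) \<partial>L)
      - (\<integral>s. g x s * (p s \<gamma> * e (x - s)) \<partial>L)"
    unfolding remainder_def Bochner_Integration.integral_diff[OF i' i, symmetric]
    by (intro Bochner_Integration.integral_cong refl) (simp add: algebra_simps)
  then show ?thesis by (simp add: test_h_def innovation_def)
qed

text \<open>The commutation rule for the deterministic integrand \<open>g x\<close>: its own
  increments vanish, so the innovation in the middle of \<open>innovation_insert\<close> drops
  out.\<close>

lemma test_h_insert:
  assumes \<gamma>: "\<gamma> \<in> locally_finite_sets" and xy: "x \<in> \<Lambda>" "y \<in> \<Lambda>" "y \<notin> \<gamma>"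
  shows "test_h g x (insert y \<gamma>) - test_h g x \<gamma> = g x y - remainder g x y \<gamma>"
  using innovation_insert[OF weight_p1[OF xy(1)] tame_g \<gamma> xy(2,3)]
  by (simp add: test_h_def remainder_def innovation_def)

text \<open>Cauchy-Schwarz against the density \<open>?u\<close> keeps one kernel e - 1 next to
  \<open>(g x s)\<^sup>2\<close> and leaves a second one, which integrates to \<Phi>. With the
  weight, the squared integral contains four intensities; this is where the fourth moments in
  \<open>p_moments\<close> are needed.\<close>

lemma remainder_bound:
  "(\<integral>\<^sup>+\<gamma>. ennreal (p x \<gamma> * p y \<gamma> * (remainder g x y \<gamma>)\<^sup>2) \<partial>P)
    \<le> ennreal (K\<^sup>2 * C * \<Phi>) * (\<integral>\<^sup>+s. ennreal ((g x s)\<^sup>2 * \<bar>e (y - s) - 1\<bar>) \<partial>L)"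
proof -
  note [measurable (raw)] = g_measurable remainder_measurable
  let ?u = "\<lambda>s \<gamma>. \<bar>e (y - s) - 1\<bar> * (p s \<gamma> * e (x - s))"
  have "(\<integral>\<^sup>+\<gamma>. ennreal (p x \<gamma> * p y \<gamma> * (remainder g x y \<gamma>)\<^sup>2) \<partial>P)
    \<le> (\<integral>\<^sup>+\<gamma>. \<integral>\<^sup>+s. \<integral>\<^sup>+s'. ennreal (p x \<gamma> * p y \<gamma> * ((g x s)\<^sup>2 * ?u s \<gamma>) * ?u s' \<gamma>) \<partial>L \<partial>L \<partial>P)"
  proof (intro nn_integral_mono)
    fix \<gamma> assume "\<gamma> \<in> space P"
    then have [measurable]: "\<gamma> \<in> space config_space" by simp
    \<comment> \<open>The sign of \<open>e (y - s) - 1\<close> is moved to the integrand, which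
      leaves the nonnegative density \<open>?u\<close>.\<close>
    have "remainder g x y \<gamma> = (\<integral>s. (g x s * sgn (e (y - s) - 1)) * ?u s \<gamma> \<partial>L)"
      unfolding remainder_def by (intro Bochner_Integration.integral_cong refl) (simp add: mult_ac
          sgn_mult_abs abs_mult_sgn)
    then have "ennreal ((remainder g x y \<gamma>)\<^sup>2)
        \<le> (\<integral>\<^sup>+s. ennreal ((g x s * sgn (e (y - s) - 1))\<^sup>2 * ?u s \<gamma>) \<partial>L) * (\<integral>\<^sup>+s. ennreal (?u s \<gamma>) \<partial>L)"
      using square_integral_product_le[of "\<lambda>s. g x s * sgn (e (y - s) - 1)" L "\<lambda>_. 0" "\<lambda>s. ?u s \<gamma>"] by simp
    also have "\<dots> \<le> (\<integral>\<^sup>+s. ennreal ((g x s)\<^sup>2 * ?u s \<gamma>) \<partial>L) * (\<integral>\<^sup>+s. ennreal (?u s \<gamma>) \<partial>L)"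
      by (intro mult_right_mono nn_integral_mono ennreal_leI) (auto simp: power_mult_distrib sgn_if)
    finally have "ennreal (p x \<gamma> * p y \<gamma>) * ennreal ((remainder g x y \<gamma>)\<^sup>2) \<le>
       ennreal (p x \<gamma> * p y \<gamma>) * ((\<integral>\<^sup>+s. ennreal ((g x s)\<^sup>2 * ?u s \<gamma>) \<partial>L) * (\<integral>\<^sup>+s. ennreal (?u s \<gamma>) \<partial>L))"
      by (rule mult_left_mono) simp
    also have "\<dots> = (\<integral>\<^sup>+s. (ennreal (p x \<gamma> * p y \<gamma>) * ennreal ((g x s)\<^sup>2 * ?u s \<gamma>))
        * (\<integral>\<^sup>+s'. ennreal (?u s' \<gamma>) \<partial>L) \<partial>L)"
      by (subst nn_integral_multc, measurable) (simp add: nn_integral_cmult mult.assoc)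
    also have "\<dots> = (\<integral>\<^sup>+s. \<integral>\<^sup>+s'. ennreal (p x \<gamma> * p y \<gamma> * ((g x s)\<^sup>2 * ?u s \<gamma>) * ?u s' \<gamma>) \<partial>L \<partial>L)"
      by (intro nn_integral_cong, subst nn_integral_cmult[symmetric]) (auto simp:
          ennreal_mult'[symmetric] intro!: nn_integral_cong)
    finally show "ennreal (p x \<gamma> * p y \<gamma> * (remainder g x y \<gamma>)\<^sup>2) \<le>
       (\<integral>\<^sup>+s. \<integral>\<^sup>+s'. ennreal (p x \<gamma> * p y \<gamma> * ((g x s)\<^sup>2 * ?u s \<gamma>) * ?u s' \<gamma>) \<partial>L \<partial>L)"
      by (simp add: ennreal_mult')
  qed
  also have "\<dots> = (\<integral>\<^sup>+s. \<integral>\<^sup>+\<gamma>. \<integral>\<^sup>+s'. ennreal (p x \<gamma> * p y \<gamma> * ((g x s)\<^sup>2 * ?u s \<gamma>) * ?u s' \<gamma>) \<partial>L \<partial>P \<partial>L)"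
    by (rule nn_integral_swap) measurable
  also have "\<dots> = (\<integral>\<^sup>+s. \<integral>\<^sup>+s'. \<integral>\<^sup>+\<gamma>. ennreal (p x \<gamma> * p y \<gamma> * ((g x s)\<^sup>2 * ?u s \<gamma>) * ?u s' \<gamma>) \<partial>P \<partial>L \<partial>L)"
    by (rule nn_integral_cong) (rule nn_integral_swap, measurable)
  also have "\<dots> \<le> (\<integral>\<^sup>+s. \<integral>\<^sup>+s'. ennreal ((g x s)\<^sup>2 * \<bar>e (y - s) - 1\<bar> * K\<^sup>2 * C) * ennreal \<bar>e (y - s')
      - 1\<bar> \<partial>L \<partial>L)"
  proof (intro nn_integral_mono)
    fix s s'
    have "(\<integral>\<^sup>+\<gamma>. ennreal (p x \<gamma> * p y \<gamma> * ((g x s)\<^sup>2 * ?u s \<gamma>) * ?u s' \<gamma>) \<partial>P)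
       \<le> ennreal (((g x s)\<^sup>2 * \<bar>e (y - s) - 1\<bar> * \<bar>e (y - s') - 1\<bar> * K\<^sup>2) * C)"
    proof (rule nn_integral_scale_le[OF _ _ _ moment4[of x y s s']])
      fix \<gamma>
      have "e (x - s) * e (x - s') \<le> K * K" using K_ge_1 by (intro mult_mono e_le) auto
      then have "(e (x - s) * e (x - s')) * (p x \<gamma> * p y \<gamma> * p s \<gamma> * p s' \<gamma> * (g x s)\<^sup>2 * \<bar>e (y - s)
          - 1\<bar> * \<bar>e (y - s') - 1\<bar>)
        \<le> (K * K) * (p x \<gamma> * p y \<gamma> * p s \<gamma> * p s' \<gamma> * (g x s)\<^sup>2 * \<bar>e (y - s) - 1\<bar> * \<bar>e (y - s') - 1\<bar>)"
        by (rule mult_right_mono) (intro mult_nonneg_nonneg, auto)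
      then show "p x \<gamma> * p y \<gamma> * ((g x s)\<^sup>2 * ?u s \<gamma>) * ?u s' \<gamma>
         \<le> (g x s)\<^sup>2 * \<bar>e (y - s) - 1\<bar> * \<bar>e (y - s') - 1\<bar> * K\<^sup>2 * (p x \<gamma> * p y \<gamma> * p s \<gamma> * p s' \<gamma>)"
        by (simp add: power2_eq_square[of K] mult_ac)
    qed auto
    also have "\<dots> = ennreal ((g x s)\<^sup>2 * \<bar>e (y - s) - 1\<bar> * K\<^sup>2 * C) * ennreal \<bar>e (y - s') - 1\<bar>"
      using C_nonneg by (simp add: ennreal_mult'[symmetric] mult_ac)
    finally show "(\<integral>\<^sup>+\<gamma>. ennreal (p x \<gamma> * p y \<gamma> * ((g x s)\<^sup>2 * ?u s \<gamma>) * ?u s' \<gamma>) \<partial>P)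
       \<le> ennreal ((g x s)\<^sup>2 * \<bar>e (y - s) - 1\<bar> * K\<^sup>2 * C) * ennreal \<bar>e (y - s') - 1\<bar>" .
  qed
  also have "\<dots> = (\<integral>\<^sup>+s. ennreal ((g x s)\<^sup>2 * \<bar>e (y - s) - 1\<bar> * K\<^sup>2 * C) * (\<integral>\<^sup>+s'. ennreal \<bar>e (y - s')
      - 1\<bar> \<partial>L) \<partial>L)"
    by (intro nn_integral_cong nn_integral_cmult) measurable
  also have "\<dots> \<le> (\<integral>\<^sup>+s. ennreal ((g x s)\<^sup>2 * \<bar>e (y - s) - 1\<bar> * K\<^sup>2 * C) * ennreal \<Phi> \<partial>L)"
    by (intro nn_integral_mono mult_left_mono e_integral_L) simp
  also have "\<dots> = (\<integral>\<^sup>+s. ennreal (K\<^sup>2 * C * \<Phi>) * ennreal ((g x s)\<^sup>2 * \<bar>e (y - s) - 1\<bar>) \<partial>L)"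
    using C_nonneg \<Phi>_nonneg by (intro nn_integral_cong) (simp add: ennreal_mult'[symmetric] mult_ac)
  also have "\<dots> = ennreal (K\<^sup>2 * C * \<Phi>) * (\<integral>\<^sup>+s. ennreal ((g x s)\<^sup>2 * \<bar>e (y - s) - 1\<bar>) \<partial>L)"
    by (rule nn_integral_cmult) measurable
  finally show ?thesis .
qed

abbreviation "G2 x \<equiv> (\<integral>\<^sup>+s. ennreal ((g x s)\<^sup>2) \<partial>L)"

text \<open>The kernel that \<open>remainder_bound\<close> leaves next to g is now integrated over y
  at fixed s. This gives the second power of \<Phi>.\<close>

lemma remainder_bound_integrated:
  "(\<integral>\<^sup>+y. \<integral>\<^sup>+\<gamma>. ennreal (p x \<gamma> * p y \<gamma> * (remainder g x y \<gamma>)\<^sup>2) \<partial>P \<partial>L) \<le> ennreal (K\<^sup>2 * C * \<Phi>\<^sup>2) * G2 x"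
proof -
  note [measurable (raw)] = g_measurable remainder_measurable
  have "(\<integral>\<^sup>+y. \<integral>\<^sup>+\<gamma>. ennreal (p x \<gamma> * p y \<gamma> * (remainder g x y \<gamma>)\<^sup>2) \<partial>P \<partial>L)
     \<le> (\<integral>\<^sup>+y. ennreal (K\<^sup>2 * C * \<Phi>) * (\<integral>\<^sup>+s. ennreal ((g x s)\<^sup>2 * \<bar>e (y - s) - 1\<bar>) \<partial>L) \<partial>L)"
    by (intro nn_integral_mono remainder_bound)
  also have "\<dots> = ennreal (K\<^sup>2 * C * \<Phi>) * (\<integral>\<^sup>+y. \<integral>\<^sup>+s. ennreal ((g x s)\<^sup>2 * \<bar>e (y - s) - 1\<bar>) \<partial>L \<partial>L)"
    by (rule nn_integral_cmult) measurable
  also have "(\<integral>\<^sup>+y. \<integral>\<^sup>+s. ennreal ((g x s)\<^sup>2 * \<bar>e (y - s) - 1\<bar>) \<partial>L \<partial>L)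
      = (\<integral>\<^sup>+s. \<integral>\<^sup>+y. ennreal ((g x s)\<^sup>2 * \<bar>e (y - s) - 1\<bar>) \<partial>L \<partial>L)"
    by (rule nn_integral_swap_LL) measurable
  also have "\<dots> = (\<integral>\<^sup>+s. ennreal ((g x s)\<^sup>2) * (\<integral>\<^sup>+y. ennreal \<bar>e (y - s) - 1\<bar> \<partial>L) \<partial>L)"
    by (intro nn_integral_cong) (subst nn_integral_cmult[symmetric], auto simp: ennreal_mult')
  also have "\<dots> \<le> (\<integral>\<^sup>+s. ennreal ((g x s)\<^sup>2) * ennreal \<Phi> \<partial>L)"
    by (intro nn_integral_mono mult_left_mono e_integral_L') simp
  also have "\<dots> = G2 x * ennreal \<Phi>" by (rule nn_integral_multc) measurable
  finally have "(\<integral>\<^sup>+y. \<integral>\<^sup>+\<gamma>. ennreal (p x \<gamma> * p y \<gamma> * (remainder g x y \<gamma>)\<^sup>2) \<partial>P \<partial>L)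
     \<le> ennreal (K\<^sup>2 * C * \<Phi>) * (G2 x * ennreal \<Phi>)" by (simp add: mult_left_mono)
  also have "\<dots> = ennreal (K\<^sup>2 * C * \<Phi>\<^sup>2) * G2 x"
    using C_nonneg \<Phi>_nonneg by (simp add: power2_eq_square[of \<Phi>] ennreal_mult mult_ac)
  finally show ?thesis .
qed

lemma test_h_first_term:
  assumes x: "x \<in> \<Lambda>"
  shows "(\<integral>\<^sup>+\<gamma>. ennreal (p x \<gamma> * (test_h g x \<gamma>)\<^sup>2) \<partial>P) \<le> ennreal isometry_const * G2 x"
  unfolding test_h_def
proof (rule deterministic_isometry[OF weight_p1[OF x]])
  show "e (x - y) \<le> K\<^sup>2" for y
    using e_le[of "x - y"] self_le_power[OF K_ge_1, of 2] by simp
  show "(\<integral>\<^sup>+\<gamma>. ennreal (p x \<gamma> * p y \<gamma>) \<partial>P) \<le> ennreal C" for y by (rule moment2)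
  show "(\<integral>\<^sup>+\<gamma>. ennreal (p x \<gamma> * p y \<gamma> * p s \<gamma>) \<partial>P) \<le> ennreal C" for y s by (rule moment3)
qed (auto intro: g_le simp: g_measurable)

text \<open>Under the weight \<open>p x * p y\<close> the function \<open>test_h g x\<close> is
  split into its innovation for this weight, to which \<open>deterministic_isometry\<close> applies,
  and the remainder. The factors 2 come from the square of a sum.\<close>

lemma test_h_second_term:
  assumes x: "x \<in> \<Lambda>" and y: "y \<in> \<Lambda>"
  shows "(\<integral>\<^sup>+\<gamma>. ennreal (p x \<gamma> * p y \<gamma> * (test_h g x \<gamma>)\<^sup>2) \<partial>P)
    \<le> ennreal (2 * isometry_const) * G2 x + 2 * (\<integral>\<^sup>+\<gamma>. ennreal (p x \<gamma> * p y \<gamma> * (remainder g x y \<gamma>)\<^sup>2) \<partial>P)"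
proof -
  note [measurable (raw)] = g_measurable remainder_measurable
  let ?d = "innovation (\<lambda>s. e (x - s) * e (y - s)) (\<lambda>s _. g x s)"
  have [measurable]: "?d \<in> borel_measurable config_space"
    using innovation_tame1[OF weight_p2[OF x y] tame_g] by (simp add: tame1_def)
  have "(\<integral>\<^sup>+\<gamma>. ennreal (p x \<gamma> * p y \<gamma> * (test_h g x \<gamma>)\<^sup>2) \<partial>P) \<le>
     (\<integral>\<^sup>+\<gamma>. 2 * ennreal (p x \<gamma> * p y \<gamma> * (?d \<gamma>)\<^sup>2) + 2 * ennreal (p x \<gamma> * p y \<gamma> * (remainder g x y \<gamma>)\<^sup>2) \<partial>P)"
  proof (intro nn_integral_mono)
    fix \<gamma> assume "\<gamma> \<in> space P"
    then have "test_h g x \<gamma> = ?d \<gamma> + remainder g x y \<gamma>" by (intro test_h_split) simp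
    then have "(test_h g x \<gamma>)\<^sup>2 \<le> 2 * (?d \<gamma>)\<^sup>2 + 2 * (remainder g x y \<gamma>)\<^sup>2"
      using sum_squares_bound[of "?d \<gamma>" "remainder g x y \<gamma>"] by (simp add: power2_sum)
    then have "(p x \<gamma> * p y \<gamma>) * (test_h g x \<gamma>)\<^sup>2
        \<le> (p x \<gamma> * p y \<gamma>) * (2 * (?d \<gamma>)\<^sup>2 + 2 * (remainder g x y \<gamma>)\<^sup>2)"
      by (rule mult_left_mono) simp
    then have "ennreal (p x \<gamma> * p y \<gamma> * (test_h g x \<gamma>)\<^sup>2)
        \<le> ennreal (2 * (p x \<gamma> * p y \<gamma> * (?d \<gamma>)\<^sup>2) + 2 * (p x \<gamma> * p y \<gamma> * (remainder g x y \<gamma>)\<^sup>2))"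
      by (intro ennreal_leI) (simp add: algebra_simps)
    then show "ennreal (p x \<gamma> * p y \<gamma> * (test_h g x \<gamma>)\<^sup>2) \<le>
       2 * ennreal (p x \<gamma> * p y \<gamma> * (?d \<gamma>)\<^sup>2) + 2 * ennreal (p x \<gamma> * p y \<gamma> * (remainder g x y \<gamma>)\<^sup>2)"
      by (simp add: ennreal_mult')
  qed
  also have "\<dots> = 2 * (\<integral>\<^sup>+\<gamma>. ennreal (p x \<gamma> * p y \<gamma> * (?d \<gamma>)\<^sup>2) \<partial>P)
      + 2 * (\<integral>\<^sup>+\<gamma>. ennreal (p x \<gamma> * p y \<gamma> * (remainder g x y \<gamma>)\<^sup>2) \<partial>P)"
    by (subst nn_integral_add, measurable, measurable) (simp add: nn_integral_cmult)
  also have "\<dots> \<le> 2 * (ennreal isometry_const * G2 x)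
      + 2 * (\<integral>\<^sup>+\<gamma>. ennreal (p x \<gamma> * p y \<gamma> * (remainder g x y \<gamma>)\<^sup>2) \<partial>P)"
  proof (intro add_mono mult_left_mono order_refl deterministic_isometry[OF weight_p2[OF x y]])
    show "e (x - s) * e (y - s) \<le> K\<^sup>2" for s
      unfolding power2_eq_square using K_ge_1 by (intro mult_mono e_le) auto
    show "(\<integral>\<^sup>+\<gamma>. ennreal (p x \<gamma> * p y \<gamma> * p s \<gamma>) \<partial>P) \<le> ennreal C" for s by (rule moment3)
    show "(\<integral>\<^sup>+\<gamma>. ennreal (p x \<gamma> * p y \<gamma> * p s \<gamma> * p s' \<gamma>) \<partial>P) \<le> ennreal C" for s s' by (rule moment4)
  qed (auto intro: g_le simp: g_measurable)
  also have "2 * (ennreal isometry_const * G2 x) = ennreal (2 * isometry_const) * G2 x"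
    by (simp add: ennreal_mult' mult.assoc)
  finally show ?thesis .
qed

lemma test_function_bound:
  "(\<integral>\<^sup>+\<gamma>. ennreal ((innovation (\<lambda>_. 1) (test_h g) \<gamma>)\<^sup>2) \<partial>P)
      \<le> ennreal variance_const * (\<integral>\<^sup>+x. \<integral>\<^sup>+y. ennreal ((g x y)\<^sup>2) \<partial>L \<partial>L)"
proof -
  note [measurable (raw)] = g_measurable remainder_measurable
  note [measurable (raw)] = borel_measurable_pair[OF test_h_pair]
  let ?GG = "\<integral>\<^sup>+x. G2 x \<partial>L" and ?R = "\<lambda>x y. \<integral>\<^sup>+\<gamma>. ennreal (p x \<gamma> * p y \<gamma> * (remainder g x y \<gamma>)\<^sup>2) \<partial>P"
  have [measurable]: "G2 \<in> borel_measurable borel" by measurable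
  have 1: "(\<integral>\<^sup>+x. \<integral>\<^sup>+\<gamma>. ennreal (p x \<gamma> * (test_h g x \<gamma>)\<^sup>2) \<partial>P \<partial>L) \<le> ennreal isometry_const * ?GG"
  proof -
    have "(\<integral>\<^sup>+x. \<integral>\<^sup>+\<gamma>. ennreal (p x \<gamma> * (test_h g x \<gamma>)\<^sup>2) \<partial>P \<partial>L) \<le> (\<integral>\<^sup>+x. ennreal isometry_const * G2 x \<partial>L)"
      by (intro nn_integral_mono_AE AE_L test_h_first_term)
    also have "\<dots> = ennreal isometry_const * ?GG" by (rule nn_integral_cmult) measurable
    finally show ?thesis .
  qed
  \<comment> \<open>The kernel e - 1 is used in two ways: next to \<open>G2 x\<close> it is
    integrated to \<Phi>, next to \<open>?R\<close> it is only bounded by \<open>K\<close>, because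
    the integral of \<open>?R\<close> over y is already controlled.\<close>
  have 2: "(\<integral>\<^sup>+x. \<integral>\<^sup>+y. \<integral>\<^sup>+\<gamma>. ennreal (p x \<gamma> * p y \<gamma> * \<bar>e (x - y) - 1\<bar> * (test_h g x \<gamma>)\<^sup>2) \<partial>P \<partial>L \<partial>L)
      \<le> ennreal (2 * \<Phi> * isometry_const + 2 * K * (K\<^sup>2 * C * \<Phi>\<^sup>2)) * ?GG"
  proof -
    have "(\<integral>\<^sup>+y. \<integral>\<^sup>+\<gamma>. ennreal (p x \<gamma> * p y \<gamma> * \<bar>e (x - y) - 1\<bar> * (test_h g x \<gamma>)\<^sup>2) \<partial>P \<partial>L)
       \<le> ennreal (2 * \<Phi> * isometry_const + 2 * K * (K\<^sup>2 * C * \<Phi>\<^sup>2)) * G2 x" if x: "x \<in> \<Lambda>" for x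
    proof -
      have "(\<integral>\<^sup>+y. \<integral>\<^sup>+\<gamma>. ennreal (p x \<gamma> * p y \<gamma> * \<bar>e (x - y) - 1\<bar> * (test_h g x \<gamma>)\<^sup>2) \<partial>P \<partial>L)
        \<le> (\<integral>\<^sup>+y. (ennreal (2 * isometry_const) * G2 x) * ennreal \<bar>e (x - y) - 1\<bar>
            + ennreal (2 * K) * ?R x y \<partial>L)"
      proof (intro nn_integral_mono_AE AE_L)
        fix y assume y: "y \<in> \<Lambda>"
        have "(\<integral>\<^sup>+\<gamma>. ennreal (p x \<gamma> * p y \<gamma> * \<bar>e (x - y) - 1\<bar> * (test_h g x \<gamma>)\<^sup>2) \<partial>P)
          = (\<integral>\<^sup>+\<gamma>. ennreal \<bar>e (x - y) - 1\<bar> * ennreal (p x \<gamma> * p y \<gamma> * (test_h g x \<gamma>)\<^sup>2) \<partial>P)"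
          by (intro nn_integral_cong) (simp add: ennreal_mult'[symmetric] mult_ac)
        also have "\<dots> = ennreal \<bar>e (x - y) - 1\<bar> * (\<integral>\<^sup>+\<gamma>. ennreal (p x \<gamma> * p y \<gamma> * (test_h g x \<gamma>)\<^sup>2) \<partial>P)"
          by (rule nn_integral_cmult) measurable
        also have "\<dots> \<le> ennreal \<bar>e (x - y) - 1\<bar> * (ennreal (2 * isometry_const) * G2 x + 2 * ?R x y)"
          by (intro mult_left_mono test_h_second_term x y) simp
        also have "\<dots> = (ennreal (2 * isometry_const) * G2 x) * ennreal \<bar>e (x - y) - 1\<bar>
            + ennreal (2 * \<bar>e (x - y) - 1\<bar>) * ?R x y"
          by (simp add: distrib_left mult_ac ennreal_mult')
        also have "\<dots> \<le> (ennreal (2 * isometry_const) * G2 x) * ennreal \<bar>e (x - y) - 1\<bar>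
            + ennreal (2 * K) * ?R x y"
          using abs_e_diff_le[of "x - y"] by (intro add_mono order_refl mult_right_mono ennreal_leI) auto
        finally show "(\<integral>\<^sup>+\<gamma>. ennreal (p x \<gamma> * p y \<gamma> * \<bar>e (x - y) - 1\<bar> * (test_h g x \<gamma>)\<^sup>2) \<partial>P) \<le>
           (ennreal (2 * isometry_const) * G2 x) * ennreal \<bar>e (x - y) - 1\<bar> + ennreal (2 * K) * ?R x y" .
      qed
      also have "\<dots> = (ennreal (2 * isometry_const) * G2 x) * (\<integral>\<^sup>+y. ennreal \<bar>e (x - y) - 1\<bar> \<partial>L)
          + ennreal (2 * K) * (\<integral>\<^sup>+y. ?R x y \<partial>L)"
        by (subst nn_integral_add, measurable, measurable) (simp add: nn_integral_cmult)
      also have "\<dots> \<le> (ennreal (2 * isometry_const) * G2 x) * ennreal \<Phi>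
          + ennreal (2 * K) * (ennreal (K\<^sup>2 * C * \<Phi>\<^sup>2) * G2 x)"
        by (intro add_mono mult_left_mono e_integral_L remainder_bound_integrated) simp_all
      also have "\<dots> = (ennreal (2 * \<Phi> * isometry_const) + ennreal (2 * K * (K\<^sup>2 * C * \<Phi>\<^sup>2))) * G2 x"
        using isometry_const_nonneg \<Phi>_nonneg C_nonneg K_ge_1 by (simp add: algebra_simps ennreal_mult)
      also have "\<dots> = ennreal (2 * \<Phi> * isometry_const + 2 * K * (K\<^sup>2 * C * \<Phi>\<^sup>2)) * G2 x"
        using isometry_const_nonneg \<Phi>_nonneg C_nonneg K_ge_1 by (subst ennreal_plus) auto
      finally show ?thesis .
    qed
    then have "(\<integral>\<^sup>+x. \<integral>\<^sup>+y. \<integral>\<^sup>+\<gamma>. ennreal (p x \<gamma> * p y \<gamma> * \<bar>e (x - y) - 1\<bar> * (test_h g x \<gamma>)\<^sup>2) \<partial>P \<partial>L \<partial>L)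
      \<le> (\<integral>\<^sup>+x. ennreal (2 * \<Phi> * isometry_const + 2 * K * (K\<^sup>2 * C * \<Phi>\<^sup>2)) * G2 x \<partial>L)"
      by (intro nn_integral_mono_AE AE_L)
    also have "\<dots> = ennreal (2 * \<Phi> * isometry_const + 2 * K * (K\<^sup>2 * C * \<Phi>\<^sup>2)) * ?GG"
        by (rule nn_integral_cmult) measurable
    finally show ?thesis .
  qed
  \<comment> \<open>For y outside \<gamma> the increment is
    \<open>g x y - remainder g x y \<gamma>\<close>, and e is bounded by \<open>K\<close>. The part
    with g needs only \<open>moment2\<close>, the other part is
    \<open>remainder_bound_integrated\<close>.\<close>
  have 3: "(\<integral>\<^sup>+x. \<integral>\<^sup>+y. \<integral>\<^sup>+\<gamma>. ennreal (p x \<gamma> * p y \<gamma> * e (x - y) * (test_h g x (insert y \<gamma>)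
      - test_h g x \<gamma>)\<^sup>2) \<partial>P \<partial>L \<partial>L)
      \<le> ennreal (2 * K * C + 2 * K * (K\<^sup>2 * C * \<Phi>\<^sup>2)) * ?GG"
  proof -
    have "(\<integral>\<^sup>+y. \<integral>\<^sup>+\<gamma>. ennreal (p x \<gamma> * p y \<gamma> * e (x - y) * (test_h g x (insert y \<gamma>) - test_h g x \<gamma>)\<^sup>2) \<partial>P \<partial>L)
       \<le> ennreal (2 * K * C + 2 * K * (K\<^sup>2 * C * \<Phi>\<^sup>2)) * G2 x" if x: "x \<in> \<Lambda>" for x
    proof -
      have "(\<integral>\<^sup>+y. \<integral>\<^sup>+\<gamma>. ennreal (p x \<gamma> * p y \<gamma> * e (x - y) * (test_h g x (insert y \<gamma>)
          - test_h g x \<gamma>)\<^sup>2) \<partial>P \<partial>L)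
       = (\<integral>\<^sup>+\<gamma>. \<integral>\<^sup>+y. ennreal (p x \<gamma> * p y \<gamma> * e (x - y) * (test_h g x (insert y \<gamma>) - test_h g x \<gamma>)\<^sup>2) \<partial>L \<partial>P)"
        by (rule nn_integral_swap[symmetric]) measurable
      also have "\<dots> \<le> (\<integral>\<^sup>+\<gamma>. \<integral>\<^sup>+y. ennreal (2 * K * (g x y)\<^sup>2) * ennreal (p x \<gamma> * p y \<gamma>)
          + ennreal (2 * K) * ennreal (p x \<gamma> * p y \<gamma> * (remainder g x y \<gamma>)\<^sup>2) \<partial>L \<partial>P)"
      proof (rule nn_integral_mono, rule nn_integral_mono_AE)
        fix \<gamma> assume "\<gamma> \<in> space P"
        then have \<gamma>: "\<gamma> \<in> locally_finite_sets" by simp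
        show "AE y in L. ennreal (p x \<gamma> * p y \<gamma> * e (x - y) * (test_h g x (insert y \<gamma>) - test_h g x \<gamma>)\<^sup>2) \<le>
          ennreal (2 * K * (g x y)\<^sup>2) * ennreal (p x \<gamma> * p y \<gamma>)
              + ennreal (2 * K) * ennreal (p x \<gamma> * p y \<gamma> * (remainder g x y \<gamma>)\<^sup>2)"
        proof (rule AE_L_notin[OF \<gamma>])
          fix y assume y: "y \<in> \<Lambda>" "y \<notin> \<gamma>"
          have "(g x y - remainder g x y \<gamma>)\<^sup>2 \<le> 2 * (g x y)\<^sup>2 + 2 * (remainder g x y \<gamma>)\<^sup>2"
            using sum_squares_bound[of "g x y" "- remainder g x y \<gamma>"] by (simp add: power2_diff)
          then have "e (x - y) * (g x y - remainder g x y \<gamma>)\<^sup>2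
              \<le> K * (2 * (g x y)\<^sup>2 + 2 * (remainder g x y \<gamma>)\<^sup>2)"
            using K_ge_1 by (intro mult_mono e_le) auto
          then have "(p x \<gamma> * p y \<gamma>) * (e (x - y) * (g x y - remainder g x y \<gamma>)\<^sup>2)
              \<le> (p x \<gamma> * p y \<gamma>) * (K * (2 * (g x y)\<^sup>2 + 2 * (remainder g x y \<gamma>)\<^sup>2))"
            by (rule mult_left_mono) simp
          then have "ennreal (p x \<gamma> * p y \<gamma> * e (x - y) * (g x y - remainder g x y \<gamma>)\<^sup>2) \<le>
             ennreal (2 * K * (g x y)\<^sup>2 * (p x \<gamma> * p y \<gamma>) + 2 * K * (p x \<gamma> * p y \<gamma> * (remainder g x y \<gamma>)\<^sup>2))"
            by (intro ennreal_leI) (simp add: algebra_simps)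
          also have "\<dots> = ennreal (2 * K * (g x y)\<^sup>2) * ennreal (p x \<gamma> * p y \<gamma>)
              + ennreal (2 * K) * ennreal (p x \<gamma> * p y \<gamma> * (remainder g x y \<gamma>)\<^sup>2)"
            using K_ge_1 by (subst ennreal_plus) (auto simp: ennreal_mult'[symmetric])
          finally show "ennreal (p x \<gamma> * p y \<gamma> * e (x - y) * (test_h g x (insert y \<gamma>) - test_h g x \<gamma>)\<^sup>2) \<le>
            ennreal (2 * K * (g x y)\<^sup>2) * ennreal (p x \<gamma> * p y \<gamma>)
                + ennreal (2 * K) * ennreal (p x \<gamma> * p y \<gamma> * (remainder g x y \<gamma>)\<^sup>2)"
            unfolding test_h_insert[OF \<gamma> x y] .
        qed
      qed
      also have "\<dots> = (\<integral>\<^sup>+y. \<integral>\<^sup>+\<gamma>. ennreal (2 * K * (g x y)\<^sup>2) * ennreal (p x \<gamma> * p y \<gamma>)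
          + ennreal (2 * K) * ennreal (p x \<gamma> * p y \<gamma> * (remainder g x y \<gamma>)\<^sup>2) \<partial>P \<partial>L)"
        by (rule nn_integral_swap) measurable
      also have "\<dots> = (\<integral>\<^sup>+y. ennreal (2 * K * (g x y)\<^sup>2) * (\<integral>\<^sup>+\<gamma>. ennreal (p x \<gamma> * p y \<gamma>) \<partial>P)
          + ennreal (2 * K) * ?R x y \<partial>L)"
        by (intro nn_integral_cong) (subst nn_integral_add, measurable, measurable, simp add:
            nn_integral_cmult)
      also have "\<dots> \<le> (\<integral>\<^sup>+y. ennreal (2 * K * (g x y)\<^sup>2) * ennreal C + ennreal (2 * K) * ?R x y \<partial>L)"
        by (intro nn_integral_mono add_mono order_refl mult_left_mono moment2) simp
      also have "\<dots> = (\<integral>\<^sup>+y. ennreal (2 * K * C) * ennreal ((g x y)\<^sup>2) + ennreal (2 * K) * ?R x y \<partial>L)"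
        using C_nonneg K_ge_1 by (intro nn_integral_cong) (simp add: ennreal_mult'[symmetric] mult_ac)
      also have "\<dots> = ennreal (2 * K * C) * G2 x + ennreal (2 * K) * (\<integral>\<^sup>+y. ?R x y \<partial>L)"
        by (subst nn_integral_add, measurable, measurable) (simp add: nn_integral_cmult)
      also have "\<dots> \<le> ennreal (2 * K * C) * G2 x + ennreal (2 * K) * (ennreal (K\<^sup>2 * C * \<Phi>\<^sup>2) * G2 x)"
        by (intro add_mono order_refl mult_left_mono remainder_bound_integrated) simp
      also have "\<dots> = (ennreal (2 * K * C) + ennreal (2 * K * (K\<^sup>2 * C * \<Phi>\<^sup>2))) * G2 x"
        using \<Phi>_nonneg C_nonneg K_ge_1 by (simp add: algebra_simps ennreal_mult)
      also have "\<dots> = ennreal (2 * K * C + 2 * K * (K\<^sup>2 * C * \<Phi>\<^sup>2)) * G2 x"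
        using \<Phi>_nonneg C_nonneg K_ge_1 by (subst ennreal_plus) auto
      finally show ?thesis .
    qed
    then have "(\<integral>\<^sup>+x. \<integral>\<^sup>+y. \<integral>\<^sup>+\<gamma>. ennreal (p x \<gamma> * p y \<gamma> * e (x - y) * (test_h g x (insert y \<gamma>)
        - test_h g x \<gamma>)\<^sup>2) \<partial>P \<partial>L \<partial>L)
      \<le> (\<integral>\<^sup>+x. ennreal (2 * K * C + 2 * K * (K\<^sup>2 * C * \<Phi>\<^sup>2)) * G2 x \<partial>L)"
      by (intro nn_integral_mono_AE AE_L)
    also have "\<dots> = ennreal (2 * K * C + 2 * K * (K\<^sup>2 * C * \<Phi>\<^sup>2)) * ?GG" by (rule nn_integral_cmult) measurable
    finally show ?thesis .
  qed
  have "(\<integral>\<^sup>+\<gamma>. ennreal ((innovation (\<lambda>_. 1) (test_h g) \<gamma>)\<^sup>2) \<partial>P) \<le> ennreal isometry_const * ?GG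
     + ennreal (2 * \<Phi> * isometry_const + 2 * K * (K\<^sup>2 * C * \<Phi>\<^sup>2)) * ?GG + ennreal (2 * K * C
         + 2 * K * (K\<^sup>2 * C * \<Phi>\<^sup>2)) * ?GG"
    using order_trans[OF isometry[OF weight_one tame_test_h]] add_mono[OF add_mono[OF 1 2] 3] by simp
  also have "\<dots> = ennreal variance_const * ?GG"
    using \<Phi>_nonneg C_nonneg K_ge_1 isometry_const_nonneg unfolding variance_const_def
    by (simp add: distrib_right[symmetric] ennreal_plus[symmetric] del: ennreal_plus)
  finally show ?thesis .
qed

end

end

section \<open>Pair energies and their covariance with the test functional\<close>

lemma integral_product_square_le:
  fixes f g :: "'a \<Rightarrow> real"
  assumes [measurable]: "f \<in> borel_measurable M" "g \<in> borel_measurable M"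
    and "integrable M (\<lambda>x. (f x)\<^sup>2)" "integrable M (\<lambda>x. (g x)\<^sup>2)"
  shows "(\<integral>x. f x * g x \<partial>M)\<^sup>2 \<le> (\<integral>x. (f x)\<^sup>2 \<partial>M) * (\<integral>x. (g x)\<^sup>2 \<partial>M)"
proof -
  have "ennreal ((\<integral>x. f x * g x \<partial>M)\<^sup>2) = (ennreal \<bar>\<integral>x. f x * g x \<partial>M\<bar>)\<^sup>2"
    by (simp add: ennreal_power)
  also have "\<dots> \<le> (\<integral>\<^sup>+x. ennreal \<bar>f x * g x\<bar> \<partial>M)\<^sup>2"
    by (intro power_mono ennreal_abs_integral_le) simp
  also have "(\<integral>\<^sup>+x. ennreal \<bar>f x * g x\<bar> \<partial>M) = (\<integral>\<^sup>+x. ennreal \<bar>f x\<bar> * ennreal \<bar>g x\<bar> \<partial>M)"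
    by (intro nn_integral_cong) (simp add: ennreal_mult'[symmetric] abs_mult)
  also have "\<dots>\<^sup>2 \<le> (\<integral>\<^sup>+x. (ennreal \<bar>f x\<bar>)\<^sup>2 \<partial>M) * (\<integral>\<^sup>+x. (ennreal \<bar>g x\<bar>)\<^sup>2 \<partial>M)"
    by (rule Cauchy_Schwarz_nn_integral) measurable
  also have "\<dots> = ennreal ((\<integral>x. (f x)\<^sup>2 \<partial>M) * (\<integral>x. (g x)\<^sup>2 \<partial>M))"
    using assms(3,4) by (simp add: ennreal_power nn_integral_eq_integral ennreal_mult)
  finally show ?thesis by (subst (asm) ennreal_le_iff) auto
qed

lemma product_integrable:
  fixes f g :: "'a \<Rightarrow> real"
  assumes [measurable]: "f \<in> borel_measurable M" "g \<in> borel_measurable M"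
    and "integrable M (\<lambda>x. (f x)\<^sup>2)" "integrable M (\<lambda>x. (g x)\<^sup>2)"
  shows "integrable M (\<lambda>x. f x * g x)"
proof (rule Bochner_Integration.integrable_bound)
  show "integrable M (\<lambda>x. (f x)\<^sup>2 + (g x)\<^sup>2)" using assms by simp
  have "\<bar>f x * g x\<bar> \<le> (f x)\<^sup>2 + (g x)\<^sup>2" for x
    using sum_squares_bound[of "\<bar>f x\<bar>" "\<bar>g x\<bar>"] zero_le_power2[of "f x"] zero_le_power2[of "g x"]
    unfolding abs_mult power2_abs mult.assoc by linarith
  then show "AE x in M. norm (f x * g x) \<le> norm ((f x)\<^sup>2 + (g x)\<^sup>2)" by simp
qed measurable

lemma borel_measurable_pair_borel:
  fixes k :: "'a::euclidean_space \<Rightarrow> 'b::euclidean_space \<Rightarrow> real"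
  assumes "case_prod k \<in> borel_measurable (borel \<Otimes>\<^sub>M borel)" "f1 \<in> N \<rightarrow>\<^sub>M borel" "f2 \<in> N \<rightarrow>\<^sub>M borel"
  shows "(\<lambda>m. k (f1 m) (f2 m)) \<in> borel_measurable N"
  using measurable_compose[OF measurable_Pair[OF assms(2,3)] assms(1)] by simp

context papangelou begin

definition point_energy :: "('a \<Rightarrow> 'a \<Rightarrow> real) \<Rightarrow> 'a \<Rightarrow> 'a set \<Rightarrow> real" where
  "point_energy k x \<gamma> = (\<Sum>y\<in>\<gamma> \<inter> \<Lambda>. k x y)"

text \<open>The sum over ordered pairs is written as a sum over x of a function of
  \<open>\<gamma> - {x}\<close>, the form required by the Georgii-Nguyen-Zessin equation. Kernels of
  two variables make room for products such as \<open>g x y * k x y\<close>.\<close>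

definition energy :: "('a \<Rightarrow> 'a \<Rightarrow> real) \<Rightarrow> 'a set \<Rightarrow> real" where
  "energy k \<gamma> = (\<Sum>x\<in>\<gamma> \<inter> \<Lambda>. point_energy k x (\<gamma> - {x}))"

lemma pair_energy_eq_energy:
  assumes "\<gamma> \<in> locally_finite_sets"
  shows "pair_energy v \<Lambda> \<gamma> = energy (\<lambda>x y. v (x - y)) \<gamma>"
proof -
  have "{(x, y). x \<in> \<gamma> \<inter> \<Lambda> \<and> y \<in> \<gamma> \<inter> \<Lambda> \<and> x \<noteq> y} = (SIGMA x:\<gamma> \<inter> \<Lambda>. (\<gamma> - {x}) \<inter> \<Lambda>)" by auto
  then show ?thesis
    using assms by (simp add: pair_energy_def energy_def point_energy_def sum.Sigma)
qed

lemma point_energy_measurable: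
  assumes k: "case_prod k \<in> borel_measurable (borel \<Otimes>\<^sub>M borel)"
  shows "case_prod (point_energy k) \<in> borel_measurable (borel \<Otimes>\<^sub>M config_space)"
proof -
  note [measurable (raw)] = borel_measurable_pair_borel[OF k]
  show ?thesis unfolding point_energy_def by measurable
qed

lemma energy_measurable:
  assumes k: "case_prod k \<in> borel_measurable (borel \<Otimes>\<^sub>M borel)"
  shows "energy k \<in> borel_measurable config_space"
proof -
  note [measurable (raw)] = borel_measurable_pair[OF point_energy_measurable[OF k]]
  show ?thesis unfolding energy_def by measurable
qed

text \<open>Pairs are ordered and k is symmetric, so each pair with the new point counts twice;
  hence the factor 2.\<close>

lemma energy_insert:
  assumes \<gamma>: "\<gamma> \<in> locally_finite_sets" and x: "x \<in> \<Lambda>" "x \<notin> \<gamma>" and sym: "\<And>x y. k x y = k y x"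
  shows "energy k (insert x \<gamma>) - energy k \<gamma> = 2 * point_energy k x \<gamma>"
proof -
  have 1: "insert x \<gamma> \<inter> \<Lambda> = insert x (\<gamma> \<inter> \<Lambda>)" and 2: "insert x \<gamma> - {x} = \<gamma>" using x by auto
  have 3: "point_energy k y (insert x \<gamma> - {y}) = k x y + point_energy k y (\<gamma> - {y})" if "y \<in> \<gamma>" for y
  proof -
    have "(insert x \<gamma> - {y}) \<inter> \<Lambda> = insert x ((\<gamma> - {y}) \<inter> \<Lambda>)" using x that by auto
    then show ?thesis using x \<gamma> by (simp add: point_energy_def sum.insert sym[of y x])
  qed
  have "energy k (insert x \<gamma>) = point_energy k x \<gamma> + (\<Sum>y\<in>\<gamma> \<inter> \<Lambda>. k x y + point_energy k y (\<gamma> - {y}))"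
    unfolding energy_def 1 using x \<gamma> by (simp add: 2 3)
  then show ?thesis by (simp add: energy_def point_energy_def sum.distrib)
qed

lemma polybd_point_energy:
  assumes k: "\<And>x y. \<bar>k x y\<bar> \<le> M"
  shows "polybd \<Lambda> (point_energy k)"
proof -
  have "polybd (\<Lambda> \<times> \<Lambda>) (\<lambda>(x, y) \<gamma>. k x y)"
    unfolding case_prod_beta' by (rule polybd_bounded[where B=M]) (rule k)
  then show ?thesis unfolding point_energy_def by (intro polybd_sum) (simp add: case_prod_beta')
qed

lemma tame1_energy:
  assumes k: "\<And>x y. \<bar>k x y\<bar> \<le> M" and m: "case_prod k \<in> borel_measurable (borel \<Otimes>\<^sub>M borel)"
  shows "tame1 (energy k)"
proof -
  have "pb (energy k)" unfolding energy_def
      by (rule polybd_sum_delete[OF polybd_snd[OF polybd_point_energy[OF k]]])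
  then show ?thesis using energy_measurable[OF m] by (simp add: tame1_def)
qed

text \<open>Two applications of \<open>GNZ_weight\<close>: with trivial weight it extracts x, and
  with weight \<open>p x\<close> it extracts y, which then carries the factor
  \<open>e (x - y)\<close>.\<close>

lemma expectation_energy:
  assumes k: "\<And>x y. \<bar>k x y\<bar> \<le> M" and m: "case_prod k \<in> borel_measurable (borel \<Otimes>\<^sub>M borel)"
  shows "(\<integral>\<gamma>. energy k \<gamma> \<partial>P) = (\<integral>x. (\<integral>\<gamma>. p x \<gamma> * (\<integral>y. k x y * (p y \<gamma> * e (x - y)) \<partial>L) \<partial>P) \<partial>L)"
proof -
  note mS = point_energy_measurable[OF m]
  note [measurable (raw)] = borel_measurable_pair[OF mS]
  have km: "(\<lambda>(y, _). k x y) \<in> borel_measurable (borel \<Otimes>\<^sub>M config_space)" for x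
    using borel_measurable_pair_borel[OF m, of "\<lambda>_. x" "borel \<Otimes>\<^sub>M config_space" fst]
        by (simp add: case_prod_beta')
  have "(\<integral>\<gamma>. energy k \<gamma> \<partial>P) = (\<integral>\<gamma>. (\<integral>x. point_energy k x \<gamma> * p x \<gamma> \<partial>L) \<partial>P)"
    unfolding energy_def using GNZ_weight[OF weight_one mS polybd_point_energy[OF k]] by simp
  also have "\<dots> = (\<integral>x. (\<integral>\<gamma>. point_energy k x \<gamma> * p x \<gamma> \<partial>P) \<partial>L)"
    by (rule expectation_integral_swap) (intro polybd_mult polybd_point_energy[OF k] polybd_p, measurable)
  also have "\<dots> = (\<integral>x. (\<integral>\<gamma>. p x \<gamma> * (\<integral>y. k x y * (p y \<gamma> * e (x - y)) \<partial>L) \<partial>P) \<partial>L)"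
  proof (rule integral_cong_AE)
    show "AE x in L. (\<integral>\<gamma>. point_energy k x \<gamma> * p x \<gamma> \<partial>P)
        = (\<integral>\<gamma>. p x \<gamma> * (\<integral>y. k x y * (p y \<gamma> * e (x - y)) \<partial>L) \<partial>P)"
    proof (rule AE_L)
      fix x assume x: "x \<in> \<Lambda>"
      have "polybd \<Lambda> (\<lambda>y _. k x y)" by (rule polybd_bounded[where B=M]) (rule k)
      from GNZ_weight[OF weight_p1[OF x] km this]
      show "(\<integral>\<gamma>. point_energy k x \<gamma> * p x \<gamma> \<partial>P) = (\<integral>\<gamma>. p x \<gamma> * (\<integral>y. k x y * (p y \<gamma> * e (x - y)) \<partial>L) \<partial>P)"
        unfolding point_energy_def by (simp add: mult.commute)
    qed
    note [measurable (raw)] = borel_measurable_pair_borel[OF m]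
    show "(\<lambda>x. \<integral>\<gamma>. point_energy k x \<gamma> * p x \<gamma> \<partial>P) \<in> borel_measurable L"
      "(\<lambda>x. \<integral>\<gamma>. p x \<gamma> * (\<integral>y. k x y * (p y \<gamma> * e (x - y)) \<partial>L) \<partial>P) \<in> borel_measurable L"
      by measurable
  qed
  finally show ?thesis .
qed

abbreviation "test_functional g \<equiv> innovation (\<lambda>_. 1) (test_h g)"

text \<open>Two integrations by parts. The first replaces the energy by its increment
  \<open>2 * point_energy k x\<close>, the second replaces this by its own increment
  \<open>k x y\<close>, which is deterministic. What remains is the double integral of
  \<open>expectation_energy\<close> for the kernel \<open>g x y * k x y\<close>.\<close>

lemma covariance:
  assumes k: "\<And>x y. \<bar>k x y\<bar> \<le> M" and km: "case_prod k \<in> borel_measurable (borel \<Otimes>\<^sub>M borel)"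
    and sym: "\<And>x y. k x y = k y x"
    and g: "\<And>x y. \<bar>g x y\<bar> \<le> M" and gm: "case_prod g \<in> borel_measurable (borel \<Otimes>\<^sub>M borel)"
  shows "(\<integral>\<gamma>. energy k \<gamma> * test_functional g \<gamma> \<partial>P) = 2 * (\<integral>\<gamma>. energy (\<lambda>x y. g x y * k x y) \<gamma> \<partial>P)"
proof -
  note mS = point_energy_measurable[OF km]
  note h = tame_test_h[OF gm g]
  then have mh: "case_prod (test_h g) \<in> borel_measurable (borel \<Otimes>\<^sub>M config_space)" and ph: "polybd \<Lambda>
      (test_h g)"
    by (auto simp: tame_def)
  note [measurable (raw)] = borel_measurable_pair[OF mS] borel_measurable_pair[OF mh]
  have gk: "\<bar>g x y * k x y\<bar> \<le> M * M" for x y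
    unfolding abs_mult using k g by (intro mult_mono) (auto intro: order_trans[OF abs_ge_zero])
  have gkm: "(\<lambda>(x, y). g x y * k x y) \<in> borel_measurable (borel \<Otimes>\<^sub>M borel)"
    using borel_measurable_times[OF gm km] by (simp add: case_prod_beta')
  note [measurable (raw)] = borel_measurable_pair_borel[OF gm]
  note [measurable (raw)] = borel_measurable_pair_borel[OF km]
  note [measurable] = energy_measurable[OF km]
  have "(\<integral>\<gamma>. energy k \<gamma> * test_functional g \<gamma> \<partial>P)
      = (\<integral>\<gamma>. (\<integral>x. test_h g x \<gamma> * (energy k (insert x \<gamma>) - energy k \<gamma>) * p x \<gamma> \<partial>L) \<partial>P)"
    using ibp[OF weight_one h tame1_energy[OF k km]] by simp
  also have "\<dots> = (\<integral>\<gamma>. (\<integral>x. 2 * (p x \<gamma> * (point_energy k x \<gamma> * test_h g x \<gamma>)) \<partial>L) \<partial>P)"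
  proof (rule Bochner_Integration.integral_cong[OF refl])
    fix \<gamma> assume "\<gamma> \<in> space P"
    then have \<gamma>: "\<gamma> \<in> locally_finite_sets" and [measurable]: "\<gamma> \<in> space config_space" by auto
    show "(\<integral>x. test_h g x \<gamma> * (energy k (insert x \<gamma>) - energy k \<gamma>) * p x \<gamma> \<partial>L)
        = (\<integral>x. 2 * (p x \<gamma> * (point_energy k x \<gamma> * test_h g x \<gamma>)) \<partial>L)"
    proof (rule integral_cong_AE)
      show "AE x in L. test_h g x \<gamma> * (energy k (insert x \<gamma>) - energy k \<gamma>) * p x \<gamma>
          = 2 * (p x \<gamma> * (point_energy k x \<gamma> * test_h g x \<gamma>))"
        by (rule AE_L_notin[OF \<gamma>]) (simp add: energy_insert[OF \<gamma> _ _ sym])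
    qed measurable
  qed
  also have "\<dots> = (\<integral>x. (\<integral>\<gamma>. 2 * (p x \<gamma> * (point_energy k x \<gamma> * test_h g x \<gamma>)) \<partial>P) \<partial>L)"
    by (rule expectation_integral_swap)
      (intro polybd_mult polybd_const polybd_point_energy[OF k] ph polybd_p, measurable)
  also have "\<dots> = (\<integral>x. 2 * (\<integral>\<gamma>. p x \<gamma> * (\<integral>y. (g x y * k x y) * (p y \<gamma> * e (x - y)) \<partial>L) \<partial>P) \<partial>L)"
  proof (rule integral_cong_AE)
    show "AE x in L. (\<integral>\<gamma>. 2 * (p x \<gamma> * (point_energy k x \<gamma> * test_h g x \<gamma>)) \<partial>P)
        = 2 * (\<integral>\<gamma>. p x \<gamma> * (\<integral>y. (g x y * k x y) * (p y \<gamma> * e (x - y)) \<partial>L) \<partial>P)"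
    proof (rule AE_L)
      fix x assume x: "x \<in> \<Lambda>"
      have T: "tame1 (point_energy k x)"
          using tame1_section[OF _ x, of "point_energy k"] mS polybd_point_energy[OF k]
          by (simp add: tame_def)
      have Si: "point_energy k x (insert y \<gamma>) - point_energy k x \<gamma> = k x y"
          if "\<gamma> \<in> locally_finite_sets" "y \<in> \<Lambda>" "y \<notin> \<gamma>" for y \<gamma>
      proof -
        have "insert y \<gamma> \<inter> \<Lambda> = insert y (\<gamma> \<inter> \<Lambda>)" using that by auto
        then show ?thesis using that by (simp add: point_energy_def)
      qed
      have "(\<integral>\<gamma>. 2 * (p x \<gamma> * (point_energy k x \<gamma> * test_h g x \<gamma>)) \<partial>P) =
         2 * (\<integral>\<gamma>. p x \<gamma> * (\<integral>y. g x y * (point_energy k x (insert y \<gamma>)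
             - point_energy k x \<gamma>) * (p y \<gamma> * e (x - y)) \<partial>L) \<partial>P)"
        using ibp[OF weight_p1[OF x] tame_g[OF gm g, of x] T] by (simp add: test_h_def)
      also have "(\<integral>\<gamma>. p x \<gamma> * (\<integral>y. g x y * (point_energy k x (insert y \<gamma>)
          - point_energy k x \<gamma>) * (p y \<gamma> * e (x - y)) \<partial>L) \<partial>P)
         = (\<integral>\<gamma>. p x \<gamma> * (\<integral>y. (g x y * k x y) * (p y \<gamma> * e (x - y)) \<partial>L) \<partial>P)"
      proof (rule Bochner_Integration.integral_cong[OF refl])
        fix \<gamma> assume "\<gamma> \<in> space P"
        then have \<gamma>: "\<gamma> \<in> locally_finite_sets" and [measurable]: "\<gamma> \<in> space config_space" by auto
        have "(\<integral>y. g x y * (point_energy k x (insert y \<gamma>) - point_energy k x \<gamma>) * (p y \<gamma> * e (x - y))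
            \<partial>L) = (\<integral>y. (g x y * k x y) * (p y \<gamma> * e (x - y)) \<partial>L)"
        proof (rule integral_cong_AE)
          show "AE y in L. g x y * (point_energy k x (insert y \<gamma>)
              - point_energy k x \<gamma>) * (p y \<gamma> * e (x - y)) = g x y * k x y * (p y \<gamma> * e (x - y))"
            by (rule AE_L_notin[OF \<gamma>]) (simp add: Si[OF \<gamma>])
        qed measurable
        then show "p x \<gamma> * (\<integral>y. g x y * (point_energy k x (insert y \<gamma>)
            - point_energy k x \<gamma>) * (p y \<gamma> * e (x - y)) \<partial>L)
          = p x \<gamma> * (\<integral>y. (g x y * k x y) * (p y \<gamma> * e (x - y)) \<partial>L)" by simp
      qed
      finally show "(\<integral>\<gamma>. 2 * (p x \<gamma> * (point_energy k x \<gamma> * test_h g x \<gamma>)) \<partial>P)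
          = 2 * (\<integral>\<gamma>. p x \<gamma> * (\<integral>y. (g x y * k x y) * (p y \<gamma> * e (x - y)) \<partial>L) \<partial>P)" .
    qed
  qed measurable
  also have "\<dots> = 2 * (\<integral>\<gamma>. energy (\<lambda>x y. g x y * k x y) \<gamma> \<partial>P)"
    by (subst expectation_energy[OF gk gkm]) simp
  finally show ?thesis .
qed

lemma expectation_test_functional:
  assumes g: "\<And>x y. \<bar>g x y\<bar> \<le> M" and gm: "case_prod g \<in> borel_measurable (borel \<Otimes>\<^sub>M borel)"
  shows "(\<integral>\<gamma>. test_functional g \<gamma> \<partial>P) = 0"
proof -
  have "tame1 (\<lambda>_. 1)" by (simp add: tame1_def polybd_const)
  from ibp[OF weight_one tame_test_h[OF gm g] this] show ?thesis by simp
qed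

section \<open>Square integrability for unbounded kernels\<close>

text \<open>Powers of \<open>Z\<close> pass through the Georgii-Nguyen-Zessin equation: deleting a
  point costs a factor \<open>K\<close> for each power, and the intensity is absorbed into one more
  \<open>Z\<close>. This replaces the \<open>polybd\<close> calculus where H is unbounded.\<close>

lemma GNZ_sum_le:
  fixes H :: "'a \<Rightarrow> 'a set \<Rightarrow> real"
  assumes H: "case_prod H \<in> borel_measurable (borel \<Otimes>\<^sub>M config_space)" and H0: "\<And>x \<gamma>. 0 \<le> H x \<gamma>"
  shows "(\<integral>\<^sup>+\<gamma>. ennreal (Z \<gamma> ^ n * (\<Sum>x\<in>\<gamma> \<inter> \<Lambda>. H x (\<gamma> - {x}))) \<partial>P)
    \<le> (\<integral>\<^sup>+x. \<integral>\<^sup>+\<gamma>. ennreal (K ^ n * Z \<gamma> ^ Suc n * H x \<gamma>) \<partial>P \<partial>L)"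
proof -
  note [measurable (raw)] = borel_measurable_pair[OF H]
  define H' where "H' = (\<lambda>x \<gamma>. K ^ n * Z \<gamma> ^ n * H x \<gamma>)"
  have H': "case_prod H' \<in> borel_measurable (borel \<Otimes>\<^sub>M config_space)" "\<And>x \<gamma>. 0 \<le> H' x \<gamma>"
    unfolding H'_def using K_ge_1 Z_pos by (measurable, auto intro!: mult_nonneg_nonneg H0 simp: less_imp_le)
  have "(\<integral>\<^sup>+\<gamma>. ennreal (Z \<gamma> ^ n * (\<Sum>x\<in>\<gamma> \<inter> \<Lambda>. H x (\<gamma> - {x}))) \<partial>P)
      \<le> (\<integral>\<^sup>+\<gamma>. ennreal (1 * (\<Sum>x\<in>\<gamma> \<inter> \<Lambda>. H' x (\<gamma> - {x}))) \<partial>P)"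
  proof (intro nn_integral_mono ennreal_leI)
    fix \<gamma> assume "\<gamma> \<in> space P"
    then have \<gamma>: "\<gamma> \<in> locally_finite_sets" by simp
    have "Z \<gamma> ^ n * H x (\<gamma> - {x}) \<le> H' x (\<gamma> - {x})" if "x \<in> \<gamma>" for x
    proof -
      have "Z \<gamma> \<le> K * Z (\<gamma> - {x})" using Z_insert[of "\<gamma> - {x}" x] \<gamma> that by (simp add: insert_absorb)
      then have "Z \<gamma> ^ n \<le> (K * Z (\<gamma> - {x})) ^ n" using Z_pos by (intro power_mono) (auto simp: less_imp_le)
      then show ?thesis unfolding H'_def power_mult_distrib[symmetric] by (intro mult_right_mono H0)
    qed
    then show "Z \<gamma> ^ n * (\<Sum>x\<in>\<gamma> \<inter> \<Lambda>. H x (\<gamma> - {x})) \<le> 1 * (\<Sum>x\<in>\<gamma> \<inter> \<Lambda>. H' x (\<gamma> - {x}))"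
      by (auto simp: sum_distrib_left intro!: sum_mono)
  qed
  also have "\<dots> = (\<integral>\<^sup>+\<gamma>. \<integral>\<^sup>+x. ennreal (1 * (H' x \<gamma> * (p x \<gamma> * 1))) \<partial>L \<partial>P)"
    by (rule GNZ_weight_nn[OF weight_one H'])
  also have "\<dots> \<le> (\<integral>\<^sup>+\<gamma>. \<integral>\<^sup>+x. ennreal (K ^ n * Z \<gamma> ^ Suc n * H x \<gamma>) \<partial>L \<partial>P)"
  proof (rule nn_integral_mono, rule nn_integral_mono_AE, rule AE_L)
    fix \<gamma> x assume "\<gamma> \<in> space P" and x: "x \<in> \<Lambda>"
    then have "H' x \<gamma> * p x \<gamma> \<le> H' x \<gamma> * Z \<gamma>" by (intro mult_left_mono p_le_Z H') auto
    then show "ennreal (1 * (H' x \<gamma> * (p x \<gamma> * 1))) \<le> ennreal (K ^ n * Z \<gamma> ^ Suc n * H x \<gamma>)"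
      by (intro ennreal_leI) (simp add: H'_def mult_ac)
  qed
  also have "\<dots> = (\<integral>\<^sup>+x. \<integral>\<^sup>+\<gamma>. ennreal (K ^ n * Z \<gamma> ^ Suc n * H x \<gamma>) \<partial>P \<partial>L)"
    by (rule nn_integral_swap) measurable
  finally show ?thesis .
qed

text \<open>Two passes through \<open>GNZ_sum_le\<close> raise \<open>Z ^ 2\<close> to
  \<open>Z ^ 4\<close>. After them the kernel no longer interacts with the configuration, and its
  double integral factors out.\<close>

lemma energy_weighted_finite:
  assumes k0: "\<And>x y. 0 \<le> k x y" and m: "case_prod k \<in> borel_measurable (borel \<Otimes>\<^sub>M borel)"
    and fin: "(\<integral>\<^sup>+x. \<integral>\<^sup>+y. ennreal (k x y) \<partial>L \<partial>L) < \<infinity>"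
  shows "(\<integral>\<^sup>+\<gamma>. ennreal (Z \<gamma> ^ 2 * energy k \<gamma>) \<partial>P) < \<infinity>"
proof -
  note [measurable (raw)] = borel_measurable_pair_borel[OF m]
  note [measurable (raw)] = borel_measurable_pair[OF point_energy_measurable[OF m]]
  have S0: "0 \<le> point_energy k x \<gamma>" for x \<gamma> by (simp add: point_energy_def sum_nonneg k0)
  have inner: "(\<integral>\<^sup>+\<gamma>. ennreal (Z \<gamma> ^ 3 * point_energy k x \<gamma>) \<partial>P)
      \<le> (\<integral>\<^sup>+\<gamma>. ennreal (K ^ 3 * Z \<gamma> ^ 4) \<partial>P) * (\<integral>\<^sup>+y. ennreal (k x y) \<partial>L)" for x
  proof -
    have "(\<integral>\<^sup>+\<gamma>. ennreal (Z \<gamma> ^ 3 * point_energy k x \<gamma>) \<partial>P)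
        \<le> (\<integral>\<^sup>+y. \<integral>\<^sup>+\<gamma>. ennreal (K ^ 3 * Z \<gamma> ^ Suc 3 * k x y) \<partial>P \<partial>L)"
      unfolding point_energy_def by (rule GNZ_sum_le[of "\<lambda>y _. k x y"]) (measurable, rule k0)
    also have "\<dots> = (\<integral>\<^sup>+y. (\<integral>\<^sup>+\<gamma>. ennreal (K ^ 3 * Z \<gamma> ^ 4) \<partial>P) * ennreal (k x y) \<partial>L)"
      by (intro nn_integral_cong, subst nn_integral_multc[symmetric])
        (auto simp: ennreal_mult''[symmetric] k0 eval_nat_numeral intro!: nn_integral_cong)
    also have "\<dots> = (\<integral>\<^sup>+\<gamma>. ennreal (K ^ 3 * Z \<gamma> ^ 4) \<partial>P) * (\<integral>\<^sup>+y. ennreal (k x y) \<partial>L)"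
      by (rule nn_integral_cmult) measurable
    finally show ?thesis .
  qed
  have "(\<integral>\<^sup>+\<gamma>. ennreal (Z \<gamma> ^ 2 * energy k \<gamma>) \<partial>P)
      \<le> (\<integral>\<^sup>+x. \<integral>\<^sup>+\<gamma>. ennreal (K ^ 2 * Z \<gamma> ^ Suc 2 * point_energy k x \<gamma>) \<partial>P \<partial>L)"
    unfolding energy_def by (rule GNZ_sum_le[OF point_energy_measurable[OF m] S0])
  also have "\<dots> = (\<integral>\<^sup>+x. ennreal (K ^ 2) * (\<integral>\<^sup>+\<gamma>. ennreal (Z \<gamma> ^ 3 * point_energy k x \<gamma>) \<partial>P) \<partial>L)"
    by (intro nn_integral_cong, subst nn_integral_cmult[symmetric])
      (auto simp: ennreal_mult'[symmetric] eval_nat_numeral mult_ac intro!: nn_integral_cong)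
  also have "\<dots> \<le> (\<integral>\<^sup>+x. ennreal (K ^ 2) * ((\<integral>\<^sup>+\<gamma>. ennreal (K ^ 3 * Z \<gamma> ^ 4)
      \<partial>P) * (\<integral>\<^sup>+y. ennreal (k x y) \<partial>L)) \<partial>L)"
    by (intro nn_integral_mono mult_left_mono inner) simp
  also have "\<dots> = ennreal (K ^ 2) * ((\<integral>\<^sup>+\<gamma>. ennreal (K ^ 3 * Z \<gamma> ^ 4) \<partial>P) * (\<integral>\<^sup>+x. \<integral>\<^sup>+y. ennreal (k x y)
      \<partial>L \<partial>L))"
    by (simp add: nn_integral_cmult)
  also have "\<dots> < \<infinity>"
  proof -
    have "integrable P (\<lambda>\<gamma>. K ^ 3 * Z \<gamma> ^ 4)" by (intro integrable_mult_right Z_moments)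
    then have "(\<integral>\<^sup>+\<gamma>. ennreal (K ^ 3 * Z \<gamma> ^ 4) \<partial>P) < \<infinity>"
      using K_ge_1 Z_pos by (subst nn_integral_eq_integral) (auto simp: less_imp_le)
    then show ?thesis using fin by (simp add: ennreal_mult_less_top)
  qed
  finally show ?thesis .
qed

text \<open>Cauchy-Schwarz for the two nested sums, each with at most \<open>Z \<gamma>\<close>
  terms, bounds the squared energy by \<open>Z \<gamma> ^ 2\<close> times the energy of the squared
  kernel. Square integrability of the kernel over the window thus suffices.\<close>

lemma energy_square_integrable:
  assumes k0: "\<And>x y. 0 \<le> k x y" and m: "case_prod k \<in> borel_measurable (borel \<Otimes>\<^sub>M borel)"
    and fin: "(\<integral>\<^sup>+x. \<integral>\<^sup>+y. ennreal ((k x y)\<^sup>2) \<partial>L \<partial>L) < \<infinity>"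
  shows "integrable P (\<lambda>\<gamma>. (energy k \<gamma>)\<^sup>2)"
proof (rule integrableI_bounded)
  show "(\<lambda>\<gamma>. (energy k \<gamma>)\<^sup>2) \<in> borel_measurable P" using energy_measurable[OF m] by measurable
  have m2: "(\<lambda>(x, y). (k x y)\<^sup>2) \<in> borel_measurable (borel \<Otimes>\<^sub>M borel)"
    using borel_measurable_power[OF m, of 2] by (simp add: case_prod_beta')
  have "(energy k \<gamma>)\<^sup>2 \<le> Z \<gamma> ^ 2 * energy (\<lambda>x y. (k x y)\<^sup>2) \<gamma>" if \<gamma>: "\<gamma> \<in> locally_finite_sets" for \<gamma>
  proof -
    have Sle: "(point_energy k x (\<gamma> - {x}))\<^sup>2 \<le> Z \<gamma> * point_energy (\<lambda>x y. (k x y)\<^sup>2) x (\<gamma> - {x})" for x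
    proof -
      have "(point_energy k x (\<gamma> - {x}))\<^sup>2
          \<le> point_energy (\<lambda>x y. (k x y)\<^sup>2) x (\<gamma> - {x}) * card ((\<gamma> - {x}) \<inter> \<Lambda>)"
        unfolding point_energy_def by (rule sum_squared_le_sum_of_squares)
      also have "\<dots> \<le> point_energy (\<lambda>x y. (k x y)\<^sup>2) x (\<gamma> - {x}) * Z \<gamma>"
        using card_le_Z[of "\<gamma> - {x}"] Z_delete[OF \<gamma>, of x] \<gamma>
            by (intro mult_left_mono) (auto simp: point_energy_def sum_nonneg)
      finally show ?thesis by (simp add: mult.commute)
    qed
    have "(energy k \<gamma>)\<^sup>2 \<le> (\<Sum>x\<in>\<gamma> \<inter> \<Lambda>. (point_energy k x (\<gamma> - {x}))\<^sup>2) * card (\<gamma> \<inter> \<Lambda>)"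
      unfolding energy_def by (rule sum_squared_le_sum_of_squares)
    also have "\<dots> \<le> (\<Sum>x\<in>\<gamma> \<inter> \<Lambda>. Z \<gamma> * point_energy (\<lambda>x y. (k x y)\<^sup>2) x (\<gamma> - {x})) * Z \<gamma>"
      using Z_pos[of \<gamma>] by (intro mult_mono sum_mono Sle card_le_Z \<gamma> sum_nonneg mult_nonneg_nonneg)
          (auto simp: point_energy_def sum_nonneg)
    also have "\<dots> = Z \<gamma> ^ 2 * energy (\<lambda>x y. (k x y)\<^sup>2) \<gamma>"
      by (simp add: energy_def sum_distrib_left power2_eq_square mult_ac)
    finally show ?thesis .
  qed
  then have "(\<integral>\<^sup>+\<gamma>. norm ((energy k \<gamma>)\<^sup>2) \<partial>P) \<le> (\<integral>\<^sup>+\<gamma>. ennreal (Z \<gamma> ^ 2 * energy (\<lambda>x y. (k x y)\<^sup>2) \<gamma>) \<partial>P)"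
    by (intro nn_integral_mono ennreal_leI) simp
  also have "\<dots> < \<infinity>" by (rule energy_weighted_finite[OF _ m2 fin]) simp
  finally show "(\<integral>\<^sup>+\<gamma>. norm ((energy k \<gamma>)\<^sup>2) \<partial>P) < \<infinity>" .
qed

lemma energy_abs_le: "(\<And>x y. \<bar>k x y\<bar> \<le> k' x y) \<Longrightarrow> \<bar>energy k \<gamma>\<bar> \<le> energy k' \<gamma>"
  unfolding energy_def point_energy_def by (intro order_trans[OF sum_abs] sum_mono)

lemma test_functional_square_integrable:
  assumes g: "\<And>x y. \<bar>g x y\<bar> \<le> M" and gm: "case_prod g \<in> borel_measurable (borel \<Otimes>\<^sub>M borel)"
  shows "test_functional g \<in> borel_measurable config_space" "integrable P (\<lambda>\<gamma>. (test_functional g \<gamma>)\<^sup>2)"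
proof -
  have "tame1 (test_functional g)" by (rule innovation_tame1[OF weight_one tame_test_h[OF gm g]])
  then show m[measurable]: "test_functional g \<in> borel_measurable config_space" and "integrable P (\<lambda>\<gamma>.
      (test_functional g \<gamma>)\<^sup>2)"
    unfolding tame1_def by (auto intro!: pb_integrable polybd_power2)
qed

text \<open>\<open>covariance\<close> treats bounded kernels. Here v is truncated and the truncation
  removed by dominated convergence; the majorant is the energy of the absolute value of v times the
  absolute test functional, a product of two square integrable variables.\<close>

lemma covariance_unbounded:
  assumes v: "case_prod v \<in> borel_measurable (borel \<Otimes>\<^sub>M borel)" and sym: "\<And>x y. v x y = v y x"
    and fin: "(\<integral>\<^sup>+x. \<integral>\<^sup>+y. ennreal ((v x y)\<^sup>2) \<partial>L \<partial>L) < \<infinity>"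
    and g: "\<And>x y. \<bar>g x y\<bar> \<le> M" and gm: "case_prod g \<in> borel_measurable (borel \<Otimes>\<^sub>M borel)"
    and gv: "\<And>x y. g x y \<noteq> 0 \<Longrightarrow> v x y = g x y"
  shows "integrable P (\<lambda>\<gamma>. (energy v \<gamma>)\<^sup>2)"
    "(\<integral>\<gamma>. energy v \<gamma> * test_functional g \<gamma> \<partial>P) = 2 * (\<integral>\<gamma>. energy (\<lambda>x y. (g x y)\<^sup>2) \<gamma> \<partial>P)"
proof -
  \<comment> \<open>The level starts at M, the bound of g. Where g is nonzero it equals v, so the
    truncation keeps v there: \<open>g x y * vn n x y = (g x y)\<^sup>2\<close> for every n, and the
    covariances form a constant sequence.\<close>
  define vn where "vn n x y = (if \<bar>v x y\<bar> \<le> M + real n then v x y else 0)" for n :: nat and x y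
  have M0: "0 \<le> M" using g[of undefined undefined] by linarith
  note [measurable (raw)] = borel_measurable_pair_borel[OF v]
  have vnm: "case_prod (vn n) \<in> borel_measurable (borel \<Otimes>\<^sub>M borel)" for n unfolding vn_def by measurable
  have am: "(\<lambda>(x, y). \<bar>v x y\<bar>) \<in> borel_measurable (borel \<Otimes>\<^sub>M borel)" by measurable
  note [measurable] = energy_measurable[OF v] energy_measurable[OF vnm] energy_measurable[OF am]
      test_functional_square_integrable(1)[OF g gm]
  have A2: "integrable P (\<lambda>\<gamma>. (energy (\<lambda>x y. \<bar>v x y\<bar>) \<gamma>)\<^sup>2)"
    by (rule energy_square_integrable[OF _ am]) (use fin in simp_all)
  show "integrable P (\<lambda>\<gamma>. (energy v \<gamma>)\<^sup>2)"
  proof (rule Bochner_Integration.integrable_bound[OF A2])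
    have "\<bar>energy v \<gamma>\<bar> \<le> energy (\<lambda>x y. \<bar>v x y\<bar>) \<gamma>" for \<gamma> by (rule energy_abs_le) simp
    then show "AE \<gamma> in P. norm ((energy v \<gamma>)\<^sup>2) \<le> norm ((energy (\<lambda>x y. \<bar>v x y\<bar>) \<gamma>)\<^sup>2)"
      by (intro AE_I2) (simp add: abs_le_square_iff[symmetric] order_trans[OF _ abs_ge_self])
  qed measurable
  have "(\<lambda>n. \<integral>\<gamma>. energy (vn n) \<gamma> * test_functional g \<gamma> \<partial>P) \<longlonglongrightarrow> (\<integral>\<gamma>. energy v \<gamma> * test_functional g \<gamma> \<partial>P)"
  proof (rule integral_dominated_convergence)
    show "integrable P (\<lambda>\<gamma>. energy (\<lambda>x y. \<bar>v x y\<bar>) \<gamma> * \<bar>test_functional g \<gamma>\<bar>)"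
      by (rule product_integrable) (use A2 test_functional_square_integrable(2)[OF g gm] in \<open>auto\<close>)
    have "(\<lambda>n. vn n x y) \<longlonglongrightarrow> v x y" for x y
    proof (rule tendsto_eventually)
      have "vn n x y = v x y" if "nat \<lceil>\<bar>v x y\<bar>\<rceil> \<le> n" for n
        using that M0 by (simp add: vn_def)
      then show "\<forall>\<^sub>F n in sequentially. vn n x y = v x y"
        by (rule eventually_sequentiallyI)
    qed
    then show "AE \<gamma> in P. (\<lambda>n. energy (vn n) \<gamma> * test_functional g \<gamma>) \<longlonglongrightarrow> energy v \<gamma> * test_functional g \<gamma>"
      unfolding energy_def point_energy_def by (intro AE_I2 tendsto_mult tendsto_sum tendsto_const)
    have "\<bar>energy (vn n) \<gamma>\<bar> \<le> energy (\<lambda>x y. \<bar>v x y\<bar>) \<gamma>" for n \<gamma> by (rule energy_abs_le) (simp add: vn_def)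
    then show "AE \<gamma> in P. norm (energy (vn n) \<gamma> * test_functional g \<gamma>)
        \<le> energy (\<lambda>x y. \<bar>v x y\<bar>) \<gamma> * \<bar>test_functional g \<gamma>\<bar>" for n
      by (intro AE_I2) (simp add: abs_mult mult_right_mono)
  qed measurable
  moreover have "(\<integral>\<gamma>. energy (vn n) \<gamma> * test_functional g \<gamma> \<partial>P)
      = 2 * (\<integral>\<gamma>. energy (\<lambda>x y. (g x y)\<^sup>2) \<gamma> \<partial>P)" for n
  proof -
    have "(\<integral>\<gamma>. energy (vn n) \<gamma> * test_functional g \<gamma> \<partial>P) = 2 * (\<integral>\<gamma>. energy (\<lambda>x y. g x y * vn n x y) \<gamma> \<partial>P)"
    proof (rule covariance[where M="M + real n"])
      show "\<bar>vn n x y\<bar> \<le> M + real n" "vn n x y = vn n y x" for x y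
        using M0 by (auto simp: vn_def sym[of x y])
      show "\<bar>g x y\<bar> \<le> M + real n" for x y using g[of x y] by linarith
    qed (rule vnm gm)+
    moreover have "g x y * vn n x y = (g x y)\<^sup>2" for x y
      using gv[of x y] g[of x y] by (cases "g x y = 0") (auto simp: vn_def power2_eq_square)
    ultimately show ?thesis by simp
  qed
  ultimately show "(\<integral>\<gamma>. energy v \<gamma> * test_functional g \<gamma> \<partial>P) = 2 * (\<integral>\<gamma>. energy (\<lambda>x y. (g x y)\<^sup>2) \<gamma> \<partial>P)"
    by (simp add: LIMSEQ_const_iff)
qed

lemma variance_const_nonneg: "0 \<le> variance_const"
  using \<Phi>_nonneg C_nonneg K_ge_1 isometry_const_nonneg by (simp add: variance_const_def)

text \<open>Cauchy-Schwarz for the centred energy of v and the test functional of w. Centring does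
  not change the covariance because the test functional has mean zero. As w equals v where it is
  nonzero, the covariance is an expected sum of squares, and the second moment of the test
  functional is bounded through \<open>(g x y)\<^sup>2 \<le> (k x y)\<^sup>2\<close>.\<close>

lemma variance_lower_bound:
  fixes v w :: "'a \<Rightarrow> real"
  assumes v[measurable]: "v \<in> borel_measurable borel" and even: "\<And>x. v (- x) = v x"
    and v2: "integrable lborel (\<lambda>x. (v x)\<^sup>2)"
    and w[measurable]: "w \<in> borel_measurable borel" and wM: "\<And>x. \<bar>w x\<bar> \<le> M" and wv: "\<And>x. w x \<noteq> 0 \<Longrightarrow> v x = w x"
  shows "(2 * (\<integral>\<gamma>. pair_energy (\<lambda>x. (w x)\<^sup>2) \<Lambda> \<gamma> \<partial>P))\<^sup>2
    \<le> variance (pair_energy v \<Lambda>) * (variance_const * (measure lborel \<Lambda> * (\<integral>x. (v x)\<^sup>2 \<partial>lborel)))"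
proof -
  define g where "g = (\<lambda>x y. w (x - y))"
  define k where "k = (\<lambda>x y. v (x - y))"
  have gm: "case_prod g \<in> borel_measurable (borel \<Otimes>\<^sub>M borel)" and km: "case_prod k \<in> borel_measurable
      (borel \<Otimes>\<^sub>M borel)"
    unfolding g_def k_def by measurable
  have g: "\<bar>g x y\<bar> \<le> M" for x y by (simp add: g_def wM)
  have sym: "k x y = k y x" for x y unfolding k_def using even[of "x - y"] by simp
  let ?J = "\<integral>x. (v x)\<^sup>2 \<partial>lborel"
  have int_le: "(\<integral>\<^sup>+x. \<integral>\<^sup>+y. ennreal ((k x y)\<^sup>2) \<partial>L \<partial>L) \<le> ennreal (measure lborel \<Lambda> * ?J)"
  proof -
    \<comment> \<open>In y the window is enlarged to the whole space, so that only the integration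
      over x produces a factor of volume.\<close>
    have "(\<integral>\<^sup>+y. ennreal ((k x y)\<^sup>2) \<partial>L) \<le> ennreal ?J" for x
    proof -
      have "(\<integral>\<^sup>+y. ennreal ((k x y)\<^sup>2) \<partial>L) \<le> (\<integral>\<^sup>+y. ennreal ((v (- x + y))\<^sup>2) \<partial>lborel)"
        unfolding k_def using even[of "x - _"]
        by (subst nn_integral_L) (auto intro!: nn_integral_mono simp: indicator_def)
      also have "\<dots> = (\<integral>\<^sup>+y. ennreal ((v y)\<^sup>2) \<partial>distr lborel borel ((+) (- x)))"
        by (subst nn_integral_distr) auto
      also have "\<dots> = ennreal ?J"
        unfolding lborel_distr_plus by (rule nn_integral_eq_integral[OF v2]) simp
      finally show ?thesis .
    qed
    then have "(\<integral>\<^sup>+x. \<integral>\<^sup>+y. ennreal ((k x y)\<^sup>2) \<partial>L \<partial>L) \<le> (\<integral>\<^sup>+x. ennreal ?J \<partial>L)"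
      by (rule nn_integral_mono)
    also have "\<dots> = ennreal ?J * emeasure lborel \<Lambda>"
      by (simp add: L_def emeasure_density)
    also have "emeasure lborel \<Lambda> = ennreal (measure lborel \<Lambda>)"
      using emeasure_bounded_finite[OF bounded_\<Lambda>] by (intro emeasure_eq_ennreal_measure) auto
    finally show ?thesis by (simp add: ennreal_mult' mult.commute)
  qed
  then have fin: "(\<integral>\<^sup>+x. \<integral>\<^sup>+y. ennreal ((k x y)\<^sup>2) \<partial>L \<partial>L) < \<infinity>"
    by (rule le_less_trans) simp
  have gk: "g x y \<noteq> 0 \<Longrightarrow> k x y = g x y" for x y unfolding g_def k_def by (rule wv)
  note cu = covariance_unbounded[OF km sym fin g gm gk]
  note Fi = test_functional_square_integrable[OF g gm]
  note [measurable] = energy_measurable[OF km] Fi(1)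
  have Vi: "integrable P (energy k)"
    by (rule square_integrable_imp_integrable[OF _ cu(1)]) measurable
  have Fint: "integrable P (test_functional g)"
    by (rule square_integrable_imp_integrable[OF _ Fi(2)]) measurable
  define m where "m = expectation (energy k)"
  have c2: "integrable P (\<lambda>\<gamma>. (energy k \<gamma> - m)\<^sup>2)"
    unfolding power2_diff using cu(1) Vi by simp
  have "(\<integral>\<gamma>. (energy k \<gamma> - m) * test_functional g \<gamma> \<partial>P)
      = (\<integral>\<gamma>. energy k \<gamma> * test_functional g \<gamma> \<partial>P) - m * (\<integral>\<gamma>. test_functional g \<gamma> \<partial>P)"
    using product_integrable[OF _ _ cu(1) Fi(2)] Fint by (simp add: left_diff_distrib)
  then have cov: "(\<integral>\<gamma>. (energy k \<gamma> - m) * test_functional g \<gamma> \<partial>P) = 2 * (\<integral>\<gamma>. energy (\<lambda>x y. (g x y)\<^sup>2) \<gamma> \<partial>P)"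
    by (simp add: cu(2) expectation_test_functional[OF g gm])
  have test_functional_le: "(\<integral>\<gamma>. (test_functional g \<gamma>)\<^sup>2 \<partial>P) \<le> variance_const * (measure lborel \<Lambda> * ?J)"
  proof -
    have "ennreal (\<integral>\<gamma>. (test_functional g \<gamma>)\<^sup>2 \<partial>P) = (\<integral>\<^sup>+\<gamma>. ennreal ((test_functional g \<gamma>)\<^sup>2) \<partial>P)"
      by (rule nn_integral_eq_integral[OF Fi(2), symmetric]) simp
    also have "\<dots> \<le> ennreal variance_const * (\<integral>\<^sup>+x. \<integral>\<^sup>+y. ennreal ((g x y)\<^sup>2) \<partial>L \<partial>L)"
      by (rule test_function_bound[OF gm g])
    also have "\<dots> \<le> ennreal variance_const * (\<integral>\<^sup>+x. \<integral>\<^sup>+y. ennreal ((k x y)\<^sup>2) \<partial>L \<partial>L)"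
    proof (intro mult_left_mono nn_integral_mono ennreal_leI)
      show "(g x y)\<^sup>2 \<le> (k x y)\<^sup>2" for x y using gk[of x y] by (cases "g x y = 0") auto
    qed simp
    also have "\<dots> \<le> ennreal variance_const * ennreal (measure lborel \<Lambda> * ?J)"
        by (intro mult_left_mono int_le) simp
    also have "\<dots> = ennreal (variance_const * (measure lborel \<Lambda> * ?J))" using variance_const_nonneg
        by (simp add: ennreal_mult')
    finally show ?thesis using variance_const_nonneg by (subst (asm) ennreal_le_iff) auto
  qed
  have "(2 * (\<integral>\<gamma>. energy (\<lambda>x y. (g x y)\<^sup>2) \<gamma> \<partial>P))\<^sup>2
      \<le> (\<integral>\<gamma>. (energy k \<gamma> - m)\<^sup>2 \<partial>P) * (\<integral>\<gamma>. (test_functional g \<gamma>)\<^sup>2 \<partial>P)"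
    unfolding cov[symmetric] by (rule integral_product_square_le[OF _ _ c2 Fi(2)]) measurable
  also have "\<dots> \<le> (\<integral>\<gamma>. (energy k \<gamma> - m)\<^sup>2 \<partial>P) * (variance_const * (measure lborel \<Lambda> * ?J))"
    by (rule mult_left_mono[OF test_functional_le]) simp
  finally have "(2 * (\<integral>\<gamma>. energy (\<lambda>x y. (g x y)\<^sup>2) \<gamma> \<partial>P))\<^sup>2
      \<le> (\<integral>\<gamma>. (energy k \<gamma> - m)\<^sup>2 \<partial>P) * (variance_const * (measure lborel \<Lambda> * ?J))" .
  moreover have "(\<integral>\<gamma>. pair_energy (\<lambda>x. (w x)\<^sup>2) \<Lambda> \<gamma> \<partial>P) = (\<integral>\<gamma>. energy (\<lambda>x y. (g x y)\<^sup>2) \<gamma> \<partial>P)"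
    by (intro Bochner_Integration.integral_cong refl) (simp add: pair_energy_eq_energy g_def)
  moreover have "expectation (pair_energy v \<Lambda>) = m"
    unfolding m_def by (intro Bochner_Integration.integral_cong refl) (simp add: pair_energy_eq_energy k_def)
  moreover from this have "variance (pair_energy v \<Lambda>) = (\<integral>\<gamma>. (energy k \<gamma> - m)\<^sup>2 \<partial>P)"
    by (intro Bochner_Integration.integral_cong refl) (simp add: pair_energy_eq_energy k_def)
  ultimately show ?thesis by simp
qed

end

section \<open>Exponential moments from the Ruelle bound\<close>

text \<open>The n-th elementary symmetric polynomial in the values \<open>f y\<close>, y in
  X.\<close>

definition esym :: "('a \<Rightarrow> real) \<Rightarrow> nat \<Rightarrow> 'a set \<Rightarrow> real" where
  "esym f n X = (\<Sum>S | S \<subseteq> X \<and> card S = n. \<Prod>y\<in>S. f y)"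

lemma esym_0: "finite X \<Longrightarrow> esym f 0 X = 1"
proof -
  assume "finite X"
  then have "{S. S \<subseteq> X \<and> card S = 0} = {{}}" by (auto dest: finite_subset)
  then show ?thesis by (simp add: esym_def)
qed

lemma esym_eq_0: "finite X \<Longrightarrow> card X < n \<Longrightarrow> esym f n X = 0"
proof -
  assume X: "finite X" "card X < n"
  then have "{S. S \<subseteq> X \<and> card S = n} = {}"
    using card_mono[OF X(1)] by (metis (mono_tags, lifting) Collect_empty_eq leD)
  then show ?thesis by (simp only: esym_def sum.empty)
qed

lemma esym_nonneg: "(\<And>y. 0 \<le> f y) \<Longrightarrow> 0 \<le> esym f n X"
  by (simp add: esym_def sum_nonneg prod_nonneg)

lemma prod_one_plus_eq_esym:
  assumes X: "finite X"
  shows "(\<Prod>y\<in>X. 1 + f y) = (\<Sum>n\<le>card X. esym f n X)"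
proof -
  have "(\<Prod>y\<in>X. f y + 1) = (\<Sum>S\<in>Pow X. \<Prod>y\<in>S. f y)"
    by (subst prod_add[OF X]) simp
  also have "\<dots> = (\<Sum>n\<le>card X. \<Sum>S | S \<in> Pow X \<and> card S = n. \<Prod>y\<in>S. f y)"
    using X by (subst sum.group) (auto intro: card_mono)
  finally show ?thesis by (simp add: esym_def add.commute Pow_def)
qed

text \<open>Double counting of the pairs of a subset S and a point y in S. The recursion serves both
  for counting ordered tuples and for measurability.\<close>

lemma Suc_esym:
  assumes X: "finite X"
  shows "real (Suc n) * esym f (Suc n) X = (\<Sum>y\<in>X. f y * esym f n (X - {y}))"
proof -
  let ?A = "{S. S \<subseteq> X \<and> card S = Suc n}"
  have fA: "finite ?A" using X by simp
  have "real (Suc n) * esym f (Suc n) X = (\<Sum>S\<in>?A. \<Sum>y\<in>{y\<in>X. y \<in> S}. \<Prod>s\<in>S. f s)"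
    unfolding esym_def sum_distrib_left
  proof (intro sum.cong refl)
    fix S assume S: "S \<in> ?A"
    then have "{y\<in>X. y \<in> S} = S" by auto
    then show "real (Suc n) * prod f S = (\<Sum>y\<in>{y\<in>X. y \<in> S}. \<Prod>s\<in>S. f s)" using S by simp
  qed
  also have "\<dots> = (\<Sum>y\<in>X. \<Sum>S | S \<in> ?A \<and> y \<in> S. \<Prod>s\<in>S. f s)"
    by (rule sum.swap_restrict[OF fA X])
  also have "\<dots> = (\<Sum>y\<in>X. f y * esym f n (X - {y}))"
  proof (intro sum.cong refl)
    fix y assume y: "y \<in> X"
    have "(\<Sum>S | S \<in> ?A \<and> y \<in> S. \<Prod>s\<in>S. f s) = (\<Sum>S | S \<subseteq> X - {y} \<and> card S = n. f y * (\<Prod>s\<in>S. f s))"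
    proof (rule sum.reindex_bij_witness[where i="insert y" and j="\<lambda>S. S - {y}"])
      fix S assume S: "S \<in> {S. S \<in> ?A \<and> y \<in> S}"
      then have "finite S" using X finite_subset by auto
      then show "S - {y} \<in> {S. S \<subseteq> X - {y} \<and> card S = n}" "insert y (S - {y}) = S"
        "f y * (\<Prod>s\<in>S - {y}. f s) = (\<Prod>s\<in>S. f s)"
        using S by (auto simp: prod.remove)
    next
      fix S assume S: "S \<in> {S. S \<subseteq> X - {y} \<and> card S = n}"
      then have "finite S" "y \<notin> S" using X finite_subset by auto
      then show "insert y S - {y} = S" "insert y S \<in> {S. S \<in> ?A \<and> y \<in> S}" using S y by auto
    qed
    then show "(\<Sum>S | S \<in> ?A \<and> y \<in> S. \<Prod>s\<in>S. f s) = f y * esym f n (X - {y})"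
      by (simp add: esym_def sum_distrib_left)
  qed
  finally show ?thesis .
qed

lemma finite_distinct_tuples: "finite X \<Longrightarrow> finite (distinct_tuples n X)"
  unfolding distinct_tuples_def
  by (rule finite_subset[of _ "{..<n} \<rightarrow>\<^sub>E X"]) (auto intro: finite_PiE)

text \<open>Every n-element subset is enumerated by \<open>fact n\<close> injective tuples. The
  induction splits off the last entry of the tuple, as in \<open>Suc_esym\<close>.\<close>

lemma sum_distinct_tuples:
  assumes X: "finite X"
  shows "(\<Sum>t\<in>distinct_tuples n X. \<Prod>i<n. f (t i)) = fact n * esym f n X"
  using X
proof (induction n arbitrary: X)
  case 0
  have "distinct_tuples 0 X = {\<lambda>_. undefined}" by (auto simp: distinct_tuples_def)
  then show ?case using 0 by (simp add: esym_0)
next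
  case (Suc n)
  have "(\<Sum>t\<in>distinct_tuples (Suc n) X. \<Prod>i<Suc n. f (t i)) =
     (\<Sum>(y, t)\<in>(SIGMA y:X. distinct_tuples n (X - {y})). f y * (\<Prod>i<n. f (t i)))"
  proof (rule sum.reindex_bij_witness[where j="\<lambda>t. (t n, restrict t {..<n})" and i="\<lambda>(y, t). t(n := y)"])
    fix t assume t: "t \<in> distinct_tuples (Suc n) X"
    then have te: "t \<in> {..<Suc n} \<rightarrow>\<^sub>E X" and inj: "inj_on t {..<Suc n}" by (auto simp: distinct_tuples_def)
    show "(case (t n, restrict t {..<n}) of (y, t) \<Rightarrow> t(n := y)) = t"
      using te by (auto simp: fun_eq_iff PiE_def extensional_def restrict_def less_Suc_eq)
    have "t i \<noteq> t n" if "i < n" for i using inj that by (auto dest: inj_onD)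
    moreover have "inj_on (restrict t {..<n}) {..<n}" using inj by (auto simp: inj_on_def)
    ultimately show "(t n, restrict t {..<n}) \<in> (SIGMA y:X. distinct_tuples n (X - {y}))"
      using te by (auto simp: distinct_tuples_def PiE_def Pi_def)
    show "(case (t n, restrict t {..<n}) of (y, t) \<Rightarrow> f y * (\<Prod>i<n. f (t i))) = (\<Prod>i<Suc n. f (t i))"
      by (simp add: mult.commute)
  next
    fix b assume "b \<in> (SIGMA y:X. distinct_tuples n (X - {y}))"
    then obtain y t where b: "b = (y, t)" "y \<in> X" and te: "t \<in> {..<n} \<rightarrow>\<^sub>E X - {y}" and inj: "inj_on t {..<n}"
      by (auto simp: distinct_tuples_def)
    have "t(n := y) \<in> {..<Suc n} \<rightarrow>\<^sub>E X" using te b(2) by (auto simp: PiE_def Pi_def extensional_def)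
    moreover have "inj_on (t(n := y)) {..<Suc n}"
      using te inj by (auto simp: inj_on_def less_Suc_eq PiE_def Pi_def)
    ultimately show "(case b of (y, t) \<Rightarrow> t(n := y)) \<in> distinct_tuples (Suc n) X"
      by (simp add: b distinct_tuples_def)
    show "(\<lambda>t. (t n, restrict t {..<n})) (case b of (y, t) \<Rightarrow> t(n := y)) = b"
      using te by (auto simp: b fun_eq_iff restrict_def PiE_def extensional_def)
  qed
  also have "\<dots> = (\<Sum>y\<in>X. \<Sum>t\<in>distinct_tuples n (X - {y}). f y * (\<Prod>i<n. f (t i)))"
    using Suc.prems by (subst sum.Sigma) (auto intro: finite_distinct_tuples)
  also have "\<dots> = (\<Sum>y\<in>X. f y * (fact n * esym f n (X - {y})))"
    using Suc by (simp add: sum_distrib_left[symmetric])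
  also have "\<dots> = fact n * (\<Sum>y\<in>X. f y * esym f n (X - {y}))"
    by (simp add: sum_distrib_left mult_ac)
  also have "\<dots> = fact (Suc n) * esym f (Suc n) X"
    by (simp only: Suc_esym[OF Suc.prems, symmetric]) (simp add: mult_ac)
  finally show ?case .
qed

text \<open>A sum over subsets is out of reach of \<open>sum_config_measurable\<close>.
  \<open>Suc_esym\<close> turns it into a sum over single points of a function of the configuration
  with this point deleted.\<close>

lemma esym_measurable:
  fixes f :: "'a::euclidean_space \<Rightarrow> real"
  assumes f[measurable]: "f \<in> borel_measurable borel" and B: "B \<in> sets borel" "bounded B"
  shows "(\<lambda>\<gamma>. esym f n (\<gamma> \<inter> B)) \<in> borel_measurable config_space"
proof (induction n)
  case 0
  have "esym f 0 (\<gamma> \<inter> B) = 1" if "\<gamma> \<in> space config_space" for \<gamma>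
    using that B by (auto intro!: esym_0 finite_Int_bounded)
  then show ?case by (subst measurable_cong[of _ _ "\<lambda>_. 1"]) auto
next
  case (Suc n)
  have "esym f (Suc n) (\<gamma> \<inter> B) = (\<Sum>y\<in>\<gamma> \<inter> B. f y * esym f n ((\<gamma> - {y}) \<inter> B)) / real (Suc n)"
    if "\<gamma> \<in> space config_space" for \<gamma>
  proof -
    have fin: "finite (\<gamma> \<inter> B)" using that B by (auto intro!: finite_Int_bounded)
    have "(\<gamma> - {y}) \<inter> B = \<gamma> \<inter> B - {y}" for y by auto
    then show ?thesis using Suc_esym[OF fin, of n f] by (simp add: field_simps del: of_nat_Suc)
  qed
  moreover have "(\<lambda>\<gamma>. (\<Sum>y\<in>\<gamma> \<inter> B. f y * esym f n ((\<gamma>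
      - {y}) \<inter> B)) / real (Suc n)) \<in> borel_measurable config_space"
  proof (intro borel_measurable_divide borel_measurable_const sum_config_measurable[OF _ _ B]
      measurable_ident_sets[OF refl])
    have "(\<lambda>z. fst z - {snd z}) \<in> (config_space :: 'a set measure) \<Otimes>\<^sub>M borel \<rightarrow>\<^sub>M config_space" by measurable
    note [measurable] = measurable_compose[OF this Suc.IH]
    show "(\<lambda>(\<gamma>, y). f y * esym f n ((\<gamma> - {y}) \<inter> B)) \<in> borel_measurable (config_space \<Otimes>\<^sub>M borel)"
      unfolding case_prod_beta' by measurable
  qed
  ultimately show ?case by (subst measurable_cong) auto
qed

section \<open>Factorial and exponential moments under the Ruelle bound\<close>

context
  fixes G :: "'a::euclidean_space set measure" and \<rho> :: "nat \<Rightarrow> (nat \<Rightarrow> 'a) \<Rightarrow> real" and q :: real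
  assumes pp: "point_process G"
    and corr: "\<And>n. 1 \<le> n \<Longrightarrow> is_correlation_function G n (\<rho> n)"
    and q: "0 < q" and bound: "\<And>n. 1 \<le> n \<Longrightarrow> AE x in PiM {..<n} (\<lambda>_. lborel). \<rho> n x \<le> q ^ n"
begin

lemma sets_pp: "sets G = sets config_space" using pp by (simp add: point_process_def)
lemma space_pp: "space G = locally_finite_sets" using sets_eq_imp_space_eq[OF sets_pp] by simp
lemma prob_pp: "prob_space G" using pp by (simp add: point_process_def)

text \<open>Times \<open>fact n\<close>, the expectation is the integral of a product function
  against the n-th correlation function. The bound \<open>q ^ n\<close> and Fubini leave the n-th
  power of a one-point integral.\<close>

lemma esym_expectation_le:
  fixes f :: "'a \<Rightarrow> real"
  assumes f[measurable]: "f \<in> borel_measurable borel" and f0: "\<And>y. 0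
      \<le> f y" and B: "B \<in> sets borel" "bounded B"
    and J: "(\<integral>\<^sup>+y. ennreal (f y) \<partial>lborel) \<le> ennreal J" and J0: "0 \<le> J"
  shows "(\<integral>\<^sup>+\<gamma>. ennreal (esym f n (\<gamma> \<inter> B)) \<partial>G) \<le> ennreal ((q * J) ^ n / fact n)"
proof (cases "n = 0")
  \<comment> \<open>Correlation functions are given for \<open>1 \<le> n\<close> only; for n = 0 the
    symmetric polynomial is 1.\<close>
  case True
  interpret prob_space G by (rule prob_pp)
  have "(\<integral>\<^sup>+\<gamma>. ennreal (esym f n (\<gamma> \<inter> B)) \<partial>G) = (\<integral>\<^sup>+\<gamma>. 1 \<partial>G)"
    using B by (intro nn_integral_cong) (auto simp: True space_pp esym_0 finite_Int_bounded)
  then show ?thesis by (simp add: True emeasure_space_1)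
next
  case False
  then have n: "1 \<le> n" by simp
  let ?g = "\<lambda>y. ennreal (f y) * indicator B y"
  interpret product_sigma_finite "\<lambda>_::nat. lborel :: 'a measure" ..
  have g_meas[measurable]: "?g \<in> borel_measurable borel"
    by (intro borel_measurable_times_ennreal borel_measurable_indicator measurable_compose[OF f
        measurable_ennreal] B)
  note [measurable] = B(1)
  define F where "F = (\<lambda>t::nat \<Rightarrow> 'a. \<Prod>i<n. ?g (t i))"
  have F: "F \<in> borel_measurable (PiM {..<n} (\<lambda>_. lborel))" unfolding F_def by measurable
  have inner: "(\<integral>\<^sup>+t. F t \<partial>count_space (distinct_tuples n \<gamma>)) = ennreal (fact n * esym f n (\<gamma> \<inter> B))"
    if \<gamma>: "\<gamma> \<in> locally_finite_sets" for \<gamma>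
  proof -
    have fin: "finite (\<gamma> \<inter> B)" using \<gamma> B by (intro finite_Int_bounded)
    have sub: "distinct_tuples n (\<gamma> \<inter> B) \<subseteq> distinct_tuples n \<gamma>"
      unfolding distinct_tuples_def using PiE_mono[of "{..<n}" "\<lambda>_. \<gamma> \<inter> B" "\<lambda>_. \<gamma>"] by blast
    have eq: "F t = ennreal (\<Prod>i<n. f (t i)) * indicator (distinct_tuples n (\<gamma> \<inter> B)) t"
        if t: "t \<in> distinct_tuples n \<gamma>" for t
    proof (cases "t \<in> distinct_tuples n (\<gamma> \<inter> B)")
      case True
      then have "t i \<in> B" if "i < n" for i
        using that PiE_mem[of t "{..<n}" "\<lambda>_. \<gamma> \<inter> B" i] unfolding distinct_tuples_def by blast
      then have "?g (t i) = ennreal (f (t i))" if "i < n" for i using that by simp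
      then show ?thesis using True f0 by (simp add: F_def prod_ennreal)
    next
      case False
      then obtain i where "i < n" "t i \<notin> B" using t by (auto simp: distinct_tuples_def PiE_def Pi_def)
      then have "F t = 0" unfolding F_def by (intro prod_zero) (auto intro!: bexI[of _ i])
      then show ?thesis using False by simp
    qed
    have "(\<integral>\<^sup>+t. F t \<partial>count_space (distinct_tuples n \<gamma>)) =
      (\<integral>\<^sup>+t. ennreal (\<Prod>i<n. f (t i)) * indicator (distinct_tuples n (\<gamma> \<inter> B)) t
          \<partial>count_space (distinct_tuples n \<gamma>))"
      by (intro nn_integral_cong) (simp add: eq)
    also have "\<dots> = (\<integral>\<^sup>+t. ennreal (\<Prod>i<n. f (t i)) \<partial>count_space (distinct_tuples n (\<gamma> \<inter> B)))"
      using sub by (subst nn_integral_restrict_space[symmetric]) (auto simp: restrict_count_space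
          Int_absorb1 Int_absorb2)
    also have "\<dots> = ennreal (\<Sum>t\<in>distinct_tuples n (\<gamma> \<inter> B). \<Prod>i<n. f (t i))"
      by (subst nn_integral_count_space_finite[OF finite_distinct_tuples[OF fin]]) (simp add:
          sum_ennreal prod_nonneg f0)
    finally show ?thesis by (simp add: sum_distinct_tuples[OF fin])
  qed
  have "(\<integral>\<^sup>+\<gamma>. ennreal (fact n * esym f n (\<gamma> \<inter> B)) \<partial>G)
      = (\<integral>\<^sup>+\<gamma>. (\<integral>\<^sup>+t. F t \<partial>count_space (distinct_tuples n \<gamma>)) \<partial>G)"
    by (intro nn_integral_cong) (simp add: inner space_pp)
  also have "\<dots> = (\<integral>\<^sup>+t. F t * ennreal (\<rho> n t) \<partial>PiM {..<n} (\<lambda>_. lborel))"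
    using corr[OF n] F by (simp add: is_correlation_function_def)
  also have "\<dots> \<le> (\<integral>\<^sup>+t. F t * ennreal (q ^ n) \<partial>PiM {..<n} (\<lambda>_. lborel))"
  proof (rule nn_integral_mono_AE)
    show "AE t in PiM {..<n} (\<lambda>_. lborel). F t * ennreal (\<rho> n t) \<le> F t * ennreal (q ^ n)"
      using bound[OF n] by eventually_elim (intro mult_left_mono ennreal_leI, auto)
  qed
  also have "\<dots> = (\<integral>\<^sup>+t. F t \<partial>PiM {..<n} (\<lambda>_. lborel)) * ennreal (q ^ n)"
    by (rule nn_integral_multc[OF F])
  also have "(\<integral>\<^sup>+t. F t \<partial>PiM {..<n} (\<lambda>_. lborel)) = (\<Prod>i<n. \<integral>\<^sup>+y. ?g y \<partial>lborel)"
    unfolding F_def by (rule product_nn_integral_prod[where f="\<lambda>_. ?g"]) (simp_all add: g_meas)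
  also have "\<dots> * ennreal (q ^ n) \<le> (\<Prod>i<n. ennreal J) * ennreal (q ^ n)"
  proof -
    have "(\<integral>\<^sup>+y. ?g y \<partial>lborel) \<le> ennreal J"
      by (rule order_trans[OF _ J]) (auto intro!: nn_integral_mono simp: indicator_def)
    then have "(\<integral>\<^sup>+y. ?g y \<partial>lborel) ^ n \<le> ennreal J ^ n" by (intro power_mono) auto
    then show ?thesis by (intro mult_right_mono) simp_all
  qed
  also have "\<dots> = ennreal ((q * J) ^ n)"
    using J0 q by (simp add: ennreal_power ennreal_mult'[symmetric] power_mult_distrib mult.commute)
  finally have le: "(\<integral>\<^sup>+\<gamma>. ennreal (fact n * esym f n (\<gamma> \<inter> B)) \<partial>G) \<le> ennreal ((q * J) ^ n)" .
  have [measurable]: "(\<lambda>\<gamma>. esym f n (\<gamma> \<inter> B)) \<in> borel_measurable G"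
    using esym_measurable[OF f B] measurable_cong_sets[OF sets_pp refl] by blast
  have "(\<integral>\<^sup>+\<gamma>. ennreal (esym f n (\<gamma> \<inter> B)) \<partial>G)
      = (\<integral>\<^sup>+\<gamma>. ennreal (1 / fact n) * ennreal (fact n * esym f n (\<gamma> \<inter> B)) \<partial>G)"
    by (intro nn_integral_cong) (simp add: ennreal_mult'[symmetric])
  also have "\<dots> = ennreal (1 / fact n) * (\<integral>\<^sup>+\<gamma>. ennreal (fact n * esym f n (\<gamma> \<inter> B)) \<partial>G)"
    by (rule nn_integral_cmult) measurable
  also have "\<dots> \<le> ennreal (1 / fact n) * ennreal ((q * J) ^ n)" by (rule mult_left_mono[OF le]) simp
  also have "\<dots> = ennreal ((q * J) ^ n / fact n)" by (simp add: ennreal_mult'[symmetric])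
  finally show ?thesis .
qed

text \<open>The product is the sum of all symmetric polynomials, and their bounds
  \<open>(q * J) ^ n / fact n\<close> add up to an exponential.\<close>

lemma prod_expectation_le:
  fixes f :: "'a \<Rightarrow> real"
  assumes f[measurable]: "f \<in> borel_measurable borel" and f0: "\<And>y. 0
      \<le> f y" and B: "B \<in> sets borel" "bounded B"
    and J: "(\<integral>\<^sup>+y. ennreal (f y) \<partial>lborel) \<le> ennreal J" and J0: "0 \<le> J"
  shows "(\<integral>\<^sup>+\<gamma>. ennreal (\<Prod>y\<in>\<gamma> \<inter> B. 1 + f y) \<partial>G) \<le> ennreal (exp (q * J))"
proof -
  have [measurable]: "(\<lambda>\<gamma>. esym f n (\<gamma> \<inter> B)) \<in> borel_measurable G" for n
    using esym_measurable[OF f B] measurable_cong_sets[OF sets_pp refl] by blast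
  have "(\<integral>\<^sup>+\<gamma>. ennreal (\<Prod>y\<in>\<gamma> \<inter> B. 1 + f y) \<partial>G) = (\<integral>\<^sup>+\<gamma>. (\<Sum>n. ennreal (esym f n (\<gamma> \<inter> B))) \<partial>G)"
  proof (intro nn_integral_cong)
    fix \<gamma> assume "\<gamma> \<in> space G"
    then have fin: "finite (\<gamma> \<inter> B)" using B by (intro finite_Int_bounded) (auto simp: space_pp)
    have "(\<Sum>n. ennreal (esym f n (\<gamma> \<inter> B))) = (\<Sum>n\<le>card (\<gamma> \<inter> B). ennreal (esym f n (\<gamma> \<inter> B)))"
      by (rule suminf_finite) (auto simp: esym_eq_0[OF fin])
    also have "\<dots> = ennreal (\<Prod>y\<in>\<gamma> \<inter> B. 1 + f y)"
      unfolding prod_one_plus_eq_esym[OF fin] by (rule sum_ennreal) (simp add: esym_nonneg f0)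
    finally show "ennreal (\<Prod>y\<in>\<gamma> \<inter> B. 1 + f y) = (\<Sum>n. ennreal (esym f n (\<gamma> \<inter> B)))" by simp
  qed
  also have "\<dots> = (\<Sum>n. \<integral>\<^sup>+\<gamma>. ennreal (esym f n (\<gamma> \<inter> B)) \<partial>G)"
    by (rule nn_integral_suminf) measurable
  also have "\<dots> \<le> (\<Sum>n. ennreal ((q * J) ^ n / fact n))"
    by (intro suminf_le esym_expectation_le assms) auto
  also have "\<dots> = ennreal (\<Sum>n. (q * J) ^ n / fact n)"
    using q J0 summable_exp_generic[of "q * J"]
    by (intro suminf_ennreal2) (auto simp: divide_inverse mult.commute)
  also have "(\<Sum>n. (q * J) ^ n / fact n) = exp (q * J)"
    by (simp add: exp_def divide_inverse mult.commute)
  finally show ?thesis .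
qed

text \<open>With \<open>exp (b * f y) - 1\<close> in the role of f, the product in
  \<open>prod_expectation_le\<close> over a ball is the exponential of a sum. Monotone convergence
  passes from balls to the whole space.\<close>

lemma exp_sum_expectation:
  fixes f :: "'a \<Rightarrow> real"
  assumes f[measurable]: "f \<in> borel_measurable borel" and f0: "\<And>y. 0 \<le> f y" and b: "0 < b"
    and J: "(\<integral>\<^sup>+y. ennreal (exp (b * f y) - 1) \<partial>lborel) \<le> ennreal J" and J0: "0 \<le> J"
  shows "AE \<gamma> in G. (\<integral>\<^sup>+y. ennreal (f y) \<partial>count_space \<gamma>) < \<infinity>"
    "(\<integral>\<^sup>+\<gamma>. ennreal (exp (b * enn2real (\<integral>\<^sup>+y. ennreal (f y) \<partial>count_space \<gamma>))) \<partial>G) \<le> ennreal (exp (q * J))"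
proof -
  define E where "E n \<gamma> = ennreal (exp (b * (\<Sum>y\<in>\<gamma> \<inter> cball 0 (real n). f y)))" for n :: nat and \<gamma>
  note idm = measurable_ident_sets[OF sets_pp]
  have [measurable]: "E n \<in> borel_measurable G" for n
  proof -
    have "(\<lambda>\<gamma>. \<Sum>y\<in>\<gamma> \<inter> cball 0 (real n). f y) \<in> borel_measurable G"
      by (rule sum_config_measurable[OF _ idm]) auto
    then show ?thesis unfolding E_def by measurable
  qed
  define s where "s n \<gamma> = (\<Sum>y\<in>\<gamma> \<inter> cball 0 (real n). f y)" for n :: nat and \<gamma>
  let ?\<Psi> = "\<lambda>\<gamma>. \<integral>\<^sup>+y. ennreal (f y) \<partial>count_space \<gamma>"
  have fin: "finite (\<gamma> \<inter> cball 0 (real n))" if "\<gamma> \<in> locally_finite_sets" for \<gamma> :: "'a set" and n :: nat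
    using that by (intro finite_Int_bounded) auto
  have s0: "0 \<le> s n \<gamma>" for n \<gamma> unfolding s_def by (intro sum_nonneg f0)
  have s_mono: "s m \<gamma> \<le> s n \<gamma>" if "m \<le> n" "\<gamma> \<in> locally_finite_sets" for m n \<gamma>
    unfolding s_def using that fin[OF that(2)] by (intro sum_mono2 f0) auto
  have \<Psi>: "?\<Psi> \<gamma> = (SUP n. ennreal (s n \<gamma>))" if "\<gamma> \<in> locally_finite_sets" for \<gamma>
    by (subst nn_integral_count_space_exhaust)
      (simp add: nn_integral_count_space_finite[OF fin[OF that]] sum_ennreal f0 s_def)
  \<comment> \<open>A common bound for the exponentials of the partial sums forces the full sum to
    be finite. Then \<open>enn2real\<close> yields its true value, and continuity of exp gives the
    bound in the limit.\<close>
  have bnd: "exp (b * enn2real (?\<Psi> \<gamma>)) \<le> r \<and> ?\<Psi> \<gamma> < \<infinity>"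
    if \<gamma>: "\<gamma> \<in> locally_finite_sets" and r: "\<And>n. exp (b * s n \<gamma>) \<le> r" for \<gamma> r
  proof -
    have "s n \<gamma> \<le> r / b" for n
    proof -
      have "b * s n \<gamma> \<le> exp (b * s n \<gamma>)" using exp_ge_add_one_self[of "b * s n \<gamma>"] by linarith
      then show ?thesis using r[of n] b by (simp add: pos_le_divide_eq mult.commute)
    qed
    then have le: "?\<Psi> \<gamma> \<le> ennreal (r / b)" unfolding \<Psi>[OF \<gamma>] by (intro SUP_least ennreal_leI)
    then have fin\<Psi>: "?\<Psi> \<gamma> < \<infinity>" using le_less_trans by fastforce
    have "(\<lambda>n. ennreal (s n \<gamma>)) \<longlonglongrightarrow> ?\<Psi> \<gamma>"
      unfolding \<Psi>[OF \<gamma>] by (intro LIMSEQ_SUP monoI ennreal_leI s_mono \<gamma>)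
    then have "(\<lambda>n. ennreal (s n \<gamma>)) \<longlonglongrightarrow> ennreal (enn2real (?\<Psi> \<gamma>))" using fin\<Psi> by simp
    then have "(\<lambda>n. s n \<gamma>) \<longlonglongrightarrow> enn2real (?\<Psi> \<gamma>)"
      by (subst (asm) tendsto_ennreal_iff) (auto simp: s0)
    then have "(\<lambda>n. exp (b * s n \<gamma>)) \<longlonglongrightarrow> exp (b * enn2real (?\<Psi> \<gamma>))" by (intro tendsto_intros)
    then have "exp (b * enn2real (?\<Psi> \<gamma>)) \<le> r" by (rule LIMSEQ_le_const2) (use r in auto)
    with fin\<Psi> show ?thesis by simp
  qed
  have "(\<integral>\<^sup>+\<gamma>. (SUP n. E n \<gamma>) \<partial>G) = (SUP n. \<integral>\<^sup>+\<gamma>. E n \<gamma> \<partial>G)"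
  proof (rule nn_integral_monotone_convergence_SUP_AE)
    show "AE \<gamma> in G. E n \<gamma> \<le> E (Suc n) \<gamma>" for n
      using b by (intro AE_I2) (auto simp: E_def s_def[symmetric] space_pp simp del: of_nat_Suc intro!:
          ennreal_leI s_mono)
  qed measurable
  also have "\<dots> \<le> ennreal (exp (q * J))"
  proof (rule SUP_least)
    fix n
    have "(\<integral>\<^sup>+\<gamma>. E n \<gamma> \<partial>G) = (\<integral>\<^sup>+\<gamma>. ennreal (\<Prod>y\<in>\<gamma> \<inter> cball 0 (real n). 1 + (exp (b * f y) - 1)) \<partial>G)"
      by (intro nn_integral_cong) (simp add: E_def exp_sum[symmetric] sum_distrib_left fin space_pp)
    also have "\<dots> \<le> ennreal (exp (q * J))"
      by (rule prod_expectation_le) (use J J0 b f0 in \<open>auto\<close>)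
    finally show "(\<integral>\<^sup>+\<gamma>. E n \<gamma> \<partial>G) \<le> ennreal (exp (q * J))" .
  qed
  finally have le: "(\<integral>\<^sup>+\<gamma>. (SUP n. E n \<gamma>) \<partial>G) \<le> ennreal (exp (q * J))" .
  have E_le: "exp (b * s n \<gamma>) \<le> enn2real (SUP n. E n \<gamma>)" if "(SUP n. E n \<gamma>) < \<infinity>" for n \<gamma>
  proof -
    have "enn2real (E n \<gamma>) \<le> enn2real (SUP n. E n \<gamma>)" using that by (intro enn2real_mono SUP_upper) auto
    then show ?thesis by (simp add: E_def s_def)
  qed
  have "AE \<gamma> in G. (SUP n. E n \<gamma>) \<noteq> \<infinity>"
  proof (rule nn_integral_PInf_AE)
    show "(\<lambda>\<gamma>. SUP n. E n \<gamma>) \<in> borel_measurable G" by measurable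
    show "(\<integral>\<^sup>+\<gamma>. (SUP n. E n \<gamma>) \<partial>G) \<noteq> \<infinity>" using le by (auto simp: top_unique)
  qed
  then show "AE \<gamma> in G. ?\<Psi> \<gamma> < \<infinity>"
  proof (rule AE_mp, intro AE_I2 impI)
    fix \<gamma> assume \<gamma>: "\<gamma> \<in> space G" and "(SUP n. E n \<gamma>) \<noteq> \<infinity>"
    then have "(SUP n. E n \<gamma>) < \<infinity>" by (simp only: infinity_ennreal_def top.not_eq_extremum)
    then show "?\<Psi> \<gamma> < \<infinity>" using bnd[OF _ E_le] \<gamma> by (simp add: space_pp)
  qed
  have "(\<integral>\<^sup>+\<gamma>. ennreal (exp (b * enn2real (?\<Psi> \<gamma>))) \<partial>G) \<le> (\<integral>\<^sup>+\<gamma>. (SUP n. E n \<gamma>) \<partial>G)"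
  proof (rule nn_integral_mono)
    fix \<gamma> assume "\<gamma> \<in> space G"
    then have \<gamma>: "\<gamma> \<in> locally_finite_sets" by (simp add: space_pp)
    show "ennreal (exp (b * enn2real (?\<Psi> \<gamma>))) \<le> (SUP n. E n \<gamma>)"
    proof (cases "(SUP n. E n \<gamma>) < \<infinity>")
      case True
      then have "ennreal (exp (b * enn2real (?\<Psi> \<gamma>))) \<le> ennreal (enn2real (SUP n. E n \<gamma>))"
        using bnd[OF \<gamma> E_le[OF True]] by (intro ennreal_leI) simp
      also have "\<dots> = (SUP n. E n \<gamma>)" using True by (intro ennreal_enn2real) simp
      finally show ?thesis .
    next
      \<comment> \<open>Here the right side is infinite, so the value that \<open>enn2real\<close>
        assigns to a divergent sum does no harm.\<close>
      case False
      then have "(SUP n. E n \<gamma>) = \<infinity>"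
          by (simp only: infinity_ennreal_def top.not_eq_extremum[symmetric] not_not)
      show ?thesis unfolding \<open>(SUP n. E n \<gamma>) = \<infinity>\<close> by simp
    qed
  qed
  also note le
  finally show "(\<integral>\<^sup>+\<gamma>. ennreal (exp (b * enn2real (?\<Psi> \<gamma>))) \<partial>G) \<le> ennreal (exp (q * J))" .
qed

end

section \<open>Radial integrals\<close>

text \<open>Polar coordinates for radial functions. The two measures are compared on half-lines,
  where the left one is the volume of a ball; the density on the right is the derivative of that
  volume in the radius.\<close>

lemma distr_norm_lborel:
  "distr (lborel :: 'a::euclidean_space measure) borel norm =
    density lborel (\<lambda>r. ennreal (unit_ball_vol (DIM('a)) * DIM('a) * r ^ (DIM('a) - 1)) * indicator {0..} r)"
  (is "?M = ?N")
proof (rule measure_eqI_generator_eq[where \<Omega>=UNIV and E="range atMost" and A="\<lambda>n. {..real n}"])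
  show "Int_stable (range atMost :: real set set)"
    by (auto simp: Int_stable_def)
  show "sets ?M = sigma_sets UNIV (range atMost)" "sets ?N = sigma_sets UNIV (range atMost)"
    by (simp_all add: borel_eq_atMost sets_measure_of)
  let ?d = "DIM('a)" and ?V = "unit_ball_vol (DIM('a))"
  have V0: "0 \<le> ?V" by simp
  fix X :: "real set" assume "X \<in> range atMost"
  then obtain r where X: "X = {..r}" by auto
  have dens: "emeasure ?N X = (\<integral>\<^sup>+s. ennreal (?V * ?d * s ^ (?d
      - 1)) * indicator {0..} s * indicator {..r} s \<partial>lborel)"
    unfolding X by (subst emeasure_density) auto
  have "emeasure ?M X = emeasure (lborel :: 'a measure) (cball 0 r)"
    unfolding X by (subst emeasure_distr) (auto intro!: arg_cong2[where f=emeasure])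
  also have "\<dots> = emeasure ?N X"
  proof (cases "0 \<le> r")
    case True
    have "emeasure ?N X = (\<integral>\<^sup>+s. ennreal (?V * ?d * s ^ (?d - 1)) * indicator {0..r} s \<partial>lborel)"
      unfolding dens by (intro nn_integral_cong) (auto simp: indicator_def)
    also have "\<dots> = ennreal (?V * r ^ ?d - ?V * 0 ^ ?d)"
    proof (rule nn_integral_FTC_Icc[OF _ _ _ True])
      show "DERIV (\<lambda>s. ?V * s ^ ?d) s :> ?V * ?d * s ^ (?d - 1)" for s
        by (auto intro!: derivative_eq_intros)
    qed auto
    finally show ?thesis using True by (simp add: emeasure_cball)
  next
    case False
    have "emeasure ?N X = (\<integral>\<^sup>+s. 0 \<partial>(lborel :: real measure))"
      unfolding dens using False by (intro nn_integral_cong) (auto simp: indicator_def)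
    then show ?thesis using False by simp
  qed
  finally show "emeasure ?M X = emeasure ?N X" .
next
  show "emeasure ?M {..real n} \<noteq> \<infinity>" for n
  proof -
    have "emeasure ?M {..real n} = emeasure (lborel :: 'a measure) (cball 0 (real n))"
      by (subst emeasure_distr) (auto intro!: arg_cong2[where f=emeasure])
    then show ?thesis using emeasure_bounded_finite[of "cball (0::'a) (real n)"] by auto
  qed
  show "(\<Union>n. {..real n}) = UNIV" using real_arch_simple by auto
qed auto

lemma nn_integral_norm:
  fixes F :: "real \<Rightarrow> ennreal"
  assumes [measurable]: "F \<in> borel_measurable borel"
  shows "(\<integral>\<^sup>+x. F (norm (x::'a::euclidean_space)) \<partial>lborel) =
    (\<integral>\<^sup>+r. F r * (ennreal (unit_ball_vol (DIM('a)) * DIM('a) * r ^ (DIM('a) - 1)) * indicator {0..} r)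
        \<partial>lborel)"
proof -
  have "(\<integral>\<^sup>+x. F (norm (x::'a)) \<partial>lborel) = (\<integral>\<^sup>+r. F r \<partial>distr (lborel :: 'a measure) borel norm)"
    by (subst nn_integral_distr) auto
  then show ?thesis unfolding distr_norm_lborel by (subst (asm) nn_integral_density) (auto simp: mult.commute)
qed

text \<open>\<psi> is monotone on the half-line only; composition with \<open>max r0\<close> gives a
  monotone function on the whole line, and monotone functions are Borel.\<close>

lemma borel_measurable_antimono_cutoff:
  fixes \<psi> :: "real \<Rightarrow> real"
  assumes "antimono_on {0..} \<psi>" "0 < r0"
  shows "(\<lambda>r. \<psi> (max r0 r)) \<in> borel_measurable borel"
proof -
  have "mono (\<lambda>r. - \<psi> (max r0 r))"
    using assms by (intro monoI) (auto simp: monotone_on_def)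
  from borel_measurable_uminus[OF borel_measurable_mono[OF this]] show ?thesis by simp
qed

text \<open>Enlarging the argument by a shift costs only the factor \<open>(1 + l / r0) ^ (d - 1)\<close> in the
  radial weight, hence the shifted tail remains integrable.\<close>

lemma shifted_tail_integrable:
  fixes \<psi> :: "real \<Rightarrow> real"
  assumes anti: "antimono_on {0..} \<psi>" and pos: "\<And>r. 0 \<le> r \<Longrightarrow> 0 < \<psi> r" and r0: "0 < r0" and l: "0 \<le> l"
    and fin: "(\<integral>\<^sup>+r\<in>{r0..}. ennreal (r ^ (DIM('a::euclidean_space) - 1) * \<psi> r) \<partial>lborel) < \<infinity>"
  shows "(\<integral>\<^sup>+y. ennreal (\<psi> (max r0 (norm (y::'a) - l))) \<partial>lborel) < \<infinity>"
proof -
  let ?d = "DIM('a)" and ?V = "unit_ball_vol (DIM('a))"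
  let ?c = "?V * ?d * (1 + l / r0) ^ (?d - 1)"
  have m[measurable]: "(\<lambda>r. \<psi> (max r0 r)) \<in> borel_measurable borel"
    by (rule borel_measurable_antimono_cutoff[OF anti r0])
  have mm[measurable (raw)]: "h \<in> borel_measurable N \<Longrightarrow> (\<lambda>x. \<psi> (max r0 (h x))) \<in> borel_measurable N"
      for h and N :: "'n measure"
    by (rule measurable_compose[OF _ m])
  have "(\<integral>\<^sup>+y. ennreal (\<psi> (max r0 (norm (y::'a) - l))) \<partial>lborel) \<le>
    (\<integral>\<^sup>+y. ennreal (\<psi> r0) * indicator (cball 0 (r0 + l)) y + ennreal (\<psi> (max r0 (norm (y::'a)
        - l))) * indicator {r0 + l..} (norm y) \<partial>lborel)"
    by (intro nn_integral_mono) (auto simp: indicator_def max_def)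
  also have "\<dots> = ennreal (\<psi> r0) * emeasure lborel (cball (0::'a) (r0 + l))
     + (\<integral>\<^sup>+y. ennreal (\<psi> (max r0 (norm (y::'a) - l))) * indicator {r0 + l..} (norm y) \<partial>lborel)"
  proof -
    have [measurable]: "cball (0::'a) (r0 + l) \<in> sets borel" by simp
    show ?thesis
      by (subst nn_integral_add, measurable, measurable) (simp add: nn_integral_cmult_indicator)
  qed
  also have "(\<integral>\<^sup>+y. ennreal (\<psi> (max r0 (norm (y::'a) - l))) * indicator {r0 + l..} (norm y) \<partial>lborel)
     = (\<integral>\<^sup>+r. (ennreal (\<psi> (max r0 (r - l))) * indicator {r0 + l..} r) * (ennreal (?V * ?d * r ^ (?d
         - 1)) * indicator {0..} r) \<partial>lborel)"
    by (rule nn_integral_norm) measurable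
  also have "\<dots> = (\<integral>\<^sup>+r. (ennreal (\<psi> (max r0 ((l + r) - l))) * indicator {r0 + l..} (l
      + r)) * (ennreal (?V * ?d * (l + r) ^ (?d - 1)) * indicator {0..} (l + r)) \<partial>lborel)"
    by (subst (1) lborel_distr_plus[symmetric, of l], subst nn_integral_distr) auto
  also have "\<dots> \<le> (\<integral>\<^sup>+r. ennreal ?c * (ennreal (r ^ (?d - 1) * \<psi> (max r0 r)) * indicator {r0..} r) \<partial>lborel)"
  proof (rule nn_integral_mono)
    fix r :: real
    show "(ennreal (\<psi> (max r0 ((l + r) - l))) * indicator {r0 + l..} (l + r)) * (ennreal (?V * ?d * (l
        + r) ^ (?d - 1)) * indicator {0..} (l + r))
       \<le> ennreal ?c * (ennreal (r ^ (?d - 1) * \<psi> (max r0 r)) * indicator {r0..} r)"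
    proof (cases "r0 \<le> r")
      case True
      have "l * 1 \<le> l * (r / r0)" using True r0 l by (intro mult_left_mono) auto
      then have "l + r \<le> (1 + l / r0) * r" by (simp add: algebra_simps)
      then have "(l + r) ^ (?d - 1) \<le> ((1 + l / r0) * r) ^ (?d - 1)" using True r0 l
          by (intro power_mono) auto
      then have "?V * ?d * (l + r) ^ (?d - 1) * \<psi> r \<le> ?V * ?d * ((1 + l / r0) * r) ^ (?d - 1) * \<psi> r"
        using pos[of r] True r0 by (intro mult_right_mono mult_left_mono) (auto simp: less_imp_le)
      then have "\<psi> r * (?V * ?d * (l + r) ^ (?d - 1)) \<le> ?c * (r ^ (?d - 1) * \<psi> r)"
        by (simp add: power_mult_distrib mult_ac)
      then show ?thesis using True r0 l pos[of r]
        by (simp add: ennreal_mult'[symmetric] ennreal_leI max_absorb2 less_imp_le)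
    qed (simp add: indicator_def)
  qed
  also have "\<dots> = ennreal ?c * (\<integral>\<^sup>+r. (ennreal (r ^ (?d - 1) * \<psi> (max r0 r)) * indicator {r0..} r) \<partial>lborel)"
    by (rule nn_integral_cmult) measurable
  also have "(\<integral>\<^sup>+r. (ennreal (r ^ (?d - 1) * \<psi> (max r0 r)) * indicator {r0..} r) \<partial>lborel)
      = (\<integral>\<^sup>+r\<in>{r0..}. ennreal (r ^ (?d - 1) * \<psi> r) \<partial>lborel)"
    by (intro nn_integral_cong) (auto simp: indicator_def max_def)
  finally have "(\<integral>\<^sup>+y. ennreal (\<psi> (max r0 (norm (y::'a) - l))) \<partial>lborel)
      \<le> ennreal (\<psi> r0) * emeasure lborel (cball (0::'a) (r0 + l)) +
     ennreal ?c * (\<integral>\<^sup>+r\<in>{r0..}. ennreal (r ^ (?d - 1) * \<psi> r) \<partial>lborel)" by (simp add: add_left_mono)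
  also have "\<dots> < \<infinity>"
    using fin emeasure_bounded_finite[of "cball (0::'a) (r0 + l)"] by (simp add: ennreal_mult_less_top)
  finally show ?thesis .
qed

section \<open>Gibbs processes with superstable potential\<close>

lemma nn_integral_count_space_insert:
  assumes "x \<notin> \<gamma>"
  shows "(\<integral>\<^sup>+y. f y \<partial>count_space (insert x \<gamma>)) = f x + (\<integral>\<^sup>+y. f y \<partial>count_space \<gamma>)"
proof -
  have "(\<integral>\<^sup>+y. f y \<partial>count_space (insert x \<gamma>)) = (\<integral>\<^sup>+y\<in>{x} \<union> \<gamma>. f y \<partial>count_space UNIV)"
    by (subst nn_integral_count_space_indicator) auto
  also have "\<dots> = (\<integral>\<^sup>+y\<in>{x}. f y \<partial>count_space UNIV) + (\<integral>\<^sup>+y\<in>\<gamma>. f y \<partial>count_space UNIV)"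
    using assms by (intro nn_integral_disjoint_pair_countspace) auto
  also have "\<dots> = (\<integral>\<^sup>+y. f y \<partial>count_space {x}) + (\<integral>\<^sup>+y. f y \<partial>count_space \<gamma>)"
    by (subst (3 4) nn_integral_count_space_indicator) auto
  finally show ?thesis by (simp add: nn_integral_count_space_finite)
qed

lemma ennreal_abs_real_of_ereal_le: "ennreal \<bar>real_of_ereal a\<bar> \<le> e2ennreal \<bar>a\<bar>"
  by (cases a) auto

text \<open>The unordered sum is traded for an integral over counting measure, so that monotonicity
  and the split into positive and negative parts can be used below.\<close>

lemma interaction_eq_integral:
  "interaction u x \<gamma> = (if (\<integral>\<^sup>+y. e2ennreal \<bar>u (x - y)\<bar> \<partial>count_space \<gamma>) < \<infinity>
     then ereal (\<integral>y. real_of_ereal (u (x - y)) \<partial>count_space \<gamma>) else \<infinity>)"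
  "(\<integral>\<^sup>+y. e2ennreal \<bar>u (x - y)\<bar> \<partial>count_space \<gamma>) < \<infinity> \<Longrightarrow>
     integrable (count_space \<gamma>) (\<lambda>y. real_of_ereal (u (x - y)))"
proof -
  show i: "integrable (count_space \<gamma>) (\<lambda>y. real_of_ereal (u (x - y)))"
    if "(\<integral>\<^sup>+y. e2ennreal \<bar>u (x - y)\<bar> \<partial>count_space \<gamma>) < \<infinity>"
  proof (rule integrableI_bounded)
    have "(\<integral>\<^sup>+y. norm (real_of_ereal (u (x - y))) \<partial>count_space \<gamma>)
        \<le> (\<integral>\<^sup>+y. e2ennreal \<bar>u (x - y)\<bar> \<partial>count_space \<gamma>)"
      unfolding real_norm_def by (intro nn_integral_mono ennreal_abs_real_of_ereal_le)
    then show "(\<integral>\<^sup>+y. norm (real_of_ereal (u (x - y))) \<partial>count_space \<gamma>) < \<infinity>" using that by (rule le_less_trans)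
  qed simp
  show "interaction u x \<gamma> = (if (\<integral>\<^sup>+y. e2ennreal \<bar>u (x - y)\<bar> \<partial>count_space \<gamma>) < \<infinity>
     then ereal (\<integral>y. real_of_ereal (u (x - y)) \<partial>count_space \<gamma>) else \<infinity>)"
    using i infsetsum_infsum[of "\<lambda>y. real_of_ereal (u (x - y))" \<gamma>]
    by (simp add: interaction_def infsetsum_def Infinite_Set_Sum.abs_summable_on_def)
qed

locale gibbs_setting =
  fixes \<beta> z q r0 :: real and u :: "'a::euclidean_space \<Rightarrow> ereal" and G :: "'a set measure"
    and \<rho> :: "nat \<Rightarrow> (nat \<Rightarrow> 'a) \<Rightarrow> real" and \<phi> \<psi> :: "real \<Rightarrow> real"
  assumes \<beta>: "0 < \<beta>" and z: "0 < z"
    and u_measurable [measurable]: "u \<in> borel_measurable borel"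
    and u_not_MInf: "\<And>x. u x \<noteq> -\<infinity>" and u_even: "\<And>x. u (- x) = u x" and u_0: "u 0 = \<infinity>"
    and r0: "0 < r0" and \<phi>: "\<And>r. 0 < r \<Longrightarrow> r < r0 \<Longrightarrow> 0 < \<phi> r"
    and \<psi>_anti: "antimono_on {0..} \<psi>" and \<psi>_pos: "\<And>r. 0 \<le> r \<Longrightarrow> 0 < \<psi> r"
    and \<psi>_tail: "(\<integral>\<^sup>+r\<in>{r0..}. ennreal (r ^ (DIM('a) - 1) * \<psi> r) \<partial>lborel) < \<infinity>"
    and u_core: "\<And>x. 0 < norm x \<Longrightarrow> norm x < r0 \<Longrightarrow> ereal (\<phi> (norm x)) \<le> u x"
    and u_tail: "\<And>x. r0 \<le> norm x \<Longrightarrow> \<bar>u x\<bar> \<le> ereal (\<psi> (norm x))"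
    and gibbs: "gibbs_process \<beta> z u G"
    and corr: "\<And>n. 1 \<le> n \<Longrightarrow> is_correlation_function G n (\<rho> n)"
    and q: "0 < q" and bound: "\<And>n. 1 \<le> n \<Longrightarrow> AE x in PiM {..<n} (\<lambda>_. lborel). \<rho> n x \<le> q ^ n"
begin

lemma pp: "point_process G" using gibbs by (simp add: gibbs_process_def)
lemma sets_G [measurable_cong]: "sets G = sets config_space" using pp by (simp add: point_process_def)
lemma space_G: "space G = locally_finite_sets" using sets_eq_imp_space_eq[OF sets_G] by simp

sublocale prob_space G using pp by (simp add: point_process_def)

section \<open>Boltzmann factors and dominating sums\<close>

text \<open>A majorant of the attraction that is uniform over a ball: for every x within distance l
  of c it dominates \<open>\<psi>s 0 0 (x - y)\<close>, see \<open>\<psi>s_shift\<close>. The cutoff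
  at \<open>r0\<close> keeps it bounded by \<open>\<psi> r0\<close>.\<close>

definition \<psi>s :: "'a \<Rightarrow> real \<Rightarrow> 'a \<Rightarrow> real" where "\<psi>s c l y = \<psi> (max r0 (norm (y - c) - l))"
definition Psi :: "'a \<Rightarrow> real \<Rightarrow> 'a set \<Rightarrow> ennreal" where
  "Psi c l \<gamma> = (\<integral>\<^sup>+y. ennreal (\<psi>s c l y) \<partial>count_space \<gamma>)"
definition e :: "'a \<Rightarrow> real" where "e w = (if u w = \<infinity> then 0 else exp (- \<beta> * real_of_ereal (u w)))"
definition abs_interaction :: "'a \<Rightarrow> 'a set \<Rightarrow> ennreal" where
  "abs_interaction x \<gamma> = (\<integral>\<^sup>+y. e2ennreal \<bar>u (x - y)\<bar> \<partial>count_space \<gamma>)"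
definition papangelou0 :: "'a \<Rightarrow> 'a set \<Rightarrow> real" where
  "papangelou0 x \<gamma> = (if abs_interaction x \<gamma> < \<infinity> then z * exp (- \<beta> * (\<integral>y. real_of_ereal (u (x - y))
      \<partial>count_space \<gamma>)) else 0)"
text \<open>The locale \<open>papangelou\<close> asks for
  \<open>p x \<gamma> \<le> Z \<gamma>\<close> at every locally finite \<gamma>, while the sums
  \<open>Psi\<close> are finite only almost surely. Setting \<open>p\<close> to 0 off the good
  configurations repairs this on a null set. The identity \<open>p_insert\<close> survives, because
  \<open>good\<close> does not change when a point is added.\<close>

definition good :: "'a set \<Rightarrow> bool" where "good \<gamma> \<longleftrightarrow> (\<forall>n::nat. Psi 0 (real n) \<gamma> < \<infinity>)"
definition p :: "'a \<Rightarrow> 'a set \<Rightarrow> real" where "p x \<gamma> = (if good \<gamma> then papangelou0 x \<gamma> else 0)"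
definition psi_mass :: "real \<Rightarrow> real" where "psi_mass l = enn2real (\<integral>\<^sup>+y. ennreal (\<psi>s (0::'a) l y) \<partial>lborel)"
text \<open>One constant for two purposes: it bounds the Boltzmann factor \<open>e\<close>, and it
  bounds the growth of \<open>Z\<close> when a point is added.\<close>

definition K :: real where "K = exp (\<beta> * \<psi> r0)"

lemma K_ge_1: "1 \<le> K" using \<beta> \<psi>_pos[of r0] r0 by (simp add: K_def)

lemma \<psi>_le: "r0 \<le> r \<Longrightarrow> \<psi> r \<le> \<psi> r0" and \<psi>_mono: "0 \<le> r \<Longrightarrow> r \<le> s \<Longrightarrow> \<psi> s \<le> \<psi> r"
  using \<psi>_anti r0 by (auto simp: monotone_on_def)

lemma \<psi>s_pos: "0 < \<psi>s c l y" and \<psi>s_le: "\<psi>s c l y \<le> \<psi> r0"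
  unfolding \<psi>s_def using r0 by (auto intro!: \<psi>_pos \<psi>_le)

lemma \<psi>s_measurable [measurable]: "\<psi>s c l \<in> borel_measurable borel"
  unfolding \<psi>s_def
  by (rule measurable_compose[OF _ borel_measurable_antimono_cutoff[OF \<psi>_anti r0]]) measurable

lemma \<psi>s_integral: "0 \<le> l \<Longrightarrow> (\<integral>\<^sup>+y. ennreal (\<psi>s c l y) \<partial>lborel) = ennreal (psi_mass l)"
proof -
  assume l: "0 \<le> l"
  have "(\<integral>\<^sup>+y. ennreal (\<psi>s c l y) \<partial>lborel) = (\<integral>\<^sup>+y. ennreal (\<psi>s c l y) \<partial>distr lborel borel ((+) c))"
    by (simp add: lborel_distr_plus)
  also have "\<dots> = (\<integral>\<^sup>+y. ennreal (\<psi>s c l (c + y)) \<partial>lborel)"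
    by (subst nn_integral_distr) simp_all
  also have "\<dots> = (\<integral>\<^sup>+y. ennreal (\<psi>s 0 l y) \<partial>lborel)"
    by (simp add: \<psi>s_def)
  also have "\<dots> = ennreal (psi_mass l)"
    using shifted_tail_integrable[where 'a='a, OF \<psi>_anti \<psi>_pos r0 l \<psi>_tail]
    by (simp add: psi_mass_def \<psi>s_def)
  finally show ?thesis .
qed

lemma psi_mass_nonneg: "0 \<le> psi_mass l" by (simp add: psi_mass_def)

lemma exp_bound: "0 \<le> t \<Longrightarrow> exp t - 1 \<le> t * exp (t::real)"
proof -
  assume "0 \<le> t"
  have "1 - t \<le> exp (- t)" using exp_ge_add_one_self[of "- t"] by simp
  then have "(1 - t) * exp t \<le> exp (- t) * exp t" by (intro mult_right_mono) auto
  then show ?thesis by (simp add: algebra_simps flip: exp_add)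
qed

text \<open>Bounds the integral of \<open>exp (b * \<psi>s c l y) - 1\<close>. It does not depend on
  the centre c, which makes the constant \<open>C\<close> uniform in x.\<close>

definition exp_mass :: "real \<Rightarrow> real \<Rightarrow> real" where "exp_mass b l = b * exp (b * \<psi> r0) * psi_mass l"

lemma exp_\<psi>s_integral:
  assumes b: "0 < b" and l: "0 \<le> l"
  shows "(\<integral>\<^sup>+y. ennreal (exp (b * \<psi>s c l y) - 1) \<partial>lborel) \<le> ennreal (exp_mass b l)"
proof -
  have "exp (b * \<psi>s c l y) - 1 \<le> b * exp (b * \<psi> r0) * \<psi>s c l y" for y
  proof -
    have "exp (b * \<psi>s c l y) - 1 \<le> (b * \<psi>s c l y) * exp (b * \<psi>s c l y)"
      using b \<psi>s_pos[of c l y] by (intro exp_bound) simp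
    also have "\<dots> \<le> (b * \<psi>s c l y) * exp (b * \<psi> r0)"
      using b \<psi>s_pos[of c l y] \<psi>s_le[of c l y] by (intro mult_left_mono) auto
    finally show ?thesis by (simp add: mult_ac)
  qed
  then have "(\<integral>\<^sup>+y. ennreal (exp (b * \<psi>s c l y) - 1) \<partial>lborel)
      \<le> (\<integral>\<^sup>+y. ennreal (b * exp (b * \<psi> r0)) * ennreal (\<psi>s c l y) \<partial>lborel)"
    using b by (intro nn_integral_mono) (simp add: ennreal_mult'[symmetric] ennreal_leI)
  also have "\<dots> = ennreal (b * exp (b * \<psi> r0)) * ennreal (psi_mass l)"
    by (subst nn_integral_cmult) (simp_all add: \<psi>s_integral[OF l])
  finally show ?thesis using b psi_mass_nonneg by (simp add: exp_mass_def ennreal_mult)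
qed

lemma exp_mass_nonneg: "0 < b \<Longrightarrow> 0 \<le> exp_mass b l" using psi_mass_nonneg by (simp add: exp_mass_def)

lemma exp_Psi:
  assumes b: "0 < b" and l: "0 \<le> l"
  shows "AE \<gamma> in G. Psi c l \<gamma> < \<infinity>" "(\<integral>\<^sup>+\<gamma>. ennreal (exp (b * enn2real (Psi c l \<gamma>))) \<partial>G)
      \<le> ennreal (exp (q * exp_mass b l))"
  unfolding Psi_def
  using exp_sum_expectation[OF pp corr q bound, of "\<psi>s c l" b "exp_mass b l"] exp_\<psi>s_integral[OF b l]
      exp_mass_nonneg[OF b] \<psi>s_pos b
  by (auto simp: less_imp_le)

lemma AE_good: "AE \<gamma> in G. good \<gamma>"
  unfolding good_def AE_all_countable using exp_Psi(1)[of 1] by simp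

lemma Psi_insert: "x \<notin> \<gamma> \<Longrightarrow> Psi c l (insert x \<gamma>) = ennreal (\<psi>s c l x) + Psi c l \<gamma>"
  unfolding Psi_def by (rule nn_integral_count_space_insert)

lemma good_insert: "good (insert x \<gamma>) \<longleftrightarrow> good \<gamma>"
  by (cases "x \<in> \<gamma>") (auto simp: good_def insert_absorb Psi_insert)

lemma Psi_measurable [measurable]: "Psi c l \<in> borel_measurable config_space"
  unfolding Psi_def by (rule nn_integral_count_measurable[OF _ measurable_ident_sets[OF refl]]) measurable

lemma good_measurable [measurable]: "Measurable.pred config_space good"
  unfolding good_def by measurable

lemma e_nonneg: "0 \<le> e x" by (simp add: e_def)
lemma e_even: "e (- x) = e x" by (simp add: e_def u_even)
lemma e_measurable [measurable]: "e \<in> borel_measurable borel"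
proof -
  have "e = (\<lambda>w. if u w < \<infinity> then exp (- \<beta> * real_of_ereal (u w)) else 0)"
    by (auto simp: e_def fun_eq_iff)
  then show ?thesis by simp
qed

text \<open>Only attraction has to be dominated. Within distance \<open>r0\<close> the potential is
  nonnegative, and \<open>real_of_ereal\<close> sends its infinite values to 0, so the left side is
  at most 0 there.\<close>

lemma neg_u_le: "- real_of_ereal (u x) \<le> \<psi>s 0 0 x"
proof (cases "r0 \<le> norm x")
  case True
  then obtain a where a: "u x = ereal a" using u_tail[OF True] by (cases "u x") auto
  have "\<bar>a\<bar> \<le> \<psi> (norm x)" using u_tail[OF True] by (simp add: a)
  then show ?thesis using True by (simp add: \<psi>s_def max_absorb2 a abs_le_iff)
next
  case False
  have "0 \<le> real_of_ereal (u x)"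
  proof (cases "x = 0")
    case True
    then show ?thesis by (simp add: u_0)
  next
    case nz: False
    then have "0 < ereal (\<phi> (norm x))" using \<phi> False by auto
    also have "\<dots> \<le> u x" using u_core nz False by simp
    finally show ?thesis by (simp add: real_of_ereal_pos)
  qed
  then show ?thesis using \<psi>s_pos[of 0 0 x] by simp
qed

lemma e_le: "e x \<le> K"
proof -
  have "- \<beta> * real_of_ereal (u x) = \<beta> * (- real_of_ereal (u x))" by simp
  also have "\<dots> \<le> \<beta> * \<psi> r0" using \<beta> neg_u_le[of x] \<psi>s_le[of 0 0 x] by (intro mult_left_mono) auto
  finally show ?thesis using K_ge_1 by (auto simp: e_def K_def)
qed

text \<open>The summand \<open>1 / \<psi> r0\<close> serves the core, where
  \<open>\<bar>e x - 1\<bar> \<le> 1\<close> and \<open>\<psi>s 0 0 x = \<psi> r0\<close>. The other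
  one serves the tail, where the exponential is linearised and u is bounded by \<psi>.\<close>

definition \<Phi> :: real where "\<Phi> = (1 / \<psi> r0 + \<beta> * exp (\<beta> * \<psi> r0)) * psi_mass 0"

lemma e_integral: "(\<integral>\<^sup>+x. ennreal \<bar>e x - 1\<bar> \<partial>lborel) \<le> ennreal \<Phi>"
proof -
  let ?D = "1 / \<psi> r0 + \<beta> * exp (\<beta> * \<psi> r0)"
  have \<psi>0: "0 < \<psi> r0" using r0 by (simp add: \<psi>_pos)
  have "\<bar>e x - 1\<bar> \<le> ?D * \<psi>s 0 0 x" for x
  proof (cases "r0 \<le> norm x")
    case True
    then have s: "\<psi>s 0 0 x = \<psi> (norm x)" by (simp add: \<psi>s_def max_absorb2)
    have fin: "u x \<noteq> \<infinity>" using u_tail[OF True] by auto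
    then obtain a where a: "u x = ereal a" using u_not_MInf[of x] by (cases "u x") auto
    have al: "\<bar>a\<bar> \<le> \<psi> (norm x)" using u_tail[OF True] by (simp add: a)
    let ?t = "\<beta> * \<psi> (norm x)"
    have t0: "0 \<le> ?t" using \<beta> \<psi>_pos[of "norm x"] by simp
    have b1: "- \<beta> * a \<le> ?t" and b2: "- ?t \<le> - \<beta> * a"
      using al \<beta> by (auto simp: abs_le_iff intro: mult_left_mono)
         (metis less_eq_real_def minus_le_iff minus_mult_right mult_left_mono)+
    have "exp (- \<beta> * a) - 1 \<le> exp ?t - 1" using b1 by simp
    also have "\<dots> \<le> ?t * exp ?t" by (rule exp_bound[OF t0])
    finally have 1: "exp (- \<beta> * a) - 1 \<le> ?t * exp ?t" .
    have "1 - exp (- \<beta> * a) \<le> 1 - exp (- ?t)" using b2 by simp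
    also have "\<dots> \<le> ?t" using exp_ge_add_one_self[of "- ?t"] by simp
    also have "\<dots> \<le> ?t * exp ?t" using t0 by (simp add: mult_le_cancel_left1)
    finally have "\<bar>e x - 1\<bar> \<le> ?t * exp ?t" using 1 by (simp add: e_def a)
    also have "\<dots> \<le> ?t * exp (\<beta> * \<psi> r0)" using \<beta> \<psi>_le[OF True] t0 by (intro mult_left_mono) auto
    also have "\<dots> \<le> ?D * \<psi>s 0 0 x" using \<psi>0 \<psi>_pos[of "norm x"] by (simp add: s algebra_simps)
    finally show ?thesis .
  next
    case False
    then have s: "\<psi>s 0 0 x = \<psi> r0" by (simp add: \<psi>s_def max_absorb1)
    have "e x \<le> 1"
    proof (cases "x = 0")
      case True
      then show ?thesis by (simp add: e_def u_0)
    next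
      case nz: False
      then have "0 < ereal (\<phi> (norm x))" using \<phi> False by auto
      also have "\<dots> \<le> u x" using u_core nz False by simp
      finally have "0 \<le> real_of_ereal (u x)" by (simp add: real_of_ereal_pos)
      then show ?thesis using \<beta> by (simp add: e_def)
    qed
    then have "\<bar>e x - 1\<bar> \<le> 1" using e_nonneg[of x] by simp
    also have "1 \<le> ?D * \<psi>s 0 0 x" using \<psi>0 \<beta> by (simp add: s distrib_right)
    finally show ?thesis .
  qed
  then have "(\<integral>\<^sup>+x. ennreal \<bar>e x - 1\<bar> \<partial>lborel) \<le> (\<integral>\<^sup>+x. ennreal ?D * ennreal (\<psi>s 0 0 x) \<partial>lborel)"
    using \<psi>0 \<beta> by (intro nn_integral_mono) (simp add: ennreal_mult'[symmetric] ennreal_leI del: ennreal_plus)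
  also have "\<dots> = ennreal ?D * ennreal (psi_mass 0)"
    by (subst nn_integral_cmult) (simp_all add: \<psi>s_integral)
  finally show ?thesis using psi_mass_nonneg \<psi>0 \<beta> by (simp add: \<Phi>_def ennreal_mult del: ennreal_plus)
qed

lemma abs_interaction_insert: "x \<notin> \<gamma> \<Longrightarrow> abs_interaction y (insert x \<gamma>)
    = e2ennreal \<bar>u (y - x)\<bar> + abs_interaction y \<gamma>"
  unfolding abs_interaction_def by (rule nn_integral_count_space_insert)

text \<open>If \<open>u (y - x)\<close> is infinite or the interaction with \<gamma> already
  diverges, both sides are 0. Otherwise the energy is additive and the exponential
  multiplicative.\<close>

lemma papangelou0_insert:
  assumes x: "x \<notin> \<gamma>"
  shows "papangelou0 y (insert x \<gamma>) = papangelou0 y \<gamma> * e (y - x)"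
proof (cases "u (y - x) = \<infinity> \<or> \<not> abs_interaction y \<gamma> < \<infinity>")
  case True
  then have "\<not> abs_interaction y (insert x \<gamma>) < \<infinity>" by (auto simp: abs_interaction_insert[OF x])
  then show ?thesis using True by (auto simp: papangelou0_def e_def)
next
  case False
  then obtain a where a: "u (y - x) = ereal a" using u_not_MInf[of "y - x"] by (cases "u (y - x)") auto
  have fin: "abs_interaction y \<gamma> < \<infinity>" using False by simp
  have "(\<integral>y'. real_of_ereal (u (y - y')) \<partial>count_space ({x} \<union> \<gamma>))
      = (\<integral>y'. real_of_ereal (u (y - y')) \<partial>count_space {x}) + (\<integral>y'. real_of_ereal (u (y - y')) \<partial>count_space \<gamma>)"
    using infsetsum_Un_disjoint[of "\<lambda>y'. real_of_ereal (u (y - y'))" "{x}" \<gamma>] x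
      interaction_eq_integral(2)[where u=u and x=y and \<gamma>=\<gamma>] fin
    by (auto simp: infsetsum_def Infinite_Set_Sum.abs_summable_on_def abs_interaction_def
        integrable_count_space)
  then have "(\<integral>y'. real_of_ereal (u (y - y')) \<partial>count_space (insert x \<gamma>))
      = a + (\<integral>y'. real_of_ereal (u (y - y')) \<partial>count_space \<gamma>)"
    by (simp add: lebesgue_integral_count_space_finite a)
  moreover have "abs_interaction y (insert x \<gamma>) < \<infinity>" using fin by (simp add: abs_interaction_insert[OF x] a)
  ultimately show ?thesis using fin by (simp add: papangelou0_def e_def a algebra_simps flip: exp_add)
qed

lemma p_insert: "x \<notin> \<gamma> \<Longrightarrow> p y (insert x \<gamma>) = p y \<gamma> * e (y - x)"
  by (simp add: p_def good_insert papangelou0_insert)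

lemma papangelou0_nonneg: "0 \<le> papangelou0 x \<gamma>" using z by (simp add: papangelou0_def)
lemma p_nonneg: "0 \<le> p x \<gamma>" by (simp add: p_def papangelou0_nonneg)

lemma boltzmann_interaction: "ennreal z * boltzmann \<beta> (interaction u x \<gamma>) = ennreal (papangelou0 x \<gamma>)"
  using z by (auto simp: boltzmann_def interaction_eq_integral(1) papangelou0_def
      abs_interaction_def[symmetric] ennreal_mult)

lemma abs_interaction_measurable: "case_prod abs_interaction \<in> borel_measurable (borel \<Otimes>\<^sub>M config_space)"
  unfolding abs_interaction_def by measurable

lemma papangelou0_measurable: "case_prod papangelou0 \<in> borel_measurable (borel \<Otimes>\<^sub>M config_space)"
proof -
  note [measurable] = abs_interaction_measurable
  \<comment> \<open>\<open>nn_integral_count_measurable\<close> treats nonnegative integrands over a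
    varying configuration, so the Bochner integral is rewritten through its positive and negative
    parts.\<close>
  define s where "s = (\<lambda>x \<gamma>. enn2real (\<integral>\<^sup>+y. ennreal (real_of_ereal (u (x - y))) \<partial>count_space \<gamma>)
     - enn2real (\<integral>\<^sup>+y. ennreal (- real_of_ereal (u (x - y))) \<partial>count_space \<gamma>))"
  have s[measurable]: "case_prod s \<in> borel_measurable (borel \<Otimes>\<^sub>M config_space)" unfolding s_def by measurable
  have "papangelou0 x \<gamma> = (if abs_interaction x \<gamma> < \<infinity> then z * exp (- \<beta> * s x \<gamma>) else 0)" for x \<gamma>
    unfolding papangelou0_def s_def using interaction_eq_integral(2)[where u=u and x=x and \<gamma>=\<gamma>]
    by (simp add: abs_interaction_def real_lebesgue_integral_def)
  then have "case_prod papangelou0 = (\<lambda>w.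
      if case_prod abs_interaction w < \<infinity> then z * exp (- \<beta> * case_prod s w) else 0)"
    by (auto simp: fun_eq_iff)
  then show ?thesis by simp
qed

lemma p_measurable: "case_prod p \<in> borel_measurable (borel \<Otimes>\<^sub>M config_space)"
proof -
  note [measurable] = papangelou0_measurable
  have "case_prod p = (\<lambda>w. if good (snd w) then case_prod papangelou0 w else 0)"
    by (auto simp: fun_eq_iff p_def)
  then show ?thesis by simp
qed

lemma \<psi>s_shift: "norm (x - c) \<le> l \<Longrightarrow> \<psi>s 0 0 (x - y) \<le> \<psi>s c l y"
proof -
  assume *: "norm (x - c) \<le> l"
  have "norm (y - c) \<le> norm (x - y) + norm (x - c)"
    using norm_triangle_ineq4[of "x - c" "x - y"] by simp
  then show ?thesis unfolding \<psi>s_def using * r0 by (intro \<psi>_mono) auto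
qed

text \<open>Only attraction can raise the intensity, and \<open>\<psi>s c l\<close> dominates it
  simultaneously for all x in the ball.\<close>

lemma papangelou0_le:
  assumes x: "norm (x - c) \<le> l" and fin: "Psi c l \<gamma> < \<infinity>"
  shows "papangelou0 x \<gamma> \<le> z * exp (\<beta> * enn2real (Psi c l \<gamma>))"
proof (cases "abs_interaction x \<gamma> < \<infinity>")
  case True
  have i1: "integrable (count_space \<gamma>) (\<lambda>y. real_of_ereal (u (x - y)))"
    using True interaction_eq_integral(2)[where u=u and x=x and \<gamma>=\<gamma>] by (simp add: abs_interaction_def)
  have i2: "integrable (count_space \<gamma>) (\<psi>s c l)"
    using fin \<psi>s_pos[of c l] by (intro integrableI_bounded) (auto simp: Psi_def abs_of_pos)
  have "- (\<integral>y. real_of_ereal (u (x - y)) \<partial>count_space \<gamma>)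
      = (\<integral>y. - real_of_ereal (u (x - y)) \<partial>count_space \<gamma>)" by simp
  also have "\<dots> \<le> (\<integral>y. \<psi>s c l y \<partial>count_space \<gamma>)"
    by (intro integral_mono Bochner_Integration.integrable_minus i1 i2 order_trans[OF neg_u_le
        \<psi>s_shift[OF x]])
  also have "\<dots> = enn2real (Psi c l \<gamma>)"
    unfolding Psi_def by (rule integral_eq_nn_integral) (auto simp: less_imp_le \<psi>s_pos)
  finally have "- \<beta> * (\<integral>y. real_of_ereal (u (x - y)) \<partial>count_space \<gamma>) \<le> \<beta> * enn2real (Psi c l \<gamma>)"
    using \<beta> mult_left_mono[of "- (\<integral>y. real_of_ereal (u (x - y))
        \<partial>count_space \<gamma>)" "enn2real (Psi c l \<gamma>)" \<beta>] by simp
  then show ?thesis using z True by (simp add: papangelou0_def)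
next
  case False
  then show ?thesis using z by (simp add: papangelou0_def)
qed

text \<open>From \<open>p x \<gamma> \<le> z * exp (\<beta> * t)\<close> with t the sum
  \<open>Psi x 0 \<gamma>\<close> follows \<open>(1 + p x \<gamma>) ^ 4 \<le> (1 + z) ^ 4 * exp (4 *
  \<beta> * t)\<close>; \<open>exp_Psi\<close> bounds the expectation independently of x.\<close>

definition C :: real where "C = (1 + z) ^ 4 * exp (q * exp_mass (4 * \<beta>) 0)"

lemma p_moments: "(\<integral>\<^sup>+\<gamma>. ennreal ((1 + p x \<gamma>) ^ 4) \<partial>G) \<le> ennreal C"
proof -
  have "(\<integral>\<^sup>+\<gamma>. ennreal ((1 + p x \<gamma>) ^ 4) \<partial>G)
      \<le> (\<integral>\<^sup>+\<gamma>. ennreal ((1 + z) ^ 4) * ennreal (exp ((4 * \<beta>) * enn2real (Psi x 0 \<gamma>))) \<partial>G)"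
  proof (rule nn_integral_mono_AE)
    have "AE \<gamma> in G. Psi x 0 \<gamma> < \<infinity>" using exp_Psi(1)[of 1] by simp
    then show "AE \<gamma> in G. ennreal ((1 + p x \<gamma>) ^ 4)
        \<le> ennreal ((1 + z) ^ 4) * ennreal (exp ((4 * \<beta>) * enn2real (Psi x 0 \<gamma>)))"
    proof eventually_elim
      fix \<gamma> assume fin: "Psi x 0 \<gamma> < \<infinity>"
      let ?E = "exp (\<beta> * enn2real (Psi x 0 \<gamma>))"
      have "1 \<le> ?E" using \<beta> by simp
      moreover have "p x \<gamma> \<le> z * ?E" using papangelou0_le[OF _ fin, of x] z by (auto simp: p_def)
      ultimately have "1 + p x \<gamma> \<le> (1 + z) * ?E" unfolding distrib_right by linarith
      then have "(1 + p x \<gamma>) ^ 4 \<le> ((1 + z) * ?E) ^ 4" using p_nonneg[of x \<gamma>] by (intro power_mono) auto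
      also have "\<dots> = (1 + z) ^ 4 * exp ((4 * \<beta>) * enn2real (Psi x 0 \<gamma>))"
        by (simp add: power_mult_distrib exp_of_nat_mult[symmetric] mult_ac)
      finally show "ennreal ((1 + p x \<gamma>) ^ 4)
          \<le> ennreal ((1 + z) ^ 4) * ennreal (exp ((4 * \<beta>) * enn2real (Psi x 0 \<gamma>)))"
        by (simp add: ennreal_mult''[symmetric] ennreal_leI)
    qed
  qed
  also have "\<dots> = ennreal ((1 + z) ^ 4) * (\<integral>\<^sup>+\<gamma>. ennreal (exp ((4 * \<beta>) * enn2real (Psi x 0 \<gamma>))) \<partial>G)"
    by (rule nn_integral_cmult) measurable
  also have "\<dots> \<le> ennreal ((1 + z) ^ 4) * ennreal (exp (q * exp_mass (4 * \<beta>) 0))"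
    using \<beta> by (intro mult_left_mono exp_Psi) auto
  finally show ?thesis by (simp add: C_def ennreal_mult'')
qed

text \<open>On the null set where \<open>Psi\<close> is infinite, the value of \<open>Y\<close> is chosen so that the bounds
  under insertion of a point survive.\<close>

definition Y :: "nat \<Rightarrow> 'a set \<Rightarrow> real" where
  "Y n \<gamma> = (if Psi 0 (real n) \<gamma> < \<infinity> then enn2real (Psi 0 (real n) \<gamma>) else \<psi> r0
      * real (card (\<gamma> \<inter> ball 0 (real n))))"
text \<open>The three summands of the factor give in turn \<open>1 \<le> Z n \<gamma>\<close>, the
  bound on the intensity, and the bound on the number of points, the last by
  \<open>\<beta> * Y n \<gamma> \<le> exp (\<beta> * Y n \<gamma>)\<close> and
  \<open>card_le_Y\<close>.\<close>

definition Z :: "nat \<Rightarrow> 'a set \<Rightarrow> real" where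
  "Z n \<gamma> = (1 + z + 1 / (\<beta> * \<psi> r0)) * exp (\<beta> * Y n \<gamma>)"

lemma Y_insert:
  assumes \<gamma>: "\<gamma> \<in> locally_finite_sets"
  shows "Y n \<gamma> \<le> Y n (insert x \<gamma>)" "Y n (insert x \<gamma>) \<le> \<psi> r0 + Y n \<gamma>"
proof -
  have \<psi>0: "0 < \<psi> r0" using r0 by (simp add: \<psi>_pos)
  have "Y n \<gamma> \<le> Y n (insert x \<gamma>) \<and> Y n (insert x \<gamma>) \<le> \<psi> r0 + Y n \<gamma>" if x: "x \<notin> \<gamma>"
  proof (cases "Psi 0 (real n) \<gamma> < \<infinity>")
    case True
    then have "enn2real (Psi 0 (real n) (insert x \<gamma>)) = \<psi>s 0 (real n) x + enn2real (Psi 0 (real n) \<gamma>)"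
      using \<psi>s_pos[of 0 "real n" x] by (simp add: Psi_insert[OF x] enn2real_plus less_imp_le)
    then show ?thesis using True \<psi>s_pos[of 0 "real n" x] \<psi>s_le[of 0 "real n" x]
      by (simp add: Y_def Psi_insert[OF x])
  next
    case False
    have fin: "finite (\<gamma> \<inter> ball 0 (real n))" using \<gamma> by (intro finite_Int_bounded) auto
    have "card (insert x \<gamma> \<inter> ball 0 (real n))
        = (if x \<in> ball 0 (real n) then Suc (card (\<gamma> \<inter> ball 0 (real n))) else card (\<gamma> \<inter> ball 0 (real n)))"
      using fin x by (simp add: Int_insert_left)
    then show ?thesis using False \<psi>0 by (simp add: Y_def Psi_insert[OF x] algebra_simps)
  qed
  moreover have "Y n (insert x \<gamma>) = Y n \<gamma>" if "x \<in> \<gamma>" using that by (simp add: insert_absorb)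
  ultimately show "Y n \<gamma> \<le> Y n (insert x \<gamma>)" "Y n (insert x \<gamma>) \<le> \<psi> r0 + Y n \<gamma>" using \<psi>0
      by (cases "x \<in> \<gamma>"; force)+
qed

text \<open>On the ball of radius n the majorant \<open>\<psi>s 0 (real n)\<close> has the constant
  value \<open>\<psi> r0\<close>, so \<open>Psi\<close> counts the points there.\<close>

lemma card_le_Y:
  assumes \<gamma>: "\<gamma> \<in> locally_finite_sets"
  shows "\<psi> r0 * real (card (\<gamma> \<inter> ball 0 (real n))) \<le> Y n \<gamma>"
proof (cases "Psi 0 (real n) \<gamma> < \<infinity>")
  case True
  have fin: "finite (\<gamma> \<inter> ball 0 (real n))" using \<gamma> by (intro finite_Int_bounded) auto
  have \<psi>0: "0 < \<psi> r0" using r0 by (simp add: \<psi>_pos)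
  have "ennreal (\<psi> r0 * real (card (\<gamma> \<inter> ball 0 (real n)))) = (\<Sum>y\<in>\<gamma> \<inter> ball 0 (real n). ennreal (\<psi> r0))"
    using \<psi>0 by (subst sum_ennreal) (auto simp: mult.commute)
  also have "\<dots> = (\<integral>\<^sup>+y. ennreal (\<psi> r0) \<partial>count_space (\<gamma> \<inter> ball 0 (real n)))"
    by (rule nn_integral_count_space_finite[OF fin, symmetric])
  also have "\<dots> = (\<integral>\<^sup>+y. ennreal (\<psi> r0) * indicator (\<gamma> \<inter> ball 0 (real n)) y \<partial>count_space UNIV)"
    by (rule nn_integral_count_space_indicator) simp
  also have "\<dots> \<le> (\<integral>\<^sup>+y. ennreal (\<psi>s 0 (real n) y) * indicator \<gamma> y \<partial>count_space UNIV)"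
    using r0 by (intro nn_integral_mono) (auto simp: indicator_def \<psi>s_def max_def intro!: ennreal_leI)
  also have "\<dots> = Psi 0 (real n) \<gamma>"
    unfolding Psi_def by (rule nn_integral_count_space_indicator[symmetric]) simp
  finally have "ennreal (\<psi> r0 * real (card (\<gamma> \<inter> ball 0 (real n)))) \<le> ennreal (enn2real (Psi 0 (real n) \<gamma>))"
    using True by simp
  then show ?thesis using True by (simp add: Y_def)
qed (simp add: Y_def)

lemma Z_moments: "integrable G (\<lambda>\<gamma>. Z n \<gamma> ^ k)"
proof -
  let ?c = "1 + z + 1 / (\<beta> * \<psi> r0)"
  have \<psi>0: "0 < \<psi> r0" using r0 by (simp add: \<psi>_pos)
  note [measurable] = measurable_card_config[OF measurable_ident_sets[OF refl], of "ball (0::'a) (real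
      n)", simplified]
  have Ym[measurable]: "Y n \<in> borel_measurable config_space" unfolding Y_def by measurable
  \<comment> \<open>\<open>exp_Psi\<close> requires a positive exponent; \<open>Suc k\<close>
    instead of k covers the case k = 0.\<close>
  have "integrable G (\<lambda>\<gamma>. exp (real (Suc k) * \<beta> * enn2real (Psi 0 (real n) \<gamma>)))"
  proof (rule integrableI_bounded)
    have "(\<integral>\<^sup>+\<gamma>. ennreal (exp (real (Suc k) * \<beta> * enn2real (Psi 0 (real n) \<gamma>))) \<partial>G)
        \<le> ennreal (exp (q * exp_mass (real (Suc k) * \<beta>) (real n)))"
      using \<beta> by (intro exp_Psi) auto
    then show "(\<integral>\<^sup>+\<gamma>. norm (exp (real (Suc k) * \<beta> * enn2real (Psi 0 (real n) \<gamma>))) \<partial>G) < \<infinity>"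
      by (simp add: le_less_trans[OF _ ennreal_less_top])
  qed measurable
  then have "integrable G (\<lambda>\<gamma>. ?c ^ k * exp (real (Suc k) * \<beta> * enn2real (Psi 0 (real n) \<gamma>)))"
    by (rule integrable_mult_right)
  then show ?thesis
  proof (rule Bochner_Integration.integrable_bound)
    show "(\<lambda>\<gamma>. Z n \<gamma> ^ k) \<in> borel_measurable G" unfolding Z_def by measurable
    have "AE \<gamma> in G. Psi 0 (real n) \<gamma> < \<infinity>" using exp_Psi(1)[of 1] by simp
    then show "AE \<gamma> in G. norm (Z n \<gamma> ^ k)
        \<le> norm (?c ^ k * exp (real (Suc k) * \<beta> * enn2real (Psi 0 (real n) \<gamma>)))"
    proof eventually_elim
      fix \<gamma> assume fin: "Psi 0 (real n) \<gamma> < \<infinity>"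
      let ?y = "enn2real (Psi 0 (real n) \<gamma>)"
      have c: "0 \<le> ?c" using z \<beta> \<psi>0 by simp
      have "Z n \<gamma> ^ k = ?c ^ k * exp (real k * (\<beta> * ?y))"
        using fin by (simp add: Z_def Y_def power_mult_distrib exp_of_nat_mult)
      also have "\<dots> \<le> ?c ^ k * exp (real (Suc k) * \<beta> * ?y)"
        using c \<beta> by (intro mult_left_mono) (auto simp: mult_ac intro!: mult_left_mono mult_right_mono)
      finally have "Z n \<gamma> ^ k \<le> ?c ^ k * exp (real (Suc k) * \<beta> * ?y)" .
      moreover have "0 \<le> Z n \<gamma> ^ k" using c by (simp add: Z_def)
      ultimately show "norm (Z n \<gamma> ^ k) \<le> norm (?c ^ k * exp (real (Suc k) * \<beta> * ?y))" by simp
    qed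
  qed
qed

section \<open>The Gibbs process as an instance of the abstract setting\<close>

text \<open>The Gibbs equation evaluates its integrand at \<open>insert x \<gamma>\<close>. For
  \<open>F (x, \<gamma>) = H (x, \<gamma> - {x})\<close> insertion and deletion cancel when x is
  outside \<gamma>, that is for almost every x. Almost every \<gamma> is good, so \<open>p\<close>
  is the true intensity there.\<close>

lemma GNZ:
  fixes H :: "'a \<times> 'a set \<Rightarrow> ennreal"
  assumes H: "H \<in> borel_measurable (borel \<Otimes>\<^sub>M config_space)"
  shows "(\<integral>\<^sup>+\<gamma>. (\<integral>\<^sup>+x. H (x, \<gamma> - {x}) \<partial>count_space \<gamma>) \<partial>G)
      = (\<integral>\<^sup>+\<gamma>. (\<integral>\<^sup>+x. H (x, \<gamma>) * ennreal (p x \<gamma>) \<partial>lborel) \<partial>G)"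
proof -
  define F where "F = (\<lambda>(x, \<gamma>). H (x, \<gamma> - {x}))"
  have F: "F \<in> borel_measurable (borel \<Otimes>\<^sub>M config_space)" unfolding F_def
    using H by measurable
  have "(\<integral>\<^sup>+\<gamma>. (\<integral>\<^sup>+x. H (x, \<gamma> - {x}) \<partial>count_space \<gamma>) \<partial>G) = (\<integral>\<^sup>+\<gamma>. (\<integral>\<^sup>+x. F (x, \<gamma>) \<partial>count_space \<gamma>) \<partial>G)"
    by (simp add: F_def)
  also have "\<dots> = (\<integral>\<^sup>+\<gamma>. ennreal z * (\<integral>\<^sup>+x. F (x, insert x \<gamma>) * boltzmann \<beta> (interaction u x \<gamma>) \<partial>lborel) \<partial>G)"
    using gibbs F by (simp add: gibbs_process_def)
  also have "\<dots> = (\<integral>\<^sup>+\<gamma>. (\<integral>\<^sup>+x. H (x, \<gamma>) * ennreal (p x \<gamma>) \<partial>lborel) \<partial>G)"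
  proof (rule nn_integral_cong_AE)
    show "AE \<gamma> in G. ennreal z * (\<integral>\<^sup>+x. F (x, insert x \<gamma>) * boltzmann \<beta> (interaction u x \<gamma>) \<partial>lborel)
        = (\<integral>\<^sup>+x. H (x, \<gamma>) * ennreal (p x \<gamma>) \<partial>lborel)"
      using AE_good AE_space
    proof eventually_elim
      fix \<gamma> assume g: "good \<gamma>" and "\<gamma> \<in> space G"
      then have \<gamma>: "\<gamma> \<in> locally_finite_sets" by (simp add: space_G)
      have p0m: "(\<lambda>x. papangelou0 x \<gamma>) \<in> borel_measurable borel"
        using measurable_Pair1[OF papangelou0_measurable, of \<gamma>] \<gamma> by simp
      have bm: "(\<lambda>x. boltzmann \<beta> (interaction u x \<gamma>)) \<in> borel_measurable borel"
      proof -
        have "boltzmann \<beta> (interaction u x \<gamma>) = ennreal (papangelou0 x \<gamma> / z)" for x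
        proof -
          have "ennreal (1 / z) * (ennreal z * boltzmann \<beta> (interaction u x \<gamma>))
              = ennreal (1 / z) * ennreal (papangelou0 x \<gamma>)"
            by (simp add: boltzmann_interaction)
          moreover have "ennreal (1 / z) * ennreal z = 1" using z by (simp add: ennreal_mult'[symmetric])
          ultimately show ?thesis using z by (simp add: mult.assoc[symmetric] ennreal_mult'[symmetric])
        qed
        then show ?thesis using p0m by simp
      qed
      have Hm: "(\<lambda>x. H (x, \<gamma>)) \<in> borel_measurable borel"
        using measurable_Pair1[OF H, of \<gamma>] \<gamma> by simp
      have "AE x in lborel. x \<notin> \<gamma>"
        using countable_imp_null_set_lborel[OF countable_locally_finite[OF \<gamma>]] AE_not_in by blast
      then have "(\<integral>\<^sup>+x. F (x, insert x \<gamma>) * boltzmann \<beta> (interaction u x \<gamma>) \<partial>lborel)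
          = (\<integral>\<^sup>+x. H (x, \<gamma>) * boltzmann \<beta> (interaction u x \<gamma>) \<partial>lborel)"
        by (intro nn_integral_cong_AE) (auto simp: F_def elim!: eventually_mono)
      then have "ennreal z * (\<integral>\<^sup>+x. F (x, insert x \<gamma>) * boltzmann \<beta> (interaction u x \<gamma>) \<partial>lborel)
        = (\<integral>\<^sup>+x. ennreal z * (H (x, \<gamma>) * boltzmann \<beta> (interaction u x \<gamma>)) \<partial>lborel)"
        using Hm bm by (simp add: nn_integral_cmult)
      also have "\<dots> = (\<integral>\<^sup>+x. H (x, \<gamma>) * ennreal (p x \<gamma>) \<partial>lborel)"
        using g by (intro nn_integral_cong) (simp add: p_def boltzmann_interaction[symmetric]
            mult.left_commute)
      finally show "ennreal z * (\<integral>\<^sup>+x. F (x, insert x \<gamma>) * boltzmann \<beta> (interaction u x \<gamma>) \<partial>lborel)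
          = (\<integral>\<^sup>+x. H (x, \<gamma>) * ennreal (p x \<gamma>) \<partial>lborel)" .
    qed
  qed
  finally show ?thesis .
qed

text \<open>The radius affects only \<open>Z n\<close>. \<open>K\<close>, \<open>C\<close> and
  \<Phi> are the same for all balls, and therefore so is \<open>variance_const\<close>. The index n
  is a natural number because \<open>good\<close> controls \<open>Psi\<close> for natural
  radii.\<close>

lemma papangelou_ball:
  assumes l: "l \<le> real n"
  shows "papangelou G (ball 0 l) p e (Z n) K C \<Phi>"
proof
  let ?c = "1 + z + 1 / (\<beta> * \<psi> r0)"
  have \<psi>0: "0 < \<psi> r0" using r0 by (simp add: \<psi>_pos)
  have c1: "1 \<le> ?c" and cz: "z \<le> ?c" and cb: "1 / (\<beta> * \<psi> r0) \<le> ?c" using z \<beta> \<psi>0 by simp_all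
  have Y0: "0 \<le> Y n \<gamma>" for \<gamma> using \<psi>0 by (simp add: Y_def)
  note [measurable] = measurable_card_config[OF measurable_ident_sets[OF refl], of "ball (0::'a) (real
      n)", simplified]
  show "Z n \<in> borel_measurable config_space" unfolding Z_def Y_def by measurable
  show "1 \<le> Z n \<gamma>" for \<gamma>
    unfolding Z_def using c1 \<beta> Y0[of \<gamma>] mult_mono[of 1 ?c 1 "exp (\<beta> * Y n \<gamma>)"] by simp
  show "p x \<gamma> \<le> Z n \<gamma>" if "x \<in> ball 0 l" "\<gamma> \<in> locally_finite_sets" for x \<gamma>
  proof (cases "good \<gamma>")
    case True
    then have fin: "Psi 0 (real n) \<gamma> < \<infinity>" by (simp add: good_def)
    have "p x \<gamma> \<le> z * exp (\<beta> * enn2real (Psi 0 (real n) \<gamma>))"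
      using papangelou0_le[OF _ fin, of x] that l by (simp add: p_def True)
    also have "\<dots> \<le> Z n \<gamma>" unfolding Z_def using fin cz z c1 by (intro mult_mono) (auto simp: Y_def)
    finally show ?thesis .
  next
    case False
    have "0 \<le> Z n \<gamma>" unfolding Z_def using c1 by (intro mult_nonneg_nonneg) auto
    then show ?thesis using False by (simp add: p_def)
  qed
  show "real (card (\<gamma> \<inter> ball 0 l)) \<le> Z n \<gamma>" if \<gamma>: "\<gamma> \<in> locally_finite_sets" for \<gamma>
  proof -
    have "card (\<gamma> \<inter> ball 0 l) \<le> card (\<gamma> \<inter> ball 0 (real n))"
      using \<gamma> l by (intro card_mono finite_Int_bounded) auto
    then have "\<beta> * (\<psi> r0 * real (card (\<gamma> \<inter> ball 0 l))) \<le> \<beta> * (\<psi> r0 * real (card (\<gamma> \<inter> ball 0 (real n))))"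
      using \<beta> \<psi>0 by (intro mult_left_mono) auto
    also have "\<dots> \<le> \<beta> * Y n \<gamma>" using \<beta> card_le_Y[OF \<gamma>] by (intro mult_left_mono) auto
    also have "\<dots> \<le> exp (\<beta> * Y n \<gamma>)" using exp_ge_add_one_self[of "\<beta> * Y n \<gamma>"] by linarith
    finally have "real (card (\<gamma> \<inter> ball 0 l)) \<le> 1 / (\<beta> * \<psi> r0) * exp (\<beta> * Y n \<gamma>)"
      using \<beta> \<psi>0 by (simp add: field_simps)
    also have "\<dots> \<le> Z n \<gamma>" unfolding Z_def by (intro mult_right_mono cb) simp
    finally show ?thesis .
  qed
  show "Z n (insert x \<gamma>) \<le> K * Z n \<gamma>" if \<gamma>: "\<gamma> \<in> locally_finite_sets" for x \<gamma>
  proof -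
    have "\<beta> * Y n (insert x \<gamma>) \<le> \<beta> * (\<psi> r0 + Y n \<gamma>)" using \<beta> Y_insert(2)[OF \<gamma>] by (intro mult_left_mono) auto
    then have "exp (\<beta> * Y n (insert x \<gamma>)) \<le> K * exp (\<beta> * Y n \<gamma>)"
      unfolding K_def exp_add[symmetric] by (simp add: distrib_left)
    then have "?c * exp (\<beta> * Y n (insert x \<gamma>)) \<le> ?c * (K * exp (\<beta> * Y n \<gamma>))" using c1
        by (intro mult_left_mono) auto
    then show ?thesis by (simp add: Z_def mult_ac)
  qed
  show "Z n \<gamma> \<le> Z n (insert x \<gamma>)" if "\<gamma> \<in> locally_finite_sets" for x \<gamma>
    unfolding Z_def using c1 \<beta> Y_insert(1)[OF that] by (intro mult_left_mono) auto
  show "0 \<le> C" using z by (simp add: C_def)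
  show "0 \<le> \<Phi>" using psi_mass_nonneg \<beta> \<psi>0 by (simp add: \<Phi>_def)
  show "p y (insert x \<gamma>) = p y \<gamma> * e (y - x)" if "x \<notin> \<gamma>" for x y \<gamma> using that by (rule p_insert)
qed (fact sets_G p_measurable p_nonneg e_measurable e_nonneg e_le e_even K_ge_1 GNZ Z_moments p_moments
    e_integral | simp)+

end

section \<open>The lower bound\<close>

lemma pair_energy_eq_nn_integral:
  assumes \<gamma>: "\<gamma> \<in> locally_finite_sets" and B: "bounded B" and k: "\<And>x. 0 \<le> k x"
  shows "(\<integral>\<^sup>+t. ennreal (k (t 0 - t 1)) * (indicator B (t 0) * indicator B (t 1))
      \<partial>count_space (distinct_tuples 2 \<gamma>))
    = ennreal (pair_energy k B \<gamma>)"
proof -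
  let ?X = "\<gamma> \<inter> B"
  have fin: "finite ?X" by (rule finite_Int_bounded[OF \<gamma> B])
  have mem: "t \<in> distinct_tuples 2 A \<longleftrightarrow> t \<in> extensional {..<2} \<and> t 0 \<in> A \<and> t 1 \<in> A \<and> t 0 \<noteq> t 1"
      for t :: "nat \<Rightarrow> 'a" and A
  proof -
    have "{..<2} = {0, 1::nat}" by auto
    then show ?thesis by (auto simp: distinct_tuples_def PiE_iff)
  qed
  have sub: "distinct_tuples 2 ?X \<subseteq> distinct_tuples 2 \<gamma>" by (auto simp: mem)
  have "(\<integral>\<^sup>+t. ennreal (k (t 0 - t 1)) * (indicator B (t 0) * indicator B (t 1))
      \<partial>count_space (distinct_tuples 2 \<gamma>))
    = (\<integral>\<^sup>+t. ennreal (k (t 0 - t 1)) * indicator (distinct_tuples 2 ?X) t \<partial>count_space (distinct_tuples 2 \<gamma>))"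
    by (intro nn_integral_cong) (auto simp: indicator_def mem)
  also have "\<dots> = (\<integral>\<^sup>+t. ennreal (k (t 0 - t 1)) \<partial>count_space (distinct_tuples 2 ?X))"
    using sub by (subst nn_integral_restrict_space[symmetric]) (auto simp: restrict_count_space
        Int_absorb1 Int_absorb2)
  also have "\<dots> = (\<Sum>t\<in>distinct_tuples 2 ?X. ennreal (k (t 0 - t 1)))"
    by (rule nn_integral_count_space_finite[OF finite_distinct_tuples[OF fin]])
  also have "\<dots> = ennreal (\<Sum>t\<in>distinct_tuples 2 ?X. k (t 0 - t 1))"
    by (rule sum_ennreal) (simp add: k)
  also have "(\<Sum>t\<in>distinct_tuples 2 ?X. k (t 0 - t 1)) = pair_energy k B \<gamma>"
    unfolding pair_energy_def
  proof (rule sum.reindex_bij_witness[where j="\<lambda>t. (t 0, t 1)" and i="\<lambda>(x, y). pair_point x y"])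
    fix t assume "t \<in> distinct_tuples 2 ?X"
    then show "(case (t 0, t 1) of (x, y) \<Rightarrow> pair_point x y) = t"
      by (auto simp: mem pair_point_def fun_eq_iff extensional_def restrict_def less_2_cases_iff)
  qed (auto simp: mem pair_point_def)
  finally show ?thesis .
qed

context gibbs_setting begin

section \<open>Expected pair energy through the pair correlation\<close>

context
  assumes inv: "translation_invariant2 (\<rho> 2)"
begin

abbreviation "pc \<equiv> pair_correlation \<rho>"

lemma \<rho>2_measurable: "\<rho> 2 \<in> borel_measurable (PiM {..<2::nat} (\<lambda>_. lborel))" and \<rho>2_nonneg: "0 \<le> \<rho> 2 t"
  using corr[of 2] by (auto simp: is_correlation_function_def)

lemma pc_measurable [measurable]: "pc \<in> borel_measurable borel"
proof -
  have "(\<lambda>x. pair_point x (0::'a)) \<in> borel \<rightarrow>\<^sub>M PiM {..<2::nat} (\<lambda>_. lborel)"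
    unfolding pair_point_def by (rule measurable_restrict) auto
  from measurable_compose[OF this \<rho>2_measurable] show ?thesis
    by (simp add: pair_correlation_def[abs_def])
qed

lemma \<rho>2_eq_pc:
  assumes "t \<in> space (PiM {..<2::nat} (\<lambda>_. lborel :: 'a measure))"
  shows "\<rho> 2 t = pc (t 0 - t 1)"
proof -
  have "t = pair_point (t 0) (t 1)"
    using assms by (auto simp: pair_point_def fun_eq_iff space_PiM PiE_def extensional_def restrict_def
        less_2_cases_iff)
  then have "\<rho> 2 t = \<rho> 2 (pair_point (t 0) (t 1))" by simp
  also have "\<dots> = \<rho> 2 (pair_point (t 0 + - t 1) (t 1 + - t 1))"
    using inv unfolding translation_invariant2_def by metis
  finally show ?thesis by (simp add: pair_correlation_def)
qed

lemma pair_energy_expectation: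
  assumes [measurable]: "k \<in> borel_measurable borel" "B \<in> sets borel" and B: "bounded B" and k: "\<And>x. 0 \<le> k x"
  shows "(\<integral>\<^sup>+\<gamma>. ennreal (pair_energy k B \<gamma>) \<partial>G) =
    (\<integral>\<^sup>+y. \<integral>\<^sup>+x. ennreal (k (x - y) * pc (x - y)) * (indicator B x * indicator B y) \<partial>lborel \<partial>lborel)"
proof -
  interpret product_sigma_finite "\<lambda>_::nat. lborel :: 'a measure" ..
  define F where "F = (\<lambda>t::nat \<Rightarrow> 'a. ennreal (k (t 0 - t 1)) * (indicator B (t 0) * indicator B (t 1)))"
  define f where "f = (\<lambda>x y. ennreal (k (x - y) * pc (x - y)) * (indicator B x * indicator B y))"
  have F: "F \<in> borel_measurable (PiM {..<2::nat} (\<lambda>_. lborel))" unfolding F_def by measurable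
  have fm: "case_prod f \<in> borel_measurable (lborel \<Otimes>\<^sub>M lborel)" unfolding f_def by measurable
  have two: "{..<2} = {0, 1::nat}" by auto
  have "(\<integral>\<^sup>+\<gamma>. ennreal (pair_energy k B \<gamma>) \<partial>G) = (\<integral>\<^sup>+\<gamma>. (\<integral>\<^sup>+t. F t \<partial>count_space (distinct_tuples 2 \<gamma>)) \<partial>G)"
    unfolding F_def by (intro nn_integral_cong pair_energy_eq_nn_integral[symmetric] B k) (simp add: space_G)
  also have "\<dots> = (\<integral>\<^sup>+t. F t * ennreal (\<rho> 2 t) \<partial>PiM {..<2::nat} (\<lambda>_. lborel))"
    using corr[of 2] F by (simp add: is_correlation_function_def)
  also have "\<dots> = (\<integral>\<^sup>+t. f (t 0) (t 1) \<partial>PiM {..<2::nat} (\<lambda>_. lborel))"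
    by (intro nn_integral_cong) (simp add: F_def f_def \<rho>2_eq_pc ennreal_mult' k mult_ac)
  also have "\<dots> = (\<integral>\<^sup>+w. f (fst w) (snd w) \<partial>(lborel \<Otimes>\<^sub>M lborel))"
    unfolding two by (rule product_nn_integral_pair[OF fm]) simp
  also have "\<dots> = (\<integral>\<^sup>+y. \<integral>\<^sup>+x. f x y \<partial>lborel \<partial>lborel)"
    using lborel_pair.nn_integral_snd[of "\<lambda>w. f (fst w) (snd w)"] fm by (simp add: case_prod_beta')
  finally show ?thesis by (simp add: f_def)
qed

text \<open>For y in the ball of radius \<open>l - R\<close> the support of \<open>k (x - y)\<close>
  in x lies inside the window, and the inner integral is the full one. All other y are dropped,
  which is possible because the integrand is nonnegative.\<close>

lemma pair_energy_expectation_ge: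
  assumes k[measurable]: "k \<in> borel_measurable borel" and k0: "\<And>x. 0 \<le> k x"
    and supp: "\<And>x. R < norm x \<Longrightarrow> k x = 0"
  shows "(\<integral>\<^sup>+x. ennreal (k x * pc x) \<partial>lborel) * emeasure lborel (ball (0::'a) (l - R))
    \<le> (\<integral>\<^sup>+\<gamma>. ennreal (pair_energy k (ball 0 l) \<gamma>) \<partial>G)"
proof -
  let ?A = "\<integral>\<^sup>+x. ennreal (k x * pc x) \<partial>lborel"
  have "?A * emeasure lborel (ball (0::'a) (l - R)) = (\<integral>\<^sup>+y. ?A * indicator (ball (0::'a) (l - R)) y \<partial>lborel)"
    by (simp add: nn_integral_cmult_indicator)
  also have "\<dots> \<le> (\<integral>\<^sup>+y. \<integral>\<^sup>+x. ennreal (k (x - y) * pc (x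
      - y)) * (indicator (ball 0 l) x * indicator (ball 0 l) y) \<partial>lborel \<partial>lborel)"
  proof (rule nn_integral_mono)
    fix y :: 'a
    show "?A * indicator (ball 0 (l - R)) y
        \<le> (\<integral>\<^sup>+x. ennreal (k (x - y) * pc (x - y)) * (indicator (ball 0 l) x * indicator (ball 0 l) y)
        \<partial>lborel)"
    proof (cases "y \<in> ball 0 (l - R)")
      case True
      have "?A = (\<integral>\<^sup>+x. ennreal (k x * pc x) \<partial>distr lborel borel ((+) (- y)))"
        by (simp add: lborel_distr_plus)
      also have "\<dots> = (\<integral>\<^sup>+x. ennreal (k (x - y) * pc (x - y)) \<partial>lborel)"
        by (subst nn_integral_distr) simp_all
      also have "\<dots> \<le> (\<integral>\<^sup>+x. ennreal (k (x - y) * pc (x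
          - y)) * (indicator (ball 0 l) x * indicator (ball 0 l) y) \<partial>lborel)"
      proof (rule nn_integral_mono)
        fix x :: 'a
        show "ennreal (k (x - y) * pc (x - y))
            \<le> ennreal (k (x - y) * pc (x - y)) * (indicator (ball 0 l) x * indicator (ball 0 l) y)"
        proof (cases "R < norm (x - y)")
          case True
          then show ?thesis by (simp add: supp)
        next
          case False
          have "norm x \<le> norm (x - y) + norm y" using norm_triangle_ineq[of "x - y" y] by simp
          then have "x \<in> ball 0 l" using False True by simp
          show ?thesis
          proof (cases "y \<in> ball 0 l")
            case True
            then show ?thesis using \<open>x \<in> ball 0 l\<close> by simp
          next
            \<comment> \<open>Here y lies in the ball of radius \<open>l - R\<close> but not in that
              of radius l, so R is negative and k vanishes identically.\<close>
            case False
            then have "R < 0" using \<open>y \<in> ball 0 (l - R)\<close> by simp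
            then show ?thesis using supp[of "x - y"] by (simp add: less_le_trans[OF _ norm_ge_zero])
          qed
        qed
      qed
      finally show ?thesis using True by simp
    qed simp
  qed
  also have "\<dots> = (\<integral>\<^sup>+\<gamma>. ennreal (pair_energy k (ball 0 l) \<gamma>) \<partial>G)"
    by (rule pair_energy_expectation[symmetric]) (auto intro: k0)
  finally show ?thesis .
qed

section \<open>The limit of large balls\<close>

text \<open>The 4 is the square of the factor 2 in \<open>variance_lower_bound\<close>; adding 1
  keeps the denominator positive.\<close>

definition c :: real where "c = 4 / (papangelou.variance_const K C \<Phi> + 1)"

lemma variance_const_nonneg: "0 \<le> papangelou.variance_const K C \<Phi>"
proof -
  \<comment> \<open>\<open>variance_const\<close> depends on \<open>K\<close>, \<open>C\<close> and
    \<Phi> alone, so any window may be used, here the empty ball.\<close>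
  interpret papangelou G "ball 0 0" p e "Z 0" K C \<Phi> by (rule papangelou_ball) simp
  show ?thesis by (rule variance_const_nonneg)
qed

lemma c_pos: "0 < c" using variance_const_nonneg by (simp add: c_def)

context
  fixes v :: "'a \<Rightarrow> real"
  assumes v[measurable]: "v \<in> borel_measurable borel" and v_even: "\<And>x. v (- x) = v x"
    and v2: "integrable lborel (\<lambda>x. (v x)\<^sup>2)" and vnz: "\<not> (AE x in lborel. v x = 0)"
begin

text \<open>Bounded, as the test functional requires, and supported in a ball of radius n, so that
  the boundary layer has a fixed width.\<close>

definition w :: "nat \<Rightarrow> 'a \<Rightarrow> real" where "w n x = (if \<bar>v x\<bar> \<le> real n \<and> norm x \<le> real n then v x else 0)"

lemma w_measurable [measurable]: "w n \<in> borel_measurable borel" unfolding w_def by measurable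

lemma v2_pos: "0 < (\<integral>x. (v x)\<^sup>2 \<partial>lborel)"
proof -
  have "(\<integral>x. (v x)\<^sup>2 \<partial>lborel) \<noteq> 0"
    using vnz integral_nonneg_eq_0_iff_AE[OF v2] by auto
  then show ?thesis by (simp add: less_le)
qed

text \<open>\<open>variance_lower_bound\<close> for the truncation \<open>w n\<close>, with the
  expected energy of its square bounded below by \<open>pair_energy_expectation_ge\<close>. The
  power of \<open>(l - real n) / l\<close> is the ratio of the volumes of the inner ball and the
  window.\<close>

lemma finite_volume_bound:
  assumes l: "real n < l"
  shows "(\<integral>\<^sup>+x. ennreal ((w n x)\<^sup>2 * pc x) \<partial>lborel) < \<infinity>"
    "c / (\<integral>x. (v x)\<^sup>2 \<partial>lborel) * (((l
        - real n) / l) ^ DIM('a) * enn2real (\<integral>\<^sup>+x. ennreal ((w n x)\<^sup>2 * pc x) \<partial>lborel))\<^sup>2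
      \<le> variance (pair_energy v (ball 0 l)) / measure lborel (ball (0::'a) l)"
proof -
  obtain N :: nat where N: "l \<le> real N" using real_arch_simple by blast
  interpret papangelou G "ball 0 l" p e "Z N" K C \<Phi> by (rule papangelou_ball[OF N])
  let ?A = "\<integral>\<^sup>+x. ennreal ((w n x)\<^sup>2 * pc x) \<partial>lborel" and ?S = "\<integral>x. (v x)\<^sup>2 \<partial>lborel"
  let ?E = "\<integral>\<gamma>. pair_energy (\<lambda>x. (w n x)\<^sup>2) (ball 0 l) \<gamma> \<partial>G"
  let ?m = "measure lborel (ball (0::'a) l)" and ?m' = "measure lborel (ball (0::'a) (l - real n))"
  let ?Var = "variance (pair_energy v (ball 0 l))"
  have "\<bar>(w n (x - y))\<^sup>2\<bar> \<le> (real n)\<^sup>2" for x y :: 'a by (auto simp: w_def abs_le_square_iff[symmetric])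
  moreover have "(\<lambda>(x, y). (w n (x - y))\<^sup>2) \<in> borel_measurable (borel \<Otimes>\<^sub>M (borel :: 'a measure))"
      by measurable
  ultimately have T: "tame1 (energy (\<lambda>x y. (w n (x - y))\<^sup>2))" by (rule tame1_energy)
  have "integrable G (energy (\<lambda>x y. (w n (x - y))\<^sup>2))"
    using T by (intro pb_integrable) (auto simp: tame1_def)
  then have int: "integrable G (pair_energy (\<lambda>x. (w n x)\<^sup>2) (ball 0 l))"
    by (subst Bochner_Integration.integrable_cong[OF refl, of _ _ "energy (\<lambda>x y. (w n (x
        - y))\<^sup>2)"]) (auto simp: pair_energy_eq_energy)
  have pe0: "0 \<le> pair_energy (\<lambda>x. (w n x)\<^sup>2) (ball 0 l) \<gamma>" for \<gamma>
    by (auto simp: pair_energy_def intro!: sum_nonneg)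
  have "?A * emeasure lborel (ball (0::'a) (l - real n))
      \<le> (\<integral>\<^sup>+\<gamma>. ennreal (pair_energy (\<lambda>x. (w n x)\<^sup>2) (ball 0 l) \<gamma>) \<partial>G)"
    by (rule pair_energy_expectation_ge) (auto simp: w_def)
  also have "\<dots> = ennreal ?E" by (rule nn_integral_eq_integral[OF int]) (simp add: pe0)
  also have "emeasure lborel (ball (0::'a) (l - real n)) = ennreal ?m'"
    using emeasure_bounded_finite[of "ball (0::'a) (l - real n)"] by (intro emeasure_eq_ennreal_measure) auto
  finally have le: "?A * ennreal ?m' \<le> ennreal ?E" .
  have m': "?m' = unit_ball_vol (DIM('a)) * (l - real n) ^ DIM('a)" using l by (simp add: content_ball)
  have m: "?m = unit_ball_vol (DIM('a)) * l ^ DIM('a)" using l by (simp add: content_ball)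
  have pos: "0 < ?m'" "0 < ?m" using l by (auto simp: m m')
  show fin: "?A < \<infinity>"
  proof (rule ccontr)
    \<comment> \<open>The pair energy of a bounded kernel has finite expectation and the inner ball
      has positive volume, so an infinite integral contradicts \<open>le\<close>.\<close>
    assume "\<not> ?A < \<infinity>"
    then have "?A = \<infinity>" by (simp only: infinity_ennreal_def top.not_eq_extremum[symmetric] not_not)
    then show False using le pos by (simp add: ennreal_top_mult top_unique)
  qed
  let ?a = "enn2real ?A"
  have "ennreal (?a * ?m') \<le> ennreal ?E" using le fin by (simp add: ennreal_mult'')
  then have aE: "?a * ?m' \<le> ?E" using pe0 by (subst (asm) ennreal_le_iff) auto
  have quot: "4 * X / T \<le> W / M" if "4 * X * M \<le> W * T" "0 < M" "0 < T" for X M W T :: real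
    using that by (simp add: field_simps)
  have ratio: "((l - real n) / l) ^ DIM('a) * ?m = ?m'" using l by (simp add: m m' power_divide)
  have "4 * (((l - real n) / l) ^ DIM('a) * ?a)\<^sup>2 * ?m\<^sup>2 = (2 * (?a * ?m'))\<^sup>2"
    unfolding ratio[symmetric] by (simp add: power_mult_distrib mult_ac)
  also have "\<dots> \<le> (2 * ?E)\<^sup>2" using aE pos by (intro power_mono) auto
  also have "\<dots> \<le> ?Var * (variance_const * (?m * ?S))"
  proof (rule variance_lower_bound[OF v _ v2, where M="real n"])
    show "\<bar>w n x\<bar> \<le> real n" "w n x \<noteq> 0 \<Longrightarrow> v x = w n x" for x by (auto simp: w_def split: if_splits)
  qed (auto simp: v_even)
  also have "\<dots> \<le> ?Var * ((variance_const + 1) * (?m * ?S))"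
    using pos v2_pos by (intro mult_left_mono mult_right_mono) auto
  finally have "4 * (((l - real n) / l) ^ DIM('a) * ?a)\<^sup>2 * ?m * ?m
      \<le> (?Var * ((variance_const + 1) * ?S)) * ?m"
    by (simp add: power2_eq_square[of ?m] mult_ac)
  then have "4 * (((l - real n) / l) ^ DIM('a) * ?a)\<^sup>2 * ?m \<le> ?Var * ((variance_const + 1) * ?S)"
    using pos(2) by (rule mult_right_le_imp_le)
  then show "c / ?S * (((l - real n) / l) ^ DIM('a) * ?a)\<^sup>2 \<le> ?Var / ?m"
    using quot[of "(((l - real n) / l) ^ DIM('a) * ?a)\<^sup>2" ?m ?Var "(variance_const
        + 1) * ?S"] pos v2_pos variance_const_nonneg
    by (simp add: c_def)
qed

text \<open>For fixed n the boundary layer is negligible as l grows: the volume ratio tends to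
  1.\<close>

lemma liminf_bound_truncated:
  "ereal (c / (\<integral>x. (v x)\<^sup>2 \<partial>lborel) * (enn2real (\<integral>\<^sup>+x. ennreal ((w n x)\<^sup>2 * pc x) \<partial>lborel))\<^sup>2)
    \<le> Liminf at_top (\<lambda>l::real. ereal (variance (pair_energy v (ball 0 l)) / measure lborel (ball (0::'a) l)))"
proof -
  let ?a = "enn2real (\<integral>\<^sup>+x. ennreal ((w n x)\<^sup>2 * pc x) \<partial>lborel)" and ?S = "\<integral>x. (v x)\<^sup>2 \<partial>lborel"
  have "((\<lambda>l::real. (l - real n) / l) \<longlongrightarrow> 1) at_top"
  proof -
    have "((\<lambda>l::real. 1 - real n / l) \<longlongrightarrow> 1 - 0) at_top"
      by (intro tendsto_diff tendsto_const tendsto_divide_0[OF tendsto_const]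
          filterlim_at_top_imp_at_infinity filterlim_ident)
    then have "((\<lambda>l::real. 1 - real n / l) \<longlongrightarrow> 1) at_top" by simp
    then show ?thesis
      by (rule Lim_transform_eventually)
        (use eventually_gt_at_top[of 0] in eventually_elim, simp_all add: diff_divide_distrib)
  qed
  then have "((\<lambda>l. ereal (c / ?S * (((l
      - real n) / l) ^ DIM('a) * ?a)\<^sup>2)) \<longlongrightarrow> ereal (c / ?S * (1 ^ DIM('a) * ?a)\<^sup>2)) at_top"
    by (intro tendsto_intros)
  then have "ereal (c / ?S * ?a\<^sup>2)
      = Liminf at_top (\<lambda>l. ereal (c / ?S * (((l - real n) / l) ^ DIM('a) * ?a)\<^sup>2))"
    by (intro lim_imp_Liminf[symmetric]) simp_all
  also have "\<dots> \<le> Liminf at_top (\<lambda>l::real. ereal (variance (pair_energy v (ball 0 l)) / measure lborel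
      (ball (0::'a) l)))"
  proof (rule Liminf_mono)
    show "\<forall>\<^sub>F l in at_top. ereal (c / ?S * (((l - real n) / l) ^ DIM('a) * ?a)\<^sup>2)
        \<le> ereal (variance (pair_energy v (ball 0 l)) / measure lborel (ball (0::'a) l))"
      using eventually_gt_at_top[of "real n"]
      by eventually_elim (unfold ereal_less_eq, rule finite_volume_bound(2))
  qed
  finally show ?thesis .
qed

text \<open>The truncation is removed only after the limit in l, by dominated convergence in n; the
  liminf on the right does not depend on n.\<close>

lemma liminf_bound:
  "ereal (c / (\<integral>x. (v x)\<^sup>2 \<partial>lborel) * (\<integral>x. (v x)\<^sup>2 * pc x \<partial>lborel)\<^sup>2)
    \<le> Liminf at_top (\<lambda>l::real. ereal (variance (pair_energy v (ball 0 l)) / measure lborel (ball (0::'a) l)))"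
proof -
  let ?S = "\<integral>x. (v x)\<^sup>2 \<partial>lborel"
  let ?a = "\<lambda>n. enn2real (\<integral>\<^sup>+x. ennreal ((w n x)\<^sup>2 * pc x) \<partial>lborel)"
  have pc0: "0 \<le> pc x" for x by (simp add: pair_correlation_def \<rho>2_nonneg)
  show ?thesis
  proof (cases "integrable lborel (\<lambda>x. (v x)\<^sup>2 * pc x)")
    case True
    have a: "?a n = (\<integral>x. (w n x)\<^sup>2 * pc x \<partial>lborel)" for n
      by (rule integral_eq_nn_integral[symmetric]) (auto simp: pc0)
    have "(\<lambda>n. \<integral>x. (w n x)\<^sup>2 * pc x \<partial>lborel) \<longlonglongrightarrow> (\<integral>x. (v x)\<^sup>2 * pc x \<partial>lborel)"
    proof (rule integral_dominated_convergence[OF _ _ True])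
      show "AE x in lborel. (\<lambda>n. (w n x)\<^sup>2 * pc x) \<longlonglongrightarrow> (v x)\<^sup>2 * pc x"
      proof (intro AE_I2 tendsto_mult tendsto_power tendsto_const tendsto_eventually)
        fix x
        obtain N :: nat where N: "max \<bar>v x\<bar> (norm x) \<le> real N" using real_arch_simple by blast
        show "\<forall>\<^sub>F n in sequentially. w n x = v x"
          by (rule eventually_sequentiallyI[of N]) (use N in \<open>auto simp: w_def\<close>)
      qed
      show "AE x in lborel. norm ((w n x)\<^sup>2 * pc x) \<le> (v x)\<^sup>2 * pc x" for n
        by (intro AE_I2) (auto simp: w_def pc0)
    qed measurable
    then have "(\<lambda>n. ereal (c / ?S * (?a n)\<^sup>2)) \<longlonglongrightarrow> ereal (c / ?S * (\<integral>x. (v x)\<^sup>2 * pc x \<partial>lborel)\<^sup>2)"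
      unfolding a by (intro tendsto_intros)
    then show ?thesis by (rule LIMSEQ_le_const2) (use liminf_bound_truncated in blast)
  next
    case False
    \<comment> \<open>A nonintegrable integrand gives the value 0, and the truncated bound for n =
      0, whose left side is nonnegative, is enough.\<close>
    then have "(\<integral>x. (v x)\<^sup>2 * pc x \<partial>lborel) = 0" by (rule not_integrable_integral_eq)
    moreover have "0 \<le> c / ?S * (?a 0)\<^sup>2"
      using c_pos v2_pos by (intro mult_nonneg_nonneg) auto
    ultimately have "ereal (c / ?S * (\<integral>x. (v x)\<^sup>2 * pc x \<partial>lborel)\<^sup>2) \<le> ereal (c / ?S * (?a 0)\<^sup>2)"
      by (simp only: power_zero_numeral mult_zero_right ereal_less_eq)
    also note liminf_bound_truncated
    finally show ?thesis .
  qed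
qed

end

end

end

theorem theorem4p4:
  fixes \<beta> z :: real
    and u :: "'a::euclidean_space \<Rightarrow> ereal"
    and G :: "'a set measure"
    and \<rho> :: "nat \<Rightarrow> (nat \<Rightarrow> 'a) \<Rightarrow> real"
  assumes "0 < \<beta>" and "0 < z"
    and "superstable u"
    and "gibbs_process \<beta> z u G"
    and "\<And>n. 1 \<le> n \<Longrightarrow> is_correlation_function G n (\<rho> n)"
    and "translation_invariant2 (\<rho> 2)"
    and "ruelle_bound \<rho>"
  shows "\<exists>c>0. \<forall>v :: 'a \<Rightarrow> real.
           v \<in> borel_measurable borel \<and> (\<forall>x. v (- x) = v x) \<and>
           integrable lborel v \<and> integrable lborel (\<lambda>x. (v x)\<^sup>2) \<and>
           \<not> (AE x in lborel. v x = 0) \<longrightarrow>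
           ereal (c / (LINT x|lborel. (v x)\<^sup>2) *
                  (LINT x|lborel. (v x)\<^sup>2 * pair_correlation \<rho> x)\<^sup>2)
           \<le> Liminf at_top (\<lambda>l::real.
               ereal (prob_space.variance G (pair_energy v (ball 0 l))
                      / measure lborel (ball (0::'a) l)))"
proof -
  obtain r0 and \<phi> \<psi> :: "real \<Rightarrow> real" where u: "u \<in> borel_measurable borel" "\<forall>x. u x \<noteq> -\<infinity>"
    "\<forall>x. u (- x) = u x" "u 0 = \<infinity>" "0 < r0" "\<forall>r\<in>{0<..<r0}. 0 < \<phi> r"
    "antimono_on {0..} \<psi>" "\<forall>r\<in>{0..}. 0 < \<psi> r"
    "(\<integral>\<^sup>+r\<in>{r0..}. ennreal (r ^ (DIM('a) - 1) * \<psi> r) \<partial>lborel) < \<infinity>"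
    "\<forall>x. 0 < norm x \<and> norm x < r0 \<longrightarrow> ereal (\<phi> (norm x)) \<le> u x"
    "\<forall>x. r0 \<le> norm x \<longrightarrow> \<bar>u x\<bar> \<le> ereal (\<psi> (norm x))"
    using \<open>superstable u\<close> unfolding superstable_def by blast
  obtain q where q: "0 < q" "\<forall>n\<ge>1. AE x in PiM {..<n} (\<lambda>_. lborel). \<rho> n x \<le> q ^ n"
    using \<open>ruelle_bound \<rho>\<close> unfolding ruelle_bound_def by blast
  interpret gibbs_setting \<beta> z q r0 u G \<rho> \<phi> \<psi>
    by unfold_locales (use assms u q in auto)
  show ?thesis
    using c_pos[OF assms(6)] liminf_bound[OF assms(6)] by blast
qed

end
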